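(* Let $\lambda$ be a two-column partition of $n$ (i.e. $\lambda\in \mathrm{Par}_n^{\le2}$) and $\mathfrak t\in\mathrm{Std}(\lambda)$. Then $\mathbb E'_{\mathfrak t}=\mathbb E_{\mathfrak t}$ in $\mathsf{TL}_n^{\mathbb Q}$. In particular, the elements $\mathbb E'_{\mathfrak t}$, with $\mathfrak t$ running over $\mathrm{Std}(\mathrm{Par}_n^{\le2})$, form a complete set of primitive idempotents for $\mathsf{TL}_n^{\mathbb Q}$ (i.e. they are primitive, pairwise orthogonal idempotents with sum $1$).
   Context: **Temperley-Lieb algebra.** $\mathsf{TL}_n^{\mathbb Q}$ is the $\mathbb Q$-algebra with basis the non-crossing planar matchings (diagrams) of $n$ top and $n$ bottom points; $D_1D_2$ is the concatenation with $D_1$ on top of $D_2$, each closed loop being replaced by the scalar $2$. $u_i$ ($1\le i<n$) is the diagram joining the top points $i,i+1$, joining the bottom points $i,i+1$, and with vertical lines elsewhere. More generally, let $\mathrm{Hom}(a,b)$ be the $\mathbb Q$-span of non-crossing matchings with $a$ top and $b$ bottom points, composed in the same way. $\ast:\mathrm{Hom}(a,b)\to\mathrm{Hom}(b,a)$ is the linear map reflecting diagrams in a horizontal axis. $\mathbf{JW}_m\in\mathsf{TL}_m^{\mathbb Q}$ is the Jones-Wenzl idempotent: the unique nonzero idempotent with $u_i\mathbf{JW}_m=\mathbf{JW}_mu_i=0$ for all $i$. **Tableaux.** $\mathrm{Par}_n^{\le2}$ is the set of partitions of $n$ whose Young diagram has at most two columns; $\mathrm{Std}(\lambda)$ is the set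 of standard $\lambda$-tableaux and $\mathrm{Std}(\mathrm{Par}_n^{\le2})=\bigcup_{\lambda\in\mathrm{Par}_n^{\le2}}\mathrm{Std}(\lambda)$. The content is $c_{\mathfrak t}(i)=c-r$ if $i$ is in row $r$ and column $c$ of $\mathfrak t$. **The idempotents $\mathbb E_{\mathfrak t}$.** $\Phi:\mathbb Q\mathfrak S_n\to\mathsf{TL}_n^{\mathbb Q}$ is the surjective algebra homomorphism with $\Phi((i,i+1))=u_i-1$. $L_1=0$, $L_i=(1,i)+(2,i)+\dots+(i-1,i)$ for $i\ge2$, and $\mathbf L_i:=\Phi(L_i)$. With $\mathcal C=\{c_{\mathfrak s}(i)\mid 1\le i\le n,\ \mathfrak s\in\mathrm{Std}(\mathrm{Par}_n^{\le2})\}$, put $$\mathbb E_{\mathfrak t}=\prod_{c\in\mathcal C}\ \prod_{\substack{1\le i\le n\\ c\ne c_{\mathfrak t}(i)}}\frac{\mathbf L_i-c}{c_{\mathfrak t}(i)-c}\in\mathsf{TL}_n^{\mathbb Q}.$$ **The elements $f_{\mathfrak t}$ and $\mathbb E'_{\mathfrak t}$.** A two-column standard tableau $\mathfrak t$ determines a unique sequence of consecutive blocks of consecutive integers $D_1,M_1,D_2,M_2,\dots,D_k,M_k$ (in increasing order, with union $\{1,\dots,n\}$), all non-empty except that $M_k$ may be empty, such that the $D_i$ lie in the first column and the $M_i$ in the second. Put $d_i=|D_i|$, $m_i=|M_i|$, $n_i=(d_1+\dots+d_i)-(m_1+\dots+m_{i-1})$. Define $g_0$ to be the empty diagram and, recursively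 for $i=1,\dots,k$: juxtapose $d_i$ vertical lines to the right of $g_{i-1}$; multiply on top by $\mathbf{JW}_{n_i}$; then bend the $m_i$ rightmost top strands around to the right and down to the bottom (without crossings), producing $m_i$ new rightmost bottom points; the result is $g_i\in\mathrm{Hom}(n_i-m_i,\sum_{j\le i}(d_j+m_j))$. Put $f_{\mathfrak t}:=g_k\in\mathrm{Hom}(n_k-m_k,n)$, let $f_{\mathfrak t\mathfrak t}\in\mathsf{TL}_n^{\mathbb Q}$ be the concatenation of $f_{\mathfrak t}^{\ast}$ (on top) with $f_{\mathfrak t}$ (below), and let $$\gamma_{\mathfrak t}=\prod_{i=1}^k\frac{n_i+1}{n_i-m_i+1},\qquad \mathbb E'_{\mathfrak t}:=\frac1{\gamma_{\mathfrak t}}f_{\mathfrak t\mathfrak t}\in\mathsf{TL}_n^{\mathbb Q}.$$ *)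

theory Defs
  imports
    Complex_Main
    "HOL-Library.Poly_Mapping"
    "HOL-Library.Disjoint_Sets"
    "HOL-Library.FuncSet"
    "HOL-Combinatorics.Permutations"
    "HOL-Algebra.Ring"
begin

section \<open>Formal rational linear combinations\<close>

definition scale :: "rat \<Rightarrow> ('a \<Rightarrow>\<^sub>0 rat) \<Rightarrow> ('a \<Rightarrow>\<^sub>0 rat)" where
  "scale c x = Poly_Mapping.map ((*) c) x"

definition lin_map :: "('a \<Rightarrow> 'b) \<Rightarrow> ('a \<Rightarrow>\<^sub>0 rat) \<Rightarrow> ('b \<Rightarrow>\<^sub>0 rat)" where
  "lin_map f x = (\<Sum>a\<in>Poly_Mapping.keys x. Poly_Mapping.single (f a) (Poly_Mapping.lookup x a))"


section \<open>Planar matchings\<close>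

text \<open>Top and bottom points are numbered from 1, from left to right.\<close>

datatype point = Top nat | Bot nat

type_synonym diagram = "point set set"

definition points :: "nat \<Rightarrow> nat \<Rightarrow> point set" where
  "points a b = Top ` {1..a} \<union> Bot ` {1..b}"

text \<open>
  The boundary of the rectangle, cut open at its right-hand side and traversed counterclockwise:
  the top points from right to left, followed by the bottom points from left to right.
\<close>
primrec bpos :: "point \<Rightarrow> int" where
  "bpos (Top i) = - int i"
| "bpos (Bot j) = int j"

definition noncrossing :: "diagram \<Rightarrow> bool" where
  "noncrossing D \<longleftrightarrow>
     \<not> (\<exists>p q r s. {p, r} \<in> D \<and> {q, s} \<in> D \<and> bpos p < bpos q \<and> bpos q < bpos r \<and> bpos r < bpos s)"

definition diagrams :: "nat \<Rightarrow> nat \<Rightarrow> diagram set" where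
  "diagrams a b = {D. partition_on (points a b) D \<and> (\<forall>S\<in>D. card S = 2) \<and> noncrossing D}"

definition id_diagram :: "nat \<Rightarrow> diagram" where
  "id_diagram n = (\<lambda>i. {Top i, Bot i}) ` {1..n}"

definition u_diagram :: "nat \<Rightarrow> nat \<Rightarrow> diagram" where
  "u_diagram n i = {{Top i, Top (i + 1)}, {Bot i, Bot (i + 1)}}
     \<union> (\<lambda>j. {Top j, Bot j}) ` ({1..n} - {i, i + 1})"


section \<open>Concatenation\<close>

text \<open>
  In the picture with the first diagram on top of the second one, the bottom points of the former
  are identified with the top points of the latter; these are the \<open>Middle\<close> nodes.
\<close>

datatype node = Upper nat | Middle nat | Lower nat

primrec in_upper :: "point \<Rightarrow> node" where
  "in_upper (Top i) = Upper i"
| "in_upper (Bot i) = Middle i"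

primrec in_lower :: "point \<Rightarrow> node" where
  "in_lower (Top i) = Middle i"
| "in_lower (Bot i) = Lower i"

primrec outer :: "point \<Rightarrow> node" where
  "outer (Top i) = Upper i"
| "outer (Bot i) = Lower i"

definition arcs :: "diagram \<Rightarrow> diagram \<Rightarrow> node set set" where
  "arcs D1 D2 = (`) in_upper ` D1 \<union> (`) in_lower ` D2"

definition components :: "diagram \<Rightarrow> diagram \<Rightarrow> node set set" where
  "components D1 D2 = \<Union>(arcs D1 D2) // {(x, y). \<exists>S\<in>arcs D1 D2. x \<in> S \<and> y \<in> S}\<^sup>*"

text \<open>
  A component of the stacked picture without outer points is a closed loop; the other components
  are the strands of the concatenation.
\<close>

definition concat_diagram :: "diagram \<Rightarrow> diagram \<Rightarrow> diagram" where
  "concat_diagram D1 D2 = (\<lambda>K. outer -` K) ` components D1 D2 - {{}}"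

definition loops :: "diagram \<Rightarrow> diagram \<Rightarrow> nat" where
  "loops D1 D2 = card {K \<in> components D1 D2. outer -` K = {}}"


section \<open>The Temperley-Lieb category and algebra with loop parameter 2\<close>

type_synonym tl = "diagram \<Rightarrow>\<^sub>0 rat"

definition Hom :: "nat \<Rightarrow> nat \<Rightarrow> tl set" where
  "Hom a b = {x. Poly_Mapping.keys x \<subseteq> diagrams a b}"

definition tl_comp :: "tl \<Rightarrow> tl \<Rightarrow> tl"  (infixl \<open>\<odot>\<close> 70) where
  "x \<odot> y = (\<Sum>D1\<in>Poly_Mapping.keys x. \<Sum>D2\<in>Poly_Mapping.keys y.
     Poly_Mapping.single (concat_diagram D1 D2)
       (2 ^ loops D1 D2 * Poly_Mapping.lookup x D1 * Poly_Mapping.lookup y D2))"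

definition tl_one :: "nat \<Rightarrow> tl" where
  "tl_one n = Poly_Mapping.single (id_diagram n) 1"

definition tl_u :: "nat \<Rightarrow> nat \<Rightarrow> tl" where
  "tl_u n i = Poly_Mapping.single (u_diagram n i) 1"

definition TL :: "nat \<Rightarrow> tl ring" where
  "TL n = \<lparr>carrier = Hom n n, mult = (\<odot>), one = tl_one n, zero = 0, add = (+)\<rparr>"

primrec flip :: "point \<Rightarrow> point" where
  "flip (Top i) = Bot i"
| "flip (Bot i) = Top i"

definition tl_star :: "tl \<Rightarrow> tl" where
  "tl_star = lin_map ((`) ((`) flip))"

definition JW :: "nat \<Rightarrow> tl" where
  "JW m = (THE e. e \<in> Hom m m \<and> e \<noteq> 0 \<and> e \<odot> e = e \<and>
     (\<forall>i. 1 \<le> i \<and> i < m \<longrightarrow> tl_u m i \<odot> e = 0 \<and> e \<odot> tl_u m i = 0))"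


section \<open>The symmetric group algebra and its map to the Temperley-Lieb algebra\<close>

definition QS :: "nat \<Rightarrow> ((nat \<Rightarrow> nat) \<Rightarrow>\<^sub>0 rat) ring" where
  "QS n = \<lparr>carrier = {x. Poly_Mapping.keys x \<subseteq> {p. p permutes {1..n}}},
     mult = (\<lambda>x y. \<Sum>p\<in>Poly_Mapping.keys x. \<Sum>q\<in>Poly_Mapping.keys y.
       Poly_Mapping.single (p \<circ> q) (Poly_Mapping.lookup x p * Poly_Mapping.lookup y q)),
     one = Poly_Mapping.single id 1, zero = 0, add = (+)\<rparr>"

definition transp :: "nat \<Rightarrow> nat \<Rightarrow> (nat \<Rightarrow> nat) \<Rightarrow>\<^sub>0 rat" where
  "transp i j = Poly_Mapping.single (Transposition.transpose i j) 1"

text \<open>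
  A homomorphism is determined by its values on the generators \<open>(i, i+1)\<close>. It is surjective,
  but this is not needed to single it out.
\<close>
definition \<Phi> :: "nat \<Rightarrow> ((nat \<Rightarrow> nat) \<Rightarrow>\<^sub>0 rat) \<Rightarrow> tl" where
  "\<Phi> n = (THE \<phi>. \<phi> \<in> extensional (carrier (QS n)) \<and> \<phi> \<in> ring_hom (QS n) (TL n) \<and>
     (\<forall>c. \<forall>x\<in>carrier (QS n). \<phi> (scale c x) = scale c (\<phi> x)) \<and>
     (\<forall>i. 1 \<le> i \<and> i < n \<longrightarrow> \<phi> (transp i (i + 1)) = tl_u n i - tl_one n))"

definition JM :: "nat \<Rightarrow> (nat \<Rightarrow> nat) \<Rightarrow>\<^sub>0 rat" where
  "JM i = (\<Sum>j\<in>{1..<i}. transp j i)"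


section \<open>Two-column standard tableaux\<close>

definition partitions :: "nat \<Rightarrow> nat list set" where
  "partitions n = {la. sorted_wrt (\<ge>) la \<and> (\<forall>x\<in>set la. 0 < x) \<and> sum_list la = n}"

text \<open>Cells are pairs (row, column), both numbered from 1.\<close>

definition young :: "nat list \<Rightarrow> (nat \<times> nat) set" where
  "young la = {(r, c). 1 \<le> r \<and> r \<le> length la \<and> 1 \<le> c \<and> c \<le> la ! (r - 1)}"

definition Par2 :: "nat \<Rightarrow> nat list set" where
  "Par2 n = {la \<in> partitions n. \<forall>(r, c)\<in>young la. c \<le> 2}"

text \<open>A tableau is a partial map whose domain is the Young diagram, so it determines its shape.\<close>

type_synonym tableau = "nat \<times> nat \<Rightarrow> nat option"

definition Std :: "nat list \<Rightarrow> tableau set" where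
  "Std la = {t. dom t = young la \<and> bij_betw (\<lambda>x. the (t x)) (young la) {1..sum_list la} \<and>
     (\<forall>r c. (r, c) \<in> young la \<and> (r, c + 1) \<in> young la \<longrightarrow> the (t (r, c)) < the (t (r, c + 1))) \<and>
     (\<forall>r c. (r, c) \<in> young la \<and> (r + 1, c) \<in> young la \<longrightarrow> the (t (r, c)) < the (t (r + 1, c)))}"

definition StdPar2 :: "nat \<Rightarrow> tableau set" where
  "StdPar2 n = (\<Union>la\<in>Par2 n. Std la)"

definition cell :: "tableau \<Rightarrow> nat \<Rightarrow> nat \<times> nat" where
  "cell t i = (THE x. t x = Some i)"

definition content :: "tableau \<Rightarrow> nat \<Rightarrow> int" where
  "content t i = int (snd (cell t i)) - int (fst (cell t i))"

definition contents :: "nat \<Rightarrow> int set" where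
  "contents n = {content s i | s i. s \<in> StdPar2 n \<and> 1 \<le> i \<and> i \<le> n}"


section \<open>The idempotents from Jucys-Murphy elements\<close>

text \<open>
  The factors of the product commute; to have an unambiguous meaning it is taken in increasing
  order of \<open>c\<close> and, for each \<open>c\<close>, in increasing order of \<open>i\<close>.
\<close>
definition EE :: "nat \<Rightarrow> tableau \<Rightarrow> tl" where
  "EE n t = foldr (\<odot>)
     [scale (1 / of_int (content t i - c)) (\<Phi> n (JM i) - scale (of_int c) (tl_one n)).
        c \<leftarrow> sorted_list_of_set (contents n), i \<leftarrow> [1..<n + 1], c \<noteq> content t i]
     (tl_one n)"


section \<open>The idempotents from Jones-Wenzl elements\<close>

text \<open>
  The list of pairs \<open>(d\<^sub>1, m\<^sub>1), \<dots>, (d\<^sub>k, m\<^sub>k)\<close> of block sizes: reading off the columns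
  of \<open>1, \<dots>, n\<close> in the tableau gives \<open>d\<^sub>1\<close> times 1, then \<open>m\<^sub>1\<close> times 2, and so on.
\<close>
definition blocks :: "nat \<Rightarrow> tableau \<Rightarrow> (nat \<times> nat) list" where
  "blocks n t = (THE bs.
     map (\<lambda>i. snd (cell t i)) [1..<n + 1] = concat (map (\<lambda>(d, m). replicate d 1 @ replicate m 2) bs) \<and>
     (\<forall>(d, m)\<in>set bs. 0 < d) \<and> (\<forall>(d, m)\<in>set (butlast bs). 0 < m))"

text \<open>
  List indices start at 0, so \<open>block_width bs i\<close> is \<open>n\<^sub>i\<^sub>+\<^sub>1\<close>. For a standard tableau the
  subtraction does not truncate.
\<close>
definition block_width :: "(nat \<times> nat) list \<Rightarrow> nat \<Rightarrow> nat" where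
  "block_width bs i = (\<Sum>j\<le>i. fst (bs ! j)) - (\<Sum>j<i. snd (bs ! j))"

text \<open>\<open>d\<close> vertical lines to the right of diagrams with \<open>a\<close> top and \<open>b\<close> bottom points.\<close>

definition add_lines :: "nat \<Rightarrow> nat \<Rightarrow> nat \<Rightarrow> tl \<Rightarrow> tl" where
  "add_lines a b d = lin_map (\<lambda>D. D \<union> (\<lambda>j. {Top (a + j), Bot (b + j)}) ` {1..d})"

text \<open>
  Bending the \<open>m\<close> rightmost of \<open>a\<close> top strands around to the right of \<open>b\<close> bottom points.
  The rightmost top strand is the innermost one, so it becomes the bottom point \<open>b + 1\<close>.
\<close>

fun bend_point :: "nat \<Rightarrow> nat \<Rightarrow> nat \<Rightarrow> point \<Rightarrow> point" where
  "bend_point a b m (Top i) = (if i \<le> a - m then Top i else Bot (b + (a + 1 - i)))"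
| "bend_point a b m (Bot j) = Bot j"

definition bend :: "nat \<Rightarrow> nat \<Rightarrow> nat \<Rightarrow> tl \<Rightarrow> tl" where
  "bend a b m = lin_map ((`) ((`) (bend_point a b m)))"

primrec g_elem :: "(nat \<times> nat) list \<Rightarrow> nat \<Rightarrow> tl" where
  "g_elem bs 0 = Poly_Mapping.single {} 1"
| "g_elem bs (Suc i) =
     (let (d, m) = bs ! i; a = block_width bs i; b = (\<Sum>j<i. fst (bs ! j) + snd (bs ! j))
      in bend a (b + d) m (JW a \<odot> add_lines (a - d) b d (g_elem bs i)))"

definition f_elem :: "nat \<Rightarrow> tableau \<Rightarrow> tl" where
  "f_elem n t = g_elem (blocks n t) (length (blocks n t))"

definition gamma_t :: "nat \<Rightarrow> tableau \<Rightarrow> rat" where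
  "gamma_t n t = (let bs = blocks n t in
     \<Prod>i<length bs. (of_nat (block_width bs i) + 1) / (of_nat (block_width bs i) - of_nat (snd (bs ! i)) + 1))"

definition EE' :: "nat \<Rightarrow> tableau \<Rightarrow> tl" where
  "EE' n t = scale (1 / gamma_t n t) (tl_star (f_elem n t) \<odot> f_elem n t)"


section \<open>Complete sets of primitive idempotents\<close>

definition idempotent_in :: "('a, 'b) ring_scheme \<Rightarrow> 'a \<Rightarrow> bool" where
  "idempotent_in R e \<longleftrightarrow> e \<in> carrier R \<and> e \<otimes>\<^bsub>R\<^esub> e = e"

definition orthogonal_in :: "('a, 'b) ring_scheme \<Rightarrow> 'a \<Rightarrow> 'a \<Rightarrow> bool" where
  "orthogonal_in R e f \<longleftrightarrow> e \<otimes>\<^bsub>R\<^esub> f = \<zero>\<^bsub>R\<^esub> \<and> f \<otimes>\<^bsub>R\<^esub> e = \<zero>\<^bsub>R\<^esub>"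

definition primitive_idempotent :: "('a, 'b) ring_scheme \<Rightarrow> 'a \<Rightarrow> bool" where
  "primitive_idempotent R e \<longleftrightarrow> idempotent_in R e \<and> e \<noteq> \<zero>\<^bsub>R\<^esub> \<and>
     \<not> (\<exists>x y. idempotent_in R x \<and> idempotent_in R y \<and> x \<noteq> \<zero>\<^bsub>R\<^esub> \<and> y \<noteq> \<zero>\<^bsub>R\<^esub> \<and>
           orthogonal_in R x y \<and> e = x \<oplus>\<^bsub>R\<^esub> y)"

definition complete_primitive_idempotents ::
  "('a, 'b) ring_scheme \<Rightarrow> 'i set \<Rightarrow> ('i \<Rightarrow> 'a) \<Rightarrow> bool" where
  "complete_primitive_idempotents R I e \<longleftrightarrow> finite I \<and>
     (\<forall>i\<in>I. primitive_idempotent R (e i)) \<and>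
     (\<forall>i\<in>I. \<forall>j\<in>I. i \<noteq> j \<longrightarrow> orthogonal_in R (e i) (e j)) \<and>
     (\<Oplus>\<^bsub>R\<^esub>i\<in>I. e i) = \<one>\<^bsub>R\<^esub>"

end

theory Submission
  imports Defs
begin

text \<open>
  Send a diagram to the matrix that tests whether a 0/1-labeling of its points is constant along
  its arcs; this is multiplicative because a loop can be labeled in 2 ways. After a twist of the labels
  and signs at alternate points, \<open>u\<^sub>i\<close> becomes \<open>1 - P\<^sub>i\<close>, where \<open>P\<^sub>i\<close> swaps the positions \<open>i\<close> and \<open>i + 1\<close>.
  So \<open>\<Phi>\<close> becomes the sign-twisted permutation action on the labelings, and the Jones-Wenzl element
  becomes the symmetrizer. The matrices of noncrossing matchings are linearly independent, hence
  all identities may be checked on matrices.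

  The element \<open>f\<close> of a tableau absorbs the symmetrizer, so its matrix depends on the labeling of the top
  points only through the number of marked points. What remains satisfies a two-term recursion
  along the tableau. By this recursion, the elements \<open>E'\<close> sum up to 1, and \<open>f\<close> intertwines the
  raising and lowering operators, which makes it an eigenvector of \<open>L\<^sub>i\<close> for the content of \<open>i\<close>.
  Contents separate tableaux, so \<open>E'\<^sub>s E\<^sub>t = \<delta>\<^sub>s\<^sub>t E'\<^sub>s\<close>, and summation over \<open>s\<close> gives \<open>E\<^sub>t = E'\<^sub>t\<close>.
  Primitivity holds because the Jones-Wenzl element spans the corner that it cuts out.
\<close>

section \<open>Components of the stacked picture\<close>

text \<open>The loop value 2 is the dimension of a two-dimensional space, and the matrices are
  sl2-intertwiners between its tensor powers. Since \<open>\<Phi>\<close> and \<open>JW\<close> are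
  definite descriptions, existence and uniqueness must both be shown. Faithful matrices give
  existence cheaply: permutation operators multiply correctly by themselves, so braid relations
  never enter, and the symmetrizer is visibly idempotent.

  The combinatorial obstacle is planarity of a concatenation. The components are only equivalence
  classes without any geometry, so crossings are excluded algebraically, by products of involutions
  along the boundary.

  No product of two elements \<open>EE'\<close> is computed directly. One-sided eigenvectors
  determine \<open>EE' n t \<odot> EE n s\<close> for any normalization. The constant gamma enters
  through the sum being 1, where its factors \<open>(a + 1) / a\<close> balance the two summands of
  the branching rule for one added strand. Idempotence and orthogonality then come out of the
  equality with \<open>EE\<close>.\<close>

lemma connected_subset_edges:
  fixes A :: "'a set set" and x0 :: 'a
  defines "K \<equiv> {(x, y). \<exists>S\<in>A. x \<in> S \<and> y \<in> S}\<^sup>* `` {x0}"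
  assumes A: "finite A" "\<And>S. S \<in> A \<Longrightarrow> card S = 2" and K: "finite K"
  assumes k: "Suc k \<le> card K"
  shows "\<exists>S\<subseteq>K. x0 \<in> S \<and> card S = Suc k \<and> k \<le> card {e \<in> A. e \<subseteq> S}"
  using k
proof (induction k)
  case 0
  have "x0 \<in> K" by (simp add: K_def)
  then show ?case by (intro exI[of _ "{x0}"]) auto
next
  case (Suc k)
  then obtain S where S: "S \<subseteq> K" "x0 \<in> S" "card S = Suc k" "k \<le> card {e \<in> A. e \<subseteq> S}" by auto
  \<comment> \<open>If no arc left \<open>S\<close>, then \<open>S\<close> would contain everything
    reachable from \<open>x0\<close>, and \<open>K\<close> would be no larger than
    \<open>S\<close>.\<close>
  have "\<exists>u v e. e \<in> A \<and> u \<in> e \<and> v \<in> e \<and> u \<in> S \<and> v \<notin> S"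
  proof (rule ccontr)
    assume neg: "\<not> ?thesis"
    have "K \<subseteq> S"
    proof
      fix z assume "z \<in> K"
      then have "(x0, z) \<in> {(x, y). \<exists>S\<in>A. x \<in> S \<and> y \<in> S}\<^sup>*" by (simp add: K_def)
      then show "z \<in> S"
        by (induction rule: rtrancl_induct) (use neg S(2) in auto)
    qed
    then have "card K \<le> card S" using K S(1) by (metis card_mono finite_subset)
    then show False using Suc.prems S(3) by simp
  qed
  then obtain u v e where e: "e \<in> A" "u \<in> e" "v \<in> e" "u \<in> S" "v \<notin> S" by blast
  have "u \<noteq> v" using e by blast
  then have euv: "e = {u, v}"
    using A(2)[OF e(1)] e(2,3) by (auto simp: card_2_iff)
  have vK: "v \<in> K"
  proof -
    have "(x0, u) \<in> {(x, y). \<exists>S\<in>A. x \<in> S \<and> y \<in> S}\<^sup>*" using e(4) S(1) by (auto simp: K_def)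
    moreover have "(u, v) \<in> {(x, y). \<exists>S\<in>A. x \<in> S \<and> y \<in> S}" using e by blast
    ultimately show ?thesis unfolding K_def by (auto intro: rtrancl_into_rtrancl)
  qed
  have finS: "finite S" using S(1) K finite_subset by blast
  \<comment> \<open>The arc \<open>e\<close> has not been counted yet, because its end
    \<open>v\<close> lies outside \<open>S\<close>.\<close>
  have "Suc k \<le> card (insert e {e \<in> A. e \<subseteq> S})"
    using S(4) A(1) e(5) euv by (subst card_insert_disjoint) auto
  also have "\<dots> \<le> card {e \<in> A. e \<subseteq> insert v S}"
    using A(1) e euv by (intro card_mono) auto
  finally show ?case
    using S vK e(5) finS by (intro exI[of _ "insert v S"]) auto
qed

text \<open>A connected graph has at least one edge for each node after the first; the preceding
  lemma grows it node by node.\<close>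

lemma connected_card_le_edges:
  fixes A :: "'a set set" and x0 :: 'a
  defines "K \<equiv> {(x, y). \<exists>S\<in>A. x \<in> S \<and> y \<in> S}\<^sup>* `` {x0}"
  assumes A: "finite A" "\<And>S. S \<in> A \<Longrightarrow> card S = 2" and K: "finite K"
  shows "card K \<le> card {e \<in> A. e \<subseteq> K} + 1"
proof -
  have "x0 \<in> K" by (simp add: K_def)
  then have "card K \<noteq> 0" using K by auto
  then obtain k where k: "card K = Suc k" by (cases "card K") auto
  then obtain S where S: "S \<subseteq> K" "k \<le> card {e \<in> A. e \<subseteq> S}"
    using connected_subset_edges[where A=A and ?x0.0=x0 and k=k] A K unfolding K_def by auto
  then have "card {e \<in> A. e \<subseteq> S} \<le> card {e \<in> A. e \<subseteq> K}"
    using A(1) by (intro card_mono) auto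
  then show ?thesis using S k by simp
qed

section \<open>Planar matchings as fixed-point-free involutions of the boundary points\<close>

lemma finite_points [simp]: "finite (points a b)"
  by (simp add: points_def)

lemma diagrams_finite: "D \<in> diagrams a b \<Longrightarrow> finite D"
  by (auto simp: diagrams_def intro: finite_elements[OF finite_points])

lemma diagrams_Union: "D \<in> diagrams a b \<Longrightarrow> \<Union>D = points a b"
  by (auto simp: diagrams_def partition_on_def)

lemma diagrams_card: "D \<in> diagrams a b \<Longrightarrow> S \<in> D \<Longrightarrow> card S = 2"
  by (auto simp: diagrams_def)

lemma diagrams_disjoint: "D \<in> diagrams a b \<Longrightarrow> S \<in> D \<Longrightarrow> S' \<in> D \<Longrightarrow> p \<in> S \<Longrightarrow> p \<in> S' \<Longrightarrow> S = S'"
  unfolding diagrams_def partition_on_def disjoint_def by blast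

lemma diagrams_card_Union:
  assumes D: "D \<in> diagrams a b" and E: "E \<subseteq> D"
  shows "2 * card E = card (\<Union>E)"
proof (rule card_partition)
  show "finite E" using finite_subset[OF E diagrams_finite[OF D]] .
  have "\<Union>E \<subseteq> points a b" using E diagrams_Union[OF D] by blast
  then show "finite (\<Union>E)" by (rule finite_subset) simp
  show "card S = 2" if "S \<in> E" for S using that E diagrams_card[OF D] by auto
  show "S \<inter> S' = {}" if "S \<in> E" "S' \<in> E" "S \<noteq> S'" for S S'
    using that E diagrams_disjoint[OF D] by blast
qed

definition mate :: "diagram \<Rightarrow> point \<Rightarrow> point" where
  "mate D p = (SOME q. q \<noteq> p \<and> {p, q} \<in> D)"

lemma mate:
  assumes "D \<in> diagrams a b" "p \<in> points a b"
  shows "mate D p \<noteq> p" "{p, mate D p} \<in> D" "mate D p \<in> points a b"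
proof -
  obtain S where S: "S \<in> D" "p \<in> S" using assms diagrams_Union by blast
  then obtain q where "q \<noteq> p" "S = {p, q}"
    using diagrams_card[OF assms(1) S(1)] unfolding card_2_iff by (metis insert_commute insertE singletonD)
  then have "\<exists>q. q \<noteq> p \<and> {p, q} \<in> D" using S by blast
  then have "mate D p \<noteq> p \<and> {p, mate D p} \<in> D" unfolding mate_def by (rule someI_ex)
  then show "mate D p \<noteq> p" "{p, mate D p} \<in> D" "mate D p \<in> points a b"
    using diagrams_Union[OF assms(1)] by auto
qed

lemma mate_eqI:
  assumes "D \<in> diagrams a b" "{p, q} \<in> D"
  shows "mate D p = q"
proof -
  have p: "p \<in> points a b" using assms diagrams_Union by blast
  have "{p, mate D p} = {p, q}"
    using diagrams_disjoint[OF assms(1) mate(2)[OF assms(1) p] assms(2), of p] by simp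
  then show ?thesis using mate(1)[OF assms(1) p] by (auto simp: doubleton_eq_iff)
qed

lemma mate_mate: "D \<in> diagrams a b \<Longrightarrow> p \<in> points a b \<Longrightarrow> mate D (mate D p) = p"
  using mate(2) mate_eqI by (metis insert_commute)

lemma diagrams_arcE:
  assumes "D \<in> diagrams a b" "S \<in> D"
  obtains p where "p \<in> points a b" "S = {p, mate D p}"
proof -
  obtain p q where "S = {p, q}" using diagrams_card[OF assms] by (auto simp: card_2_iff)
  moreover then have "p \<in> points a b" using assms diagrams_Union by blast
  ultimately show ?thesis using that mate_eqI assms by metis
qed

lemma mate_noncrossing:
  assumes "D \<in> diagrams a b" "p \<in> points a b" "q \<in> points a b"
    "bpos p < bpos q" "bpos q < bpos (mate D p)" "bpos (mate D p) < bpos (mate D q)"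
  shows False
  using assms mate(2)[OF assms(1,2)] mate(2)[OF assms(1,3)]
  unfolding diagrams_def noncrossing_def by blast

lemma bpos_inj: "p \<in> points a b \<Longrightarrow> q \<in> points a b \<Longrightarrow> bpos p = bpos q \<Longrightarrow> p = q"
  by (cases p; cases q) (auto simp: points_def)

lemma in_upper_inj: "inj in_upper" and in_lower_inj: "inj in_lower" and outer_inj: "inj outer"
  by (rule injI, case_tac x; case_tac y; simp)+

text \<open>Induction on the length: the arc at the first entry \<open>p\<close> cuts the rest into
  the part \<open>A\<close> under the arc and the part \<open>B\<close> behind it. Noncrossing makes
  both closed under \<open>m\<close>, so their products are trivial, and the two equal involutions
  at \<open>p\<close> and \<open>m p\<close> meet and cancel.\<close>

lemma involution_fold:
  fixes m :: "'a \<Rightarrow> 'a" and l :: "'a \<Rightarrow> 'b \<Rightarrow> 'b" and pos :: "'a \<Rightarrow> int"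
  assumes "sorted_wrt (\<lambda>p q. pos p < pos q) xs"
    and "\<And>p. p \<in> set xs \<Longrightarrow> m p \<in> set xs \<and> m p \<noteq> p \<and> m (m p) = p \<and> l (m p) = l p \<and> l p \<circ> l p = id"
    and "\<And>p q. p \<in> set xs \<Longrightarrow> q \<in> set xs \<Longrightarrow> pos p < pos q \<Longrightarrow> pos q < pos (m p) \<Longrightarrow> pos (m p) < pos (m q) \<Longrightarrow> False"
  shows "fold l xs = id"
  using assms
proof (induction "length xs" arbitrary: xs rule: less_induct)
  case less
  show ?case
  proof (cases xs)
    case Nil
    then show ?thesis by simp
  next
    case (Cons p ys)
    then have "m p \<in> set ys" using less.prems(2)[of p] by auto
    then obtain A B where ys: "ys = A @ m p # B" by (meson split_list)
    have xs: "xs = p # A @ m p # B" using Cons ys by simp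
    have sA: "sorted_wrt (\<lambda>p q. pos p < pos q) A" and sB: "sorted_wrt (\<lambda>p q. pos p < pos q) B"
      using less.prems(1) unfolding xs by (auto simp: sorted_wrt_append)
    have pA: "\<And>q. q \<in> set A \<Longrightarrow> pos p < pos q \<and> pos q < pos (m p)"
      and pB: "\<And>q. q \<in> set B \<Longrightarrow> pos (m p) < pos q" and pm: "pos p < pos (m p)"
      using less.prems(1) unfolding xs by (auto simp: sorted_wrt_append)
    have AB: "set A \<inter> set B = {}"
      using pA pB by fastforce
    have mmp: "m (m p) = p" using less.prems(2)[of p] xs by simp
    have mA: "m q \<in> set A" if q: "q \<in> set A" for q
    proof -
      have *: "m q \<in> set xs" "m (m q) = q" using less.prems(2)[of q] q xs by auto
      moreover have "m q \<noteq> p" using pA[OF q] *(2) by fastforce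
      moreover have "m q \<noteq> m p" using pA[OF q] *(2) mmp by (metis less_irrefl)
      \<comment> \<open>A mate in \<open>B\<close> would make an arc that crosses the one from
        \<open>p\<close> to \<open>m p\<close>.\<close>
      moreover have "m q \<notin> set B"
        using less.prems(3)[of p q] pA[OF q] pB[of "m q"] q xs by auto
      ultimately show ?thesis using xs by auto
    qed
    have mB: "m q \<in> set B" if q: "q \<in> set B" for q
    proof -
      have *: "m q \<in> set xs" "m (m q) = q" using less.prems(2)[of q] q xs by auto
      moreover have "m q \<noteq> p" using pB[OF q] *(2) by fastforce
      moreover have "m q \<noteq> m p" using pB[OF q] pm *(2) mmp by (metis less_asym)
      moreover have "m q \<notin> set A" using mA[of "m q"] *(2) AB q by auto
      ultimately show ?thesis using xs by auto
    qed
    have "fold l A = id"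
      using less.prems(2,3) mA sA by (intro less.hyps) (auto simp: xs)
    moreover have "fold l B = id"
      using less.prems(2,3) mB sB by (intro less.hyps) (auto simp: xs)
    moreover have "l (m p) = l p" "l p \<circ> l p = id" using less.prems(2)[of p] xs by auto
    ultimately show ?thesis by (simp add: xs)
  qed
qed

definition boundary :: "nat \<Rightarrow> nat \<Rightarrow> point list" where
  "boundary a b = map Top (rev [1..<a + 1]) @ map Bot [1..<b + 1]"

lemma set_boundary: "set (boundary a b) = points a b"
  by (simp add: boundary_def points_def atLeastLessThanSuc_atLeastAtMost del: upt_Suc)

lemma sorted_boundary: "sorted_wrt (\<lambda>p q. bpos p < bpos q) (boundary a b)"
proof -
  have "sorted_wrt (<) [1..<b + 1]" "sorted_wrt (<) [1..<a + 1]" by (rule sorted_wrt_upt)+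
  then show ?thesis
    unfolding boundary_def by (auto simp: sorted_wrt_append sorted_wrt_map sorted_wrt_rev simp del: upt_Suc)
qed

lemma fold_boundary:
  assumes D: "D \<in> diagrams a b"
    and l: "\<And>p. p \<in> points a b \<Longrightarrow> l p \<circ> l p = id" "\<And>p q. {p, q} \<in> D \<Longrightarrow> l p = l q"
  shows "fold l (boundary a b) = id"
proof (rule involution_fold[where pos=bpos and m="mate D"])
  show "sorted_wrt (\<lambda>p q. bpos p < bpos q) (boundary a b)" by (rule sorted_boundary)
  show "mate D p \<in> set (boundary a b) \<and> mate D p \<noteq> p \<and> mate D (mate D p) = p \<and> l (mate D p) = l p \<and> l p \<circ> l p = id"
    if "p \<in> set (boundary a b)" for p
    using mate[OF D, of p] mate_mate[OF D, of p] l that unfolding set_boundary by metis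
qed (use mate_noncrossing[OF D] in \<open>auto simp: set_boundary\<close>)

text \<open>By noncrossing, the points under an arc are matched among themselves.\<close>

lemma even_between:
  assumes D: "D \<in> diagrams a b" and p: "p \<in> points a b"
  shows "even (card {q \<in> points a b. bpos p < bpos q \<and> bpos q < bpos (mate D p)})"
proof -
  define Q where "Q = {q \<in> points a b. bpos p < bpos q \<and> bpos q < bpos (mate D p)}"
  define C where "C = {S \<in> D. S \<subseteq> Q}"
  have mQ: "mate D q \<in> Q" if q: "q \<in> Q" for q
  proof -
    have q': "q \<in> points a b" "bpos p < bpos q" "bpos q < bpos (mate D p)" using q by (auto simp: Q_def)
    note mp = mate[OF D p] and mq = mate[OF D q'(1)]
    have "mate D q \<noteq> p" "mate D q \<noteq> mate D p"
      using q' mate_mate[OF D p] mate_mate[OF D q'(1)] by auto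
    then have "bpos (mate D q) \<noteq> bpos p" "bpos (mate D q) \<noteq> bpos (mate D p)"
      using bpos_inj[OF mq(3) p] bpos_inj[OF mq(3) mp(3)] by auto
    moreover have "\<not> bpos (mate D p) < bpos (mate D q)"
      using mate_noncrossing[OF D p q'(1)] q' by auto
    moreover have "\<not> bpos (mate D q) < bpos p"
      using mate_noncrossing[OF D mq(3) p] q' mate_mate[OF D q'(1)] by auto
    ultimately show ?thesis using mq(3) by (auto simp: Q_def)
  qed
  have "\<Union>C = Q"
  proof
    show "Q \<subseteq> \<Union>C"
    proof
      fix q assume q: "q \<in> Q"
      then have "{q, mate D q} \<in> C" using mate(2)[OF D, of q] mQ[OF q] by (auto simp: C_def Q_def)
      then show "q \<in> \<Union>C" by blast
    qed
  qed (auto simp: C_def)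
  moreover have "2 * card C = card (\<Union>C)"
    by (rule diagrams_card_Union[OF D]) (auto simp: C_def)
  ultimately show ?thesis unfolding Q_def by (metis dvd_triv_left)
qed

lemma fold_rev_involutions:
  assumes "\<And>x. x \<in> set xs \<Longrightarrow> f x \<circ> f x = id"
  shows "fold f (rev xs) \<circ> fold f xs = id"
  using assms
proof (induction xs)
  case (Cons x xs)
  have "fold f (rev xs) (fold f xs z) = z" for z
    using Cons.IH Cons.prems by (simp add: fun_eq_iff)
  moreover have "f x (f x z) = z" for z
    using Cons.prems[of x] by (simp add: fun_eq_iff)
  ultimately show ?case by (simp add: fun_eq_iff)
qed simp

lemma fold_filter_id:
  assumes "\<And>x. x \<in> set xs \<Longrightarrow> \<not> P x \<Longrightarrow> f x = id"
  shows "fold f (filter P xs) = fold f xs"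
  using assms by (induction xs) auto

section \<open>Stacking two planar matchings\<close>

locale stacked =
  fixes a b c :: nat and D1 D2 :: diagram
  assumes D1: "D1 \<in> diagrams a b" and D2: "D2 \<in> diagrams b c"
begin

definition V where "V = Upper ` {1..a} \<union> Middle ` {1..b} \<union> Lower ` {1..c}"

lemma finite_V: "finite V"
  by (simp add: V_def)

definition R where "R = {(x, y). \<exists>S\<in>arcs D1 D2. x \<in> S \<and> y \<in> S}"

lemma components_eq: "components D1 D2 = \<Union>(arcs D1 D2) // R\<^sup>*"
  by (simp add: components_def R_def)

lemma Union_arcs: "\<Union>(arcs D1 D2) = V"
proof -
  have "\<Union>(arcs D1 D2) = in_upper ` \<Union>D1 \<union> in_lower ` \<Union>D2"
    by (auto simp: arcs_def)
  also have "\<dots> = V"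
    unfolding diagrams_Union[OF D1] diagrams_Union[OF D2]
    by (auto simp: points_def V_def image_Un image_image)
  finally show ?thesis .
qed

lemma finite_arcs: "finite (arcs D1 D2)"
  using diagrams_finite[OF D1] diagrams_finite[OF D2] by (simp add: arcs_def)

lemma card_arcs: "S \<in> arcs D1 D2 \<Longrightarrow> card S = 2"
  using diagrams_card[OF D1] diagrams_card[OF D2]
  by (auto simp: arcs_def card_image inj_on_subset[OF in_upper_inj] inj_on_subset[OF in_lower_inj])

lemma sym_R: "sym (R\<^sup>*)"
  by (rule sym_rtrancl) (auto simp: sym_def R_def)

lemma R_V: "(x, y) \<in> R\<^sup>* \<Longrightarrow> x \<in> V \<Longrightarrow> y \<in> V"
  by (induction rule: rtrancl_induct) (use Union_arcs in \<open>auto simp: R_def\<close>)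

lemma componentE:
  assumes "K \<in> components D1 D2"
  obtains x where "x \<in> V" "K = R\<^sup>* `` {x}"
  using assms unfolding components_eq Union_arcs by (auto elim: quotientE)

lemma component_sub: "K \<in> components D1 D2 \<Longrightarrow> K \<subseteq> V"
  by (erule componentE) (auto intro: R_V)

lemma finite_component: "K \<in> components D1 D2 \<Longrightarrow> finite K"
  using component_sub finite_subset finite_V by blast

lemma component_ne: "K \<in> components D1 D2 \<Longrightarrow> K \<noteq> {}"
  by (erule componentE) auto

lemma component_R: "K \<in> components D1 D2 \<Longrightarrow> x \<in> K \<Longrightarrow> y \<in> K \<longleftrightarrow> (x, y) \<in> R\<^sup>*"
  by (erule componentE) (auto intro: rtrancl_trans dest: symD[OF sym_R])

lemma component_eq: "K \<in> components D1 D2 \<Longrightarrow> K' \<in> components D1 D2 \<Longrightarrow> x \<in> K \<Longrightarrow> x \<in> K' \<Longrightarrow> K = K'"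
  using component_R by blast

lemma component_ex: "x \<in> V \<Longrightarrow> \<exists>K\<in>components D1 D2. x \<in> K"
  unfolding components_eq Union_arcs by (intro bexI[of _ "R\<^sup>* `` {x}"]) (auto intro: quotientI)

lemma arc_component:
  "K \<in> components D1 D2 \<Longrightarrow> S \<in> arcs D1 D2 \<Longrightarrow> x \<in> S \<Longrightarrow> x \<in> K \<Longrightarrow> S \<subseteq> K"
  using component_R[of K x] by (auto simp: R_def)

lemma finite_components: "finite (components D1 D2)"
  by (rule finite_subset[of _ "Pow V"]) (use component_sub finite_V in auto)

lemma outer_points: "p \<in> points a c \<longleftrightarrow> outer p \<in> V"
  by (cases p) (auto simp: points_def V_def)

text \<open>
  A component is connected, so it has at most one node more than arcs; its middle nodes have degree 2
  and its outer nodes have degree 1.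
\<close>
lemma card_outer:
  assumes K: "K \<in> components D1 D2"
  shows "card (outer -` K) = 0 \<or> card (outer -` K) = 2"
proof -
  note fK = finite_component[OF K]
  define U where "U = {i. Upper i \<in> K}"
  define M where "M = {i. Middle i \<in> K}"
  define L where "L = {i. Lower i \<in> K}"
  have fin: "finite U" "finite M" "finite L"
    using fK unfolding U_def M_def L_def by (auto intro!: finite_vimageI[of K, unfolded vimage_def] injI)
  have Keq: "K = Upper ` U \<union> Middle ` M \<union> Lower ` L"
    unfolding U_def M_def L_def using node.exhaust by (auto simp: image_iff) metis
  have cK: "card K = card U + card M + card L"
    unfolding Keq using fin by (subst card_Un_disjoint; auto simp: card_image inj_on_def)+
  define E1 where "E1 = {S \<in> D1. in_upper ` S \<subseteq> K}"
  define E2 where "E2 = {S \<in> D2. in_lower ` S \<subseteq> K}"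
  have arc1: "in_upper ` S \<subseteq> K" if "S \<in> D1" "p \<in> S" "in_upper p \<in> K" for S p
    using arc_component[OF K, of "in_upper ` S" "in_upper p"] that by (auto simp: arcs_def)
  have arc2: "in_lower ` S \<subseteq> K" if "S \<in> D2" "p \<in> S" "in_lower p \<in> K" for S p
    using arc_component[OF K, of "in_lower ` S" "in_lower p"] that by (auto simp: arcs_def)
  have U1: "\<Union>E1 = Top ` U \<union> Bot ` M"
  proof (intro Set.set_eqI iffI)
    fix p assume "p \<in> Top ` U \<union> Bot ` M"
    then have p: "in_upper p \<in> K" by (auto simp: U_def M_def)
    then have "in_upper p \<in> V" using component_sub[OF K] by blast
    then have "p \<in> points a b" by (cases p) (auto simp: V_def points_def)
    then obtain S where "S \<in> D1" "p \<in> S" using diagrams_Union[OF D1] by blast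
    then show "p \<in> \<Union>E1" using arc1 p unfolding E1_def by blast
  next
    fix p assume "p \<in> \<Union>E1"
    then have "in_upper p \<in> K" by (auto simp: E1_def)
    then show "p \<in> Top ` U \<union> Bot ` M" by (cases p) (auto simp: U_def M_def)
  qed
  have U2: "\<Union>E2 = Top ` M \<union> Bot ` L"
  proof (intro Set.set_eqI iffI)
    fix p assume "p \<in> Top ` M \<union> Bot ` L"
    then have p: "in_lower p \<in> K" by (auto simp: L_def M_def)
    then have "in_lower p \<in> V" using component_sub[OF K] by blast
    then have "p \<in> points b c" by (cases p) (auto simp: V_def points_def)
    then obtain S where "S \<in> D2" "p \<in> S" using diagrams_Union[OF D2] by blast
    then show "p \<in> \<Union>E2" using arc2 p unfolding E2_def by blast
  next
    fix p assume "p \<in> \<Union>E2"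
    then have "in_lower p \<in> K" by (auto simp: E2_def)
    then show "p \<in> Top ` M \<union> Bot ` L" by (cases p) (auto simp: L_def M_def)
  qed
  have fE: "finite E1" "finite E2"
    using diagrams_finite[OF D1] diagrams_finite[OF D2] by (simp_all add: E1_def E2_def)
  have "2 * card E1 = card (\<Union>E1)"
    by (rule diagrams_card_Union[OF D1]) (auto simp: E1_def)
  also have "\<dots> = card U + card M"
    unfolding U1 using fin by (subst card_Un_disjoint) (auto simp: card_image inj_on_def)
  finally have c1: "2 * card E1 = card U + card M" .
  have "2 * card E2 = card (\<Union>E2)"
    by (rule diagrams_card_Union[OF D2]) (auto simp: E2_def)
  also have "\<dots> = card M + card L"
    unfolding U2 using fin by (subst card_Un_disjoint) (auto simp: card_image inj_on_def)
  finally have c2: "2 * card E2 = card M + card L" .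
  obtain x where x: "K = R\<^sup>* `` {x}" using K by (rule componentE)
  have "card K \<le> card {e \<in> arcs D1 D2. e \<subseteq> K} + 1"
    using connected_card_le_edges[OF finite_arcs card_arcs, of x] fK unfolding x R_def by simp
  also have "{e \<in> arcs D1 D2. e \<subseteq> K} \<subseteq> (`) in_upper ` E1 \<union> (`) in_lower ` E2"
    by (auto simp: arcs_def E1_def E2_def)
  then have "card {e \<in> arcs D1 D2. e \<subseteq> K} \<le> card ((`) in_upper ` E1 \<union> (`) in_lower ` E2)"
    using fE by (intro card_mono) auto
  also have "\<dots> \<le> card E1 + card E2"
    using fE by (meson card_Un_le card_image_le add_mono order_trans)
  finally have "card K \<le> card E1 + card E2 + 1" by simp
  moreover have "outer -` K = Top ` U \<union> Bot ` L"
  proof (intro Set.set_eqI)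
    fix p show "p \<in> outer -` K \<longleftrightarrow> p \<in> Top ` U \<union> Bot ` L"
      by (cases p) (auto simp: U_def L_def)
  qed
  then have "card (outer -` K) = card U + card L"
    using fin by (simp, subst card_Un_disjoint) (auto simp: card_image inj_on_def)
  \<comment> \<open>Twice the edge bound, combined with \<open>c1\<close> and \<open>c2\<close>,
    leaves \<open>card U + card L \<le> 2\<close>; modulo 2, both numbers agree with
    \<open>card M\<close>, so their sum is even.\<close>
  ultimately show ?thesis using c1 c2 cK by presburger
qed

text \<open>The two diagrams give \<open>M \<circ> U = id\<close> and
  \<open>L \<circ> M' = id\<close>, where \<open>M\<close> and \<open>M'\<close> read the middle
  nodes in opposite directions. A product of involutions read forwards and then backwards is
  trivial, so the middle line cancels out of \<open>L \<circ> U\<close>.\<close>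

lemma fold_outer_boundary:
  fixes l :: "node \<Rightarrow> 'z \<Rightarrow> 'z"
  assumes l: "\<And>x. l x \<circ> l x = id" "\<And>S x y. S \<in> arcs D1 D2 \<Longrightarrow> x \<in> S \<Longrightarrow> y \<in> S \<Longrightarrow> l x = l y"
  shows "fold (l \<circ> outer) (boundary a c) = id"
proof -
  have 1: "fold (l \<circ> in_upper) (boundary a b) = id"
  proof (rule fold_boundary[OF D1])
    fix p q assume "{p, q} \<in> D1"
    then have "in_upper ` {p, q} \<in> arcs D1 D2" unfolding arcs_def by blast
    from l(2)[OF this, of "in_upper p" "in_upper q"]
    show "(l \<circ> in_upper) p = (l \<circ> in_upper) q" by simp
  qed (simp add: l(1))
  have 2: "fold (l \<circ> in_lower) (boundary b c) = id"
  proof (rule fold_boundary[OF D2])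
    fix p q assume "{p, q} \<in> D2"
    then have "in_lower ` {p, q} \<in> arcs D1 D2" unfolding arcs_def by blast
    from l(2)[OF this, of "in_lower p" "in_lower q"]
    show "(l \<circ> in_lower) p = (l \<circ> in_lower) q" by simp
  qed (simp add: l(1))
  define U where "U = fold (l \<circ> Upper) (rev [1..<a + 1])"
  define M where "M = fold (l \<circ> Middle) [1..<b + 1]"
  define M' where "M' = fold (l \<circ> Middle) (rev [1..<b + 1])"
  define L where "L = fold (l \<circ> Lower) [1..<c + 1]"
  have simps: "(l \<circ> in_upper) \<circ> Top = l \<circ> Upper" "(l \<circ> in_upper) \<circ> Bot = l \<circ> Middle"
    "(l \<circ> in_lower) \<circ> Top = l \<circ> Middle" "(l \<circ> in_lower) \<circ> Bot = l \<circ> Lower"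
    "(l \<circ> outer) \<circ> Top = l \<circ> Upper" "(l \<circ> outer) \<circ> Bot = l \<circ> Lower"
    by (auto simp: fun_eq_iff)
  have MU: "M \<circ> U = id" using 1 by (simp add: boundary_def fold_map simps M_def U_def del: upt_Suc)
  have LM: "L \<circ> M' = id" using 2 by (simp add: boundary_def fold_map simps M'_def L_def del: upt_Suc)
  have MM: "M' \<circ> M = id"
    unfolding M_def M'_def by (rule fold_rev_involutions) (simp add: l(1))
  have "fold (l \<circ> outer) (boundary a c) = L \<circ> U"
    by (simp add: boundary_def fold_map simps U_def L_def del: upt_Suc)
  also have "\<dots> = L \<circ> (M' \<circ> M) \<circ> U" by (simp add: MM)
  also have "\<dots> = (L \<circ> M') \<circ> (M \<circ> U)" by (simp add: o_assoc)
  finally show ?thesis by (simp add: LM MU)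
qed

text \<open>
  Two crossing strands are labeled by the reflections \<open>z \<mapsto> - z\<close> and \<open>z \<mapsto> 1 - z\<close> of the integers, all other
  nodes by the identity. The product along the boundary is the identity for both factors, hence for
  the concatenation, but the four end points contribute the square of a nontrivial translation.
\<close>
lemma concat_noncrossing: "noncrossing (concat_diagram D1 D2)"
  unfolding noncrossing_def
proof
  assume "\<exists>p q r s. {p, r} \<in> concat_diagram D1 D2 \<and> {q, s} \<in> concat_diagram D1 D2 \<and>
    bpos p < bpos q \<and> bpos q < bpos r \<and> bpos r < bpos s"
  then obtain p q r s where arcs: "{p, r} \<in> concat_diagram D1 D2" "{q, s} \<in> concat_diagram D1 D2"
    and less: "bpos p < bpos q" "bpos q < bpos r" "bpos r < bpos s" by blast
  obtain K1 where K1: "K1 \<in> components D1 D2" "outer -` K1 = {p, r}"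
    using arcs(1) by (auto simp: concat_diagram_def)
  obtain K2 where K2: "K2 \<in> components D1 D2" "outer -` K2 = {q, s}"
    using arcs(2) by (auto simp: concat_diagram_def)
  define l :: "node \<Rightarrow> int \<Rightarrow> int" where
    "l x = (if x \<in> K1 then (\<lambda>z. - z) else if x \<in> K2 then (\<lambda>z. 1 - z) else id)" for x
  have "fold (l \<circ> outer) (boundary a c) = id"
  proof (rule fold_outer_boundary)
    fix S x y assume S: "S \<in> arcs D1 D2" "x \<in> S" "y \<in> S"
    have "x \<in> K \<longleftrightarrow> y \<in> K" if "K \<in> components D1 D2" for K
      using arc_component[OF that S(1)] S by blast
    then show "l x = l y" using K1 K2 by (simp add: l_def)
  qed (auto simp: l_def fun_eq_iff)
  moreover define xs where "xs = filter (\<lambda>t. t \<in> {p, q, r, s}) (boundary a c)"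
  \<comment> \<open>Boundary points off the two strands carry the identity, so only the four end
    points matter.\<close>
  have "fold (l \<circ> outer) xs = fold (l \<circ> outer) (boundary a c)"
    unfolding xs_def using K1(2) K2(2) by (intro fold_filter_id) (auto simp: l_def)
  moreover have "xs = [p, q, r, s]"
  proof -
    have pts: "{p, q, r, s} \<subseteq> points a c"
      using K1 K2 component_sub outer_points by blast
    have sx: "sorted_wrt (\<lambda>p q. bpos p < bpos q) xs"
      unfolding xs_def using sorted_boundary by (rule sorted_wrt_filter)
    have setx: "set xs = {p, q, r, s}" using pts by (auto simp: xs_def set_boundary)
    have "map bpos xs = map bpos [p, q, r, s]"
    proof (rule sorted_distinct_set_unique)
      show "sorted (map bpos xs)" "distinct (map bpos xs)"
        using sx strict_sorted_iff[of "map bpos xs"] by (simp_all add: sorted_wrt_map)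
      show "sorted (map bpos [p, q, r, s])" "distinct (map bpos [p, q, r, s])" using less by auto
      show "set (map bpos xs) = set (map bpos [p, q, r, s])" by (simp add: setx)
    qed
    moreover have "inj_on bpos (set xs \<union> set [p, q, r, s])"
      using pts bpos_inj unfolding setx inj_on_def by (metis (no_types, lifting) Un_absorb list.set(1) list.simps(15) subsetD)
    ultimately show ?thesis using inj_on_map_eq_map by metis
  qed
  moreover have "p \<notin> {q, s}" "q \<notin> {p, r}" "r \<notin> {q, s}" "s \<notin> {p, r}" using less by auto
  then have "outer p \<in> K1" "outer r \<in> K1" "outer q \<notin> K1" "outer s \<notin> K1" "outer q \<in> K2" "outer s \<in> K2"
    using K1(2) K2(2) by blast+
  \<comment> \<open>Starting from 0, the points \<open>p\<close>, \<open>q\<close>,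
    \<open>r\<close>, \<open>s\<close> lead in turn to 0, 1, -1 and 2.\<close>
  then have "fold (l \<circ> outer) [p, q, r, s] 0 = 2" by (simp add: l_def)
  ultimately show False by simp
qed

lemma concat_diagrams: "concat_diagram D1 D2 \<in> diagrams a c"
proof -
  have "partition_on (points a c) (concat_diagram D1 D2)"
  proof (rule partition_onI)
    show "\<Union>(concat_diagram D1 D2) = points a c"
    proof (intro Set.set_eqI iffI)
      fix p assume "p \<in> points a c"
      then obtain K where "K \<in> components D1 D2" "outer p \<in> K"
        using component_ex unfolding outer_points by blast
      then show "p \<in> \<Union>(concat_diagram D1 D2)"
        unfolding concat_diagram_def by blast
    next
      fix p assume "p \<in> \<Union>(concat_diagram D1 D2)"
      then show "p \<in> points a c"
        unfolding concat_diagram_def outer_points using component_sub by blast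
    qed
    show "disjnt p q" if "p \<in> concat_diagram D1 D2" "q \<in> concat_diagram D1 D2" "p \<noteq> q" for p q
      using that component_eq unfolding concat_diagram_def disjnt_def by blast
  qed (auto simp: concat_diagram_def)
  moreover have "card S = 2" if S: "S \<in> concat_diagram D1 D2" for S
  proof -
    obtain K where K: "K \<in> components D1 D2" "S = outer -` K" "S \<noteq> {}"
      using S by (auto simp: concat_diagram_def)
    have "finite S" unfolding K by (rule finite_vimageI[OF finite_component[OF K(1)] outer_inj])
    then show ?thesis using card_outer[OF K(1)] K by auto
  qed
  ultimately show ?thesis using concat_noncrossing by (simp add: diagrams_def)
qed

end

section \<open>The matrix of a diagram\<close>

text \<open>
  The matrix of a diagram tests whether the characteristic functions of \<open>X\<close> and \<open>Y\<close>, negated at the odd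
  positions, are constant along the arcs. The sign \<open>sg X\<close> cancels in products; it turns the
  symmetric cups into antisymmetric ones.
\<close>

primrec label :: "nat set \<Rightarrow> nat set \<Rightarrow> point \<Rightarrow> bool" where
  "label X Y (Top i) = ((i \<in> X) = even i)"
| "label X Y (Bot j) = ((j \<in> Y) = even j)"

definition compatible :: "diagram \<Rightarrow> nat set \<Rightarrow> nat set \<Rightarrow> bool" where
  "compatible D X Y \<longleftrightarrow> (\<forall>S\<in>D. \<forall>p\<in>S. \<forall>q\<in>S. label X Y p = label X Y q)"

definition sg :: "nat set \<Rightarrow> rat" where
  "sg X = (- 1) ^ \<Sum>X"

definition mat_diagram :: "diagram \<Rightarrow> nat set \<Rightarrow> nat set \<Rightarrow> rat" where
  "mat_diagram D X Y = (if compatible D X Y then sg X * sg Y else 0)"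

definition mat :: "tl \<Rightarrow> nat set \<Rightarrow> nat set \<Rightarrow> rat" where
  "mat x X Y = (\<Sum>D\<in>Poly_Mapping.keys x. Poly_Mapping.lookup x D * mat_diagram D X Y)"

lemma compatibleD: "compatible D X Y \<Longrightarrow> S \<in> D \<Longrightarrow> p \<in> S \<Longrightarrow> q \<in> S \<Longrightarrow> label X Y p = label X Y q"
  unfolding compatible_def by blast

lemma sg_square [simp]: "sg X * sg X = 1"
  by (simp add: sg_def flip: power_add)

context stacked
begin

primrec node_label :: "nat set \<Rightarrow> nat set \<Rightarrow> nat set \<Rightarrow> node \<Rightarrow> bool" where
  "node_label X Y Z (Upper i) = ((i \<in> X) = even i)"
| "node_label X Y Z (Middle i) = ((i \<in> Y) = even i)"
| "node_label X Y Z (Lower i) = ((i \<in> Z) = even i)"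

lemma node_label_upper: "node_label X Y Z (in_upper p) = label X Y p"
  and node_label_lower: "node_label X Y Z (in_lower p) = label Y Z p"
  and node_label_outer: "node_label X Y Z (outer p) = label X Z p"
  by (cases p; simp)+

lemma compatible_components:
  "compatible D1 X Y \<and> compatible D2 Y Z \<longleftrightarrow>
    (\<forall>K\<in>components D1 D2. \<forall>x\<in>K. \<forall>y\<in>K. node_label X Y Z x = node_label X Y Z y)"
  (is "?L \<longleftrightarrow> ?C")
proof
  assume L: ?L
  have step: "node_label X Y Z x = node_label X Y Z y" if xy: "(x, y) \<in> R" for x y
  proof -
    obtain S where S: "S \<in> arcs D1 D2" "x \<in> S" "y \<in> S" using xy by (auto simp: R_def)
    from S(1) consider T where "T \<in> D1" "S = in_upper ` T" | T where "T \<in> D2" "S = in_lower ` T"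
      by (auto simp: arcs_def)
    then show ?thesis
    proof cases
      case 1
      then obtain p q where pq: "p \<in> T" "q \<in> T" and xy: "x = in_upper p" "y = in_upper q" using S by blast
      show ?thesis
        unfolding xy node_label_upper by (rule compatibleD[OF conjunct1[OF L] 1(1) pq])
    next
      case 2
      then obtain p q where pq: "p \<in> T" "q \<in> T" and xy: "x = in_lower p" "y = in_lower q" using S by blast
      show ?thesis
        unfolding xy node_label_lower by (rule compatibleD[OF conjunct2[OF L] 2(1) pq])
    qed
  qed
  have star: "node_label X Y Z x = node_label X Y Z y" if "(x, y) \<in> R\<^sup>*" for x y
    using that by (induction rule: rtrancl_induct) (simp_all add: step)
  show ?C using component_R star by blast
next
  assume C: ?C
  have *: "node_label X Y Z x = node_label X Y Z y" if "S \<in> arcs D1 D2" "x \<in> S" "y \<in> S" for S x y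
  proof -
    have "x \<in> V" using that Union_arcs by blast
    then obtain K where K: "K \<in> components D1 D2" "x \<in> K" using component_ex by blast
    then have "y \<in> K" using arc_component[OF K(1) that(1,2)] that by blast
    then show ?thesis using C[rule_format, OF K(1,2)] by blast
  qed
  have "label X Y p = label X Y q" if "S \<in> D1" "p \<in> S" "q \<in> S" for S p q
    using *[of "in_upper ` S" "in_upper p" "in_upper q"] that by (simp add: arcs_def node_label_upper)
  moreover have "label Y Z p = label Y Z q" if "S \<in> D2" "p \<in> S" "q \<in> S" for S p q
    using *[of "in_lower ` S" "in_lower p" "in_lower q"] that by (simp add: arcs_def node_label_lower)
  ultimately show ?L unfolding compatible_def by blast
qed

lemma compatible_concat:
  "compatible (concat_diagram D1 D2) X Z \<longleftrightarrow>
    (\<forall>K\<in>components D1 D2. \<forall>p\<in>outer -` K. \<forall>q\<in>outer -` K. label X Z p = label X Z q)"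
  unfolding compatible_def concat_diagram_def by blast

text \<open>A component that reaches the boundary inherits its label from there, while a closed loop
  is free to take either label. The bijection sends a set \<open>L\<close> of loops to the labeling
  whose true loops are exactly those in \<open>L\<close>.\<close>

lemma card_compatible:
  "card {Y \<in> Pow {1..b}. compatible D1 X Y \<and> compatible D2 Y Z} =
    (if compatible (concat_diagram D1 D2) X Z then 2 ^ loops D1 D2 else 0)"
proof (cases "compatible (concat_diagram D1 D2) X Z")
  case False
  have "\<not> (compatible D1 X Y \<and> compatible D2 Y Z)" for Y
    using False unfolding compatible_components compatible_concat
    by (metis node_label_outer vimageD)
  then have "{Y \<in> Pow {1..b}. compatible D1 X Y \<and> compatible D2 Y Z} = {}" by blast
  then show ?thesis using False by (simp only: card.empty if_False)
next
  case True
  define Lo where "Lo = {K \<in> components D1 D2. outer -` K = {}}"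
  define comp where "comp x = (THE K. K \<in> components D1 D2 \<and> x \<in> K)" for x
  have comp_eq: "comp x = K" if "K \<in> components D1 D2" "x \<in> K" for K x
    unfolding comp_def using that component_eq by (intro the_equality) blast+
  define \<beta> where "\<beta> L K \<longleftrightarrow> (if K \<in> Lo then K \<in> L else (\<exists>p. outer p \<in> K \<and> label X Z p))" for L K
  \<comment> \<open>Undoes the negation at odd positions, to turn labels back into a subset.\<close>
  define Yof where "Yof L = {j \<in> {1..b}. \<beta> L (comp (Middle j)) = even j}" for L
  have lab: "node_label X (Yof L) Z x = \<beta> L K" if K: "K \<in> components D1 D2" "x \<in> K" for L K x
  proof -
    have xV: "x \<in> V" using component_sub K by blast
    have outer: "node_label X Y Z (outer p) = \<beta> L K" if p: "outer p \<in> K" for p Y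
    proof -
      have "K \<notin> Lo" using p by (auto simp: Lo_def)
      then show ?thesis
        using True K(1) p unfolding compatible_concat \<beta>_def node_label_outer by (metis vimageI2)
    qed
    show ?thesis
    proof (cases x)
      case (Upper i)
      then show ?thesis using outer[of "Top i" "Yof L"] K by simp
    next
      case (Middle i)
      then have "i \<in> {1..b}" using xV by (auto simp: V_def)
      then show ?thesis using comp_eq[OF K] Middle by (auto simp: Yof_def)
    next
      case (Lower i)
      then show ?thesis using outer[of "Bot i" "Yof L"] K by simp
    qed
  qed
  have "bij_betw Yof (Pow Lo) {Y \<in> Pow {1..b}. compatible D1 X Y \<and> compatible D2 Y Z}"
  proof (rule bij_betwI')
    fix L L' assume L: "L \<in> Pow Lo" "L' \<in> Pow Lo"
    have "K \<in> L \<longleftrightarrow> K \<in> L'" if eq: "Yof L = Yof L'" and K: "K \<in> Lo" for K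
    proof -
      have Kc: "K \<in> components D1 D2" using K by (simp add: Lo_def)
      obtain x where "x \<in> K" using component_ne[OF Kc] by blast
      then show ?thesis using lab[OF Kc, of x L] lab[OF Kc, of x L'] eq K by (simp add: \<beta>_def)
    qed
    then show "Yof L = Yof L' \<longleftrightarrow> L = L'" using L by blast
  next
    fix L assume "L \<in> Pow Lo"
    show "Yof L \<in> {Y \<in> Pow {1..b}. compatible D1 X Y \<and> compatible D2 Y Z}"
      unfolding mem_Collect_eq compatible_components using lab by (auto simp: Yof_def)
  next
    fix Y assume "Y \<in> {Y \<in> Pow {1..b}. compatible D1 X Y \<and> compatible D2 Y Z}"
    then have Y: "Y \<subseteq> {1..b}"
      and C: "\<And>K x y. K \<in> components D1 D2 \<Longrightarrow> x \<in> K \<Longrightarrow> y \<in> K \<Longrightarrow> node_label X Y Z x = node_label X Y Z y"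
      unfolding mem_Collect_eq compatible_components by blast+
    define L where "L = {K \<in> Lo. \<forall>x\<in>K. node_label X Y Z x}"
    have "j \<in> Y \<longleftrightarrow> j \<in> Yof L" if j: "j \<in> {1..b}" for j
    proof -
      have "Middle j \<in> V" using j by (simp add: V_def)
      then obtain K where K: "K \<in> components D1 D2" "Middle j \<in> K" using component_ex by blast
      have "\<beta> L K = node_label X Y Z (Middle j)"
      proof (cases "K \<in> Lo")
        case True
        have "(\<forall>x\<in>K. node_label X Y Z x) = node_label X Y Z (Middle j)"
          using C[OF K(1) K(2)] K(2) by blast
        then show ?thesis using True unfolding \<beta>_def L_def by simp
      next
        case False
        then obtain p where p: "outer p \<in> K" using K by (auto simp: Lo_def)
        have "label X Z q = node_label X Y Z (Middle j)" if "outer q \<in> K" for q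
          using C[OF K(1) that K(2)] unfolding node_label_outer .
        then have "(\<exists>q. outer q \<in> K \<and> label X Z q) = node_label X Y Z (Middle j)"
          using p by blast
        then show ?thesis using False unfolding \<beta>_def by simp
      qed
      then show ?thesis using lab[OF K, of L] j by auto
    qed
    then have "Y = Yof L" using Y by (auto simp: Yof_def)
    moreover have "L \<in> Pow Lo" by (auto simp: L_def)
    ultimately show "\<exists>L\<in>Pow Lo. Y = Yof L" by blast
  qed
  then have "card (Pow Lo) = card {Y \<in> Pow {1..b}. compatible D1 X Y \<and> compatible D2 Y Z}"
    by (rule bij_betw_same_card)
  moreover have "finite Lo" using finite_components by (simp add: Lo_def)
  ultimately show ?thesis using True by (simp add: card_Pow loops_def Lo_def)
qed

lemma mat_diagram_concat:
  "(\<Sum>Y\<in>Pow {1..b}. mat_diagram D1 X Y * mat_diagram D2 Y Z) =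
    2 ^ loops D1 D2 * mat_diagram (concat_diagram D1 D2) X Z"
proof -
  have "mat_diagram D1 X Y * mat_diagram D2 Y Z =
      (if compatible D1 X Y \<and> compatible D2 Y Z then sg X * sg Z else 0)" for Y
    using sg_square[of Y] by (simp add: mat_diagram_def)
  then have "(\<Sum>Y\<in>Pow {1..b}. mat_diagram D1 X Y * mat_diagram D2 Y Z) =
      of_nat (card {Y \<in> Pow {1..b}. compatible D1 X Y \<and> compatible D2 Y Z}) * (sg X * sg Z)"
    by (simp add: sum.If_cases Int_def)
  then show ?thesis by (simp only: card_compatible) (simp add: mat_diagram_def)
qed

end

section \<open>Linear extension of the matrices; composition as matrix product\<close>

lemma mat_superset:
  assumes "finite A" "Poly_Mapping.keys x \<subseteq> A"
  shows "mat x X Y = (\<Sum>D\<in>A. Poly_Mapping.lookup x D * mat_diagram D X Y)"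
  unfolding mat_def using assms by (intro sum.mono_neutral_left) (auto simp: in_keys_iff)

lemma mat_0 [simp]: "mat 0 X Y = 0"
  by (simp add: mat_def)

lemma mat_add: "mat (x + y) X Y = mat x X Y + mat y X Y"
  using Poly_Mapping.keys_add[of x y]
  by (simp add: mat_superset[of "Poly_Mapping.keys x \<union> Poly_Mapping.keys y"] lookup_add
      distrib_right sum.distrib)

lemma mat_uminus: "mat (- x) X Y = - mat x X Y"
  by (simp add: mat_def sum_negf)

lemma mat_diff: "mat (x - y) X Y = mat x X Y - mat y X Y"
  using mat_add[of x "- y"] by (simp add: mat_uminus)

lemma mat_sum: "mat (\<Sum>i\<in>I. x i) X Y = (\<Sum>i\<in>I. mat (x i) X Y)"
  by (induction I rule: infinite_finite_induct) (auto simp: mat_add)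

lemma mat_single: "mat (Poly_Mapping.single D c) X Y = c * mat_diagram D X Y"
  by (simp add: mat_def)

lemma lookup_scale: "Poly_Mapping.lookup (scale c x) k = c * Poly_Mapping.lookup x k"
  by (simp add: scale_def Poly_Mapping.map.rep_eq when_def)

lemma keys_scale: "Poly_Mapping.keys (scale c x) \<subseteq> Poly_Mapping.keys x"
  by (auto simp: in_keys_iff lookup_scale)

lemma mat_scale: "mat (scale c x) X Y = c * mat x X Y"
  by (subst mat_superset[OF _ keys_scale]) (simp_all add: lookup_scale sum_distrib_left mult.assoc mat_def)

lemma mat_lin_map: "mat (lin_map f x) X Y = (\<Sum>D\<in>Poly_Mapping.keys x. Poly_Mapping.lookup x D * mat_diagram (f D) X Y)"
  by (simp add: lin_map_def mat_sum mat_single)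

lemma Hom_0: "0 \<in> Hom a b"
  by (simp add: Hom_def)

lemma Hom_add: "x \<in> Hom a b \<Longrightarrow> y \<in> Hom a b \<Longrightarrow> x + y \<in> Hom a b"
  using Poly_Mapping.keys_add[of x y] by (auto simp: Hom_def)

lemma Hom_uminus: "x \<in> Hom a b \<Longrightarrow> - x \<in> Hom a b"
  by (simp add: Hom_def)

lemma Hom_diff: "x \<in> Hom a b \<Longrightarrow> y \<in> Hom a b \<Longrightarrow> x - y \<in> Hom a b"
  using Hom_add[of x a b "- y"] by (simp add: Hom_uminus)

lemma Hom_sum: "(\<And>i. i \<in> I \<Longrightarrow> x i \<in> Hom a b) \<Longrightarrow> (\<Sum>i\<in>I. x i) \<in> Hom a b"
  by (induction I rule: infinite_finite_induct) (auto simp: Hom_0 Hom_add)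

lemma Hom_scale: "x \<in> Hom a b \<Longrightarrow> scale c x \<in> Hom a b"
  using keys_scale[of c x] by (auto simp: Hom_def)

lemma Hom_single: "D \<in> diagrams a b \<Longrightarrow> Poly_Mapping.single D c \<in> Hom a b"
  by (simp add: Hom_def)

lemma Hom_lin_map:
  assumes "x \<in> Hom a b" "\<And>D. D \<in> diagrams a b \<Longrightarrow> f D \<in> diagrams a' b'"
  shows "lin_map f x \<in> Hom a' b'"
  using assms unfolding lin_map_def by (intro Hom_sum Hom_single) (auto simp: Hom_def)

lemma Hom_comp:
  assumes "x \<in> Hom a b" "y \<in> Hom b c"
  shows "x \<odot> y \<in> Hom a c"
  unfolding tl_comp_def
proof (intro Hom_sum Hom_single)
  fix D1 D2 assume "D1 \<in> Poly_Mapping.keys x" "D2 \<in> Poly_Mapping.keys y"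
  then interpret stacked a b c D1 D2
    using assms by unfold_locales (auto simp: Hom_def)
  show "concat_diagram D1 D2 \<in> diagrams a c" by (rule concat_diagrams)
qed

lemma mat_comp:
  assumes "x \<in> Hom a b" "y \<in> Hom b c"
  shows "mat (x \<odot> y) X Z = (\<Sum>Y\<in>Pow {1..b}. mat x X Y * mat y Y Z)"
proof -
  let ?l = Poly_Mapping.lookup and ?k = Poly_Mapping.keys
  have "mat (x \<odot> y) X Z = (\<Sum>D1\<in>?k x. \<Sum>D2\<in>?k y.
      ?l x D1 * ?l y D2 * (2 ^ loops D1 D2 * mat_diagram (concat_diagram D1 D2) X Z))"
    by (simp add: tl_comp_def mat_sum mat_single mult_ac)
  also have "\<dots> = (\<Sum>D1\<in>?k x. \<Sum>D2\<in>?k y.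
      ?l x D1 * ?l y D2 * (\<Sum>Y\<in>Pow {1..b}. mat_diagram D1 X Y * mat_diagram D2 Y Z))"
  proof (intro sum.cong refl)
    fix D1 D2 assume "D1 \<in> ?k x" "D2 \<in> ?k y"
    then interpret stacked a b c D1 D2
      using assms by unfold_locales (auto simp: Hom_def)
    show "?l x D1 * ?l y D2 * (2 ^ loops D1 D2 * mat_diagram (concat_diagram D1 D2) X Z) =
      ?l x D1 * ?l y D2 * (\<Sum>Y\<in>Pow {1..b}. mat_diagram D1 X Y * mat_diagram D2 Y Z)"
      by (simp only: mat_diagram_concat)
  qed
  also have "\<dots> = (\<Sum>D1\<in>?k x. \<Sum>D2\<in>?k y. \<Sum>Y\<in>Pow {1..b}.
      (?l x D1 * mat_diagram D1 X Y) * (?l y D2 * mat_diagram D2 Y Z))"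
    by (simp add: sum_distrib_left mult_ac)
  also have "\<dots> = (\<Sum>D1\<in>?k x. \<Sum>Y\<in>Pow {1..b}. \<Sum>D2\<in>?k y.
      (?l x D1 * mat_diagram D1 X Y) * (?l y D2 * mat_diagram D2 Y Z))"
    by (intro sum.cong refl sum.swap)
  also have "\<dots> = (\<Sum>Y\<in>Pow {1..b}. \<Sum>D1\<in>?k x. \<Sum>D2\<in>?k y.
      (?l x D1 * mat_diagram D1 X Y) * (?l y D2 * mat_diagram D2 Y Z))"
    by (rule sum.swap)
  also have "\<dots> = (\<Sum>Y\<in>Pow {1..b}. mat x X Y * mat y Y Z)"
    by (simp add: mat_def sum_product)
  finally show ?thesis .
qed

section \<open>Linear independence of the matrices of planar matchings\<close>

lemma Top_in_points [simp]: "Top i \<in> points a b \<longleftrightarrow> 1 \<le> i \<and> i \<le> a"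
  and Bot_in_points [simp]: "Bot j \<in> points a b \<longleftrightarrow> 1 \<le> j \<and> j \<le> b"
  by (auto simp: points_def)

text \<open>A substitute for \<open>label\<close> without parities: now the two ends of an arc have
  to differ. Complementing the bottom makes this the right condition for strands from top to bottom
  as well, so a compatible pair becomes a set of points that meets each arc exactly once.\<close>

primrec side_label :: "nat set \<Rightarrow> nat set \<Rightarrow> point \<Rightarrow> bool" where
  "side_label X Y (Top i) = (i \<in> X)"
| "side_label X Y (Bot j) = (j \<notin> Y)"

lemma card_between:
  assumes "p \<in> points a b" "q \<in> points a b" "bpos p < bpos q"
  shows "card {r \<in> points a b. bpos p < bpos r \<and> bpos r < bpos q} =
    (case (p, q) of (Top i, Top j) \<Rightarrow> i - j - 1 | (Top i, Bot j) \<Rightarrow> (i - 1) + (j - 1)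
      | (Bot i, Bot j) \<Rightarrow> j - i - 1 | (Bot i, Top j) \<Rightarrow> 0)"
proof (cases p)
  case (Top i)
  show ?thesis
  proof (cases q)
    case q: (Top j)
    have "{r \<in> points a b. bpos p < bpos r \<and> bpos r < bpos q} = Top ` {j<..<i}"
      using assms Top q by (auto simp: points_def)
    then show ?thesis using Top q by (simp add: card_image inj_on_def)
  next
    case q: (Bot j)
    have "{r \<in> points a b. bpos p < bpos r \<and> bpos r < bpos q} = Top ` {1..<i} \<union> Bot ` {1..<j}"
      using assms Top q by (auto simp: points_def)
    then show ?thesis using Top q
      by (simp, subst card_Un_disjoint) (auto simp: card_image inj_on_def)
  qed
next
  case (Bot i)
  show ?thesis
  proof (cases q)
    case q: (Top j)
    then show ?thesis using assms Bot by simp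
  next
    case q: (Bot j)
    have "{r \<in> points a b. bpos p < bpos r \<and> bpos r < bpos q} = Bot ` {i<..<j}"
      using assms Bot q by (auto simp: points_def)
    then show ?thesis using Bot q by (simp add: card_image inj_on_def)
  qed
qed

text \<open>An even number of points lies under an arc. Hence its ends have opposite parity if they
  are on the same side and equal parity otherwise, and the parity twist in \<open>label\<close>
  matches the complement in \<open>side_label\<close>.\<close>

lemma label_mate_aux:
  assumes D: "D \<in> diagrams a b" and p: "p \<in> points a b" and less: "bpos p < bpos (mate D p)"
  shows "label X Y p = label X Y (mate D p) \<longleftrightarrow> side_label X Y p \<noteq> side_label X Y (mate D p)"
proof -
  note ev = even_between[OF D p, unfolded card_between[OF p mate(3)[OF D p] less]]
  show ?thesis
  proof (cases p)
    case (Top i)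
    show ?thesis
    proof (cases "mate D p")
      case q: (Top j)
      then have "even (i - j - 1)" "j < i" using ev Top less by simp_all
      then have "even i \<noteq> even j" by presburger
      then show ?thesis using Top q by auto
    next
      case q: (Bot j)
      then have "even ((i - 1) + (j - 1))" "1 \<le> i" "1 \<le> j"
        using ev Top p mate(3)[OF D p] by simp_all
      then have "even i = even j" by presburger
      then show ?thesis using Top q by auto
    qed
  next
    case (Bot i)
    show ?thesis
    proof (cases "mate D p")
      case q: (Top j)
      then show ?thesis using Bot less by simp
    next
      case q: (Bot j)
      then have "even (j - i - 1)" "i < j" using ev Bot less by simp_all
      then have "even i \<noteq> even j" by presburger
      then show ?thesis using Bot q by auto
    qed
  qed
qed

lemma label_mate:
  assumes D: "D \<in> diagrams a b" and p: "p \<in> points a b"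
  shows "label X Y p = label X Y (mate D p) \<longleftrightarrow> side_label X Y p \<noteq> side_label X Y (mate D p)"
proof (cases "bpos p < bpos (mate D p)")
  case True
  then show ?thesis by (rule label_mate_aux[OF D p])
next
  case False
  then have "bpos (mate D p) < bpos p"
    using bpos_inj[OF p mate(3)[OF D p]] mate(1)[OF D p] by fastforce
  then show ?thesis
    using label_mate_aux[OF D mate(3)[OF D p], of X Y] mate_mate[OF D p] by auto
qed

lemma compatible_iff:
  assumes D: "D \<in> diagrams a b"
  shows "compatible D X Y \<longleftrightarrow> (\<forall>p\<in>points a b. side_label X Y p \<noteq> side_label X Y (mate D p))"
proof
  assume C: "compatible D X Y"
  show "\<forall>p\<in>points a b. side_label X Y p \<noteq> side_label X Y (mate D p)"
  proof
    fix p assume p: "p \<in> points a b"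
    show "side_label X Y p \<noteq> side_label X Y (mate D p)"
      using compatibleD[OF C mate(2)[OF D p], of p "mate D p"] label_mate[OF D p] by blast
  qed
next
  assume R: "\<forall>p\<in>points a b. side_label X Y p \<noteq> side_label X Y (mate D p)"
  show "compatible D X Y"
    unfolding compatible_def
  proof
    fix S assume S: "S \<in> D"
    then obtain p where p: "p \<in> points a b" "S = {p, mate D p}" by (rule diagrams_arcE[OF D])
    then have "label X Y p = label X Y (mate D p)" using label_mate[OF D p(1)] R by blast
    then show "\<forall>p\<in>S. \<forall>q\<in>S. label X Y p = label X Y q" unfolding p(2) by blast
  qed
qed

text \<open>The opening brackets, when a planar matching is read as a bracket sequence in the order
  of \<open>bpos\<close>.\<close>

definition openers :: "nat \<Rightarrow> nat \<Rightarrow> diagram \<Rightarrow> point set" where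
  "openers a b D = {p \<in> points a b. bpos p < bpos (mate D p)}"

lemma bpos_mate_less:
  assumes D: "D \<in> diagrams a b" and p: "p \<in> points a b"
  shows "bpos (mate D p) < bpos p \<longleftrightarrow> p \<notin> openers a b D"
  using bpos_inj[OF p mate(3)[OF D p]] mate(1)[OF D p] p by (fastforce simp: openers_def)

lemma mate_opener:
  assumes D: "D \<in> diagrams a b" and p: "p \<in> points a b"
  shows "mate D p \<in> openers a b D \<longleftrightarrow> p \<notin> openers a b D"
  using bpos_mate_less[OF D p] mate_mate[OF D p] mate(3)[OF D p] by (simp add: openers_def)

text \<open>Suppose that the partner \<open>p'\<close> of the closer \<open>r\<close> in
  \<open>D'\<close> lay to the right of its partner in \<open>D\<close>. Then noncrossing would
  force \<open>D\<close> to close the opener \<open>p'\<close> before \<open>r\<close>. By induction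
  \<open>D'\<close> would close it there too, but it does so at \<open>r\<close>.\<close>

lemma openers_determine_aux:
  assumes D: "D \<in> diagrams a b" and D': "D' \<in> diagrams a b" and eq: "openers a b D = openers a b D'"
    and r: "r \<in> points a b" "r \<notin> openers a b D"
    and IH: "\<And>s. s \<in> points a b \<Longrightarrow> s \<notin> openers a b D \<Longrightarrow> bpos s < bpos r \<Longrightarrow> mate D s = mate D' s"
  shows "\<not> bpos (mate D r) < bpos (mate D' r)"
proof
  assume less: "bpos (mate D r) < bpos (mate D' r)"
  define p where "p = mate D r"
  define p' where "p' = mate D' r"
  have pts: "p \<in> points a b" "p' \<in> points a b" using mate(3) D D' r by (auto simp: p_def p'_def)
  have inv: "mate D p = r" "mate D' p' = r" using mate_mate D D' r by (auto simp: p_def p'_def)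
  have "p' \<in> openers a b D" using mate_opener[OF D' r(1)] r(2) eq by (simp add: p'_def)
  have p_r: "bpos p' < bpos r" using bpos_mate_less[OF D' r(1)] r(2) eq by (simp add: p'_def)
  define s where "s = mate D p'"
  have s: "s \<in> points a b" "mate D s = p'" using mate(3)[OF D pts(2)] mate_mate[OF D pts(2)] by (auto simp: s_def)
  have sno: "s \<notin> openers a b D" using mate_opener[OF D pts(2)] \<open>p' \<in> openers a b D\<close> by (simp add: s_def)
  have "s \<noteq> r" using s(2) less by (auto simp: p_def p'_def)
  then have "bpos s \<noteq> bpos r" using bpos_inj s(1) r(1) by blast
  moreover have "\<not> bpos r < bpos s"
    using mate_noncrossing[OF D pts] less p_r inv(1) by (auto simp: s_def p_def p'_def)
  ultimately have "bpos s < bpos r" by simp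
  then have "mate D' s = p'" using IH[OF s(1) sno] s(2) by simp
  then have "s = r" using mate_mate[OF D' s(1)] inv(2) by simp
  then show False using \<open>s \<noteq> r\<close> by simp
qed

lemma mate_determines:
  assumes D: "D \<in> diagrams a b" and D': "D' \<in> diagrams a b"
    and eq: "\<And>p. p \<in> points a b \<Longrightarrow> mate D p = mate D' p"
  shows "D = D'"
proof (intro Set.set_eqI iffI)
  fix S assume "S \<in> D"
  then obtain p where p: "p \<in> points a b" "S = {p, mate D p}" by (rule diagrams_arcE[OF D])
  then show "S \<in> D'" using mate(2)[OF D' p(1)] eq[OF p(1)] by simp
next
  fix S assume "S \<in> D'"
  then obtain p where p: "p \<in> points a b" "S = {p, mate D' p}" by (rule diagrams_arcE[OF D'])
  then show "S \<in> D" using mate(2)[OF D p(1)] eq[OF p(1)] by simp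
qed

lemma openers_determine:
  assumes D: "D \<in> diagrams a b" and D': "D' \<in> diagrams a b" and eq: "openers a b D = openers a b D'"
  shows "D = D'"
proof -
  have closers: "mate D r = mate D' r" if "r \<in> points a b" "r \<notin> openers a b D" for r
    using that
  proof (induction "nat (bpos r + int a)" arbitrary: r rule: less_induct)
    case less
    have IH: "mate D s = mate D' s" if s: "s \<in> points a b" "s \<notin> openers a b D" "bpos s < bpos r" for s
    proof (rule less.hyps[OF _ s(1,2)])
      have "bpos s + int a \<ge> 0" using s(1) by (auto simp: points_def)
      then show "nat (bpos s + int a) < nat (bpos r + int a)" using s(3) by simp
    qed
    have "\<not> bpos (mate D r) < bpos (mate D' r)"
      using openers_determine_aux[OF D D' eq less.prems] IH by blast
    moreover have "\<not> bpos (mate D' r) < bpos (mate D r)"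
      using openers_determine_aux[OF D' D eq[symmetric]] less.prems IH eq by (metis (no_types, lifting))
    ultimately have "bpos (mate D r) = bpos (mate D' r)" by linarith
    then show ?case using bpos_inj mate(3) D D' less.prems(1) by blast
  qed
  have "mate D p = mate D' p" if p: "p \<in> points a b" for p
  proof (cases "p \<in> openers a b D")
    case True
    then have "mate D (mate D p) = mate D' (mate D p)"
      using closers mate_opener[OF D p] mate(3)[OF D p] by blast
    then show ?thesis using mate_mate[OF D p] mate_mate[OF D' mate(3)[OF D p]] by simp
  qed (use closers p in blast)
  then show ?thesis by (rule mate_determines[OF D D'])
qed

definition opener_sum :: "nat \<Rightarrow> nat \<Rightarrow> diagram \<Rightarrow> int" where
  "opener_sum a b D = (\<Sum>p\<in>openers a b D. bpos p)"

text \<open>An arc contributes to \<^term>\<open>opener_sum\<close> the smallest position that it can.\<close>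
lemma opener_sum_transversal:
  assumes D: "D \<in> diagrams a b" and O: "O' \<subseteq> points a b"
    and t: "\<And>p. p \<in> points a b \<Longrightarrow> p \<in> O' \<longleftrightarrow> mate D p \<notin> O'"
  shows "opener_sum a b D \<le> (\<Sum>p\<in>O'. bpos p)"
    and "opener_sum a b D = (\<Sum>p\<in>O'. bpos p) \<Longrightarrow> O' = openers a b D"
proof -
  define h where "h p = (if p \<in> O' then p else mate D p)" for p
  have opn: "openers a b D \<subseteq> points a b" by (auto simp: openers_def)
  have fin: "finite (openers a b D)" using opn finite_subset finite_points by blast
  have bij: "bij_betw h (openers a b D) O'"
  proof (rule bij_betwI[where g="\<lambda>p. if p \<in> openers a b D then p else mate D p"])
    show "h \<in> openers a b D \<rightarrow> O'" using t opn by (auto simp: h_def)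
    show "(\<lambda>p. if p \<in> openers a b D then p else mate D p) \<in> O' \<rightarrow> openers a b D"
      using mate_opener[OF D] O by auto
    show "(if h p \<in> openers a b D then h p else mate D (h p)) = p" if "p \<in> openers a b D" for p
      using that opn mate_opener[OF D, of p] mate_mate[OF D, of p] by (auto simp: h_def)
    show "h (if p \<in> openers a b D then p else mate D p) = p" if "p \<in> O'" for p
      using that O t[of p] mate_mate[OF D, of p] by (auto simp: h_def)
  qed
  have sum: "(\<Sum>p\<in>O'. bpos p) = (\<Sum>p\<in>openers a b D. bpos (h p))"
    using sum.reindex_bij_betw[OF bij, of bpos] by simp
  have le: "bpos p \<le> bpos (h p)" if "p \<in> openers a b D" for p
    using that by (auto simp: h_def openers_def)
  show "opener_sum a b D \<le> (\<Sum>p\<in>O'. bpos p)"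
    unfolding sum opener_sum_def by (intro sum_mono le)
  assume "opener_sum a b D = (\<Sum>p\<in>O'. bpos p)"
  then have eq: "bpos p = bpos (h p)" if "p \<in> openers a b D" for p
    using sum_mono_inv[of bpos "openers a b D" "\<lambda>p. bpos (h p)"] le fin that
    unfolding sum opener_sum_def by blast
  have "h p = p" if "p \<in> openers a b D" for p
    using eq[OF that] that by (auto simp: h_def openers_def split: if_splits)
  then have "h ` openers a b D = openers a b D" by force
  then show "O' = openers a b D" using bij by (simp add: bij_betw_def)
qed

text \<open>Triangularity: take a diagram \<open>D'\<close> of the support with the smallest
  \<open>opener_sum\<close> and test with the labeling given by its openers. These openers are a
  transversal of every compatible \<open>D\<close>, which therefore has no larger
  \<open>opener_sum\<close>; by minimality it has the same openers and is equal to
  \<open>D'\<close>.\<close>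

lemma mat_eq_0:
  assumes x: "x \<in> Hom a b"
    and m: "\<And>X Y. X \<subseteq> {1..a} \<Longrightarrow> Y \<subseteq> {1..b} \<Longrightarrow> mat x X Y = 0"
  shows "x = 0"
proof (rule ccontr)
  assume "x \<noteq> 0"
  then have "Poly_Mapping.keys x \<noteq> {}" by simp
  then obtain D' where D': "D' \<in> Poly_Mapping.keys x"
    and min: "\<And>D. D \<in> Poly_Mapping.keys x \<Longrightarrow> opener_sum a b D' \<le> opener_sum a b D"
    using arg_min_if_finite[of "Poly_Mapping.keys x" "opener_sum a b"]
    by (metis finite_keys not_le_imp_less)
  have dD': "D' \<in> diagrams a b" using D' x by (auto simp: Hom_def)
  \<comment> \<open>As \<open>side_label\<close> complements the bottom, \<open>X\<close> collects
    the openers at the top, but \<open>Y\<close> the closers at the bottom.\<close>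
  define X where "X = {i. Top i \<in> openers a b D'}"
  define Y where "Y = {j \<in> {1..b}. Bot j \<notin> openers a b D'}"
  have XY: "X \<subseteq> {1..a}" "Y \<subseteq> {1..b}" by (auto simp: X_def Y_def openers_def points_def)
  have sl: "side_label X Y p \<longleftrightarrow> p \<in> openers a b D'" if "p \<in> points a b" for p
    using that by (cases p) (auto simp: X_def Y_def points_def)
  have comp: "compatible D X Y \<longleftrightarrow> D = D'" if "D \<in> Poly_Mapping.keys x" for D
  proof
    have D: "D \<in> diagrams a b" using that x by (auto simp: Hom_def)
    show "D = D'" if "compatible D X Y"
    proof -
      have t: "p \<in> openers a b D' \<longleftrightarrow> mate D p \<notin> openers a b D'" if "p \<in> points a b" for p
        using \<open>compatible D X Y\<close> that sl[OF that] sl[OF mate(3)[OF D that]] unfolding compatible_iff[OF D] by blast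
      have sub: "openers a b D' \<subseteq> points a b" by (auto simp: openers_def)
      have "opener_sum a b D \<le> opener_sum a b D'"
        using opener_sum_transversal(1)[OF D sub t] by (simp add: opener_sum_def)
      then have "opener_sum a b D = opener_sum a b D'" using min[OF \<open>D \<in> Poly_Mapping.keys x\<close>] by simp
      then have "openers a b D' = openers a b D"
        by (intro opener_sum_transversal(2)[OF D sub t]) (simp_all only: opener_sum_def)
      then show ?thesis using openers_determine[OF D dD'] by simp
    qed
    show "compatible D X Y" if "D = D'"
      unfolding that compatible_iff[OF dD'] using sl mate_opener[OF dD'] mate(3)[OF dD'] by blast
  qed
  have "mat x X Y = (\<Sum>D\<in>Poly_Mapping.keys x. if D = D' then Poly_Mapping.lookup x D' * (sg X * sg Y) else 0)"
    unfolding mat_def mat_diagram_def using comp by (intro sum.cong refl) auto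
  also have "\<dots> = Poly_Mapping.lookup x D' * (sg X * sg Y)" using D' by simp
  also have "\<dots> \<noteq> 0" using D' by (simp add: in_keys_iff sg_def)
  finally show False using m[OF XY] by simp
qed

lemma mat_inj:
  assumes "x \<in> Hom a b" "y \<in> Hom a b"
    "\<And>X Y. X \<subseteq> {1..a} \<Longrightarrow> Y \<subseteq> {1..b} \<Longrightarrow> mat x X Y = mat y X Y"
  shows "x = y"
  using mat_eq_0[OF Hom_diff[OF assms(1,2)]] assms(3) by (simp add: mat_diff)

section \<open>Operations on diagrams and their matrices\<close>

lemma diagrams_even: "D \<in> diagrams a b \<Longrightarrow> even (a + b)"
proof -
  assume D: "D \<in> diagrams a b"
  have "card (points a b) = a + b"
    unfolding points_def by (subst card_Un_disjoint) (auto simp: card_image inj_on_def)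
  then show ?thesis using diagrams_card_Union[OF D subset_refl] diagrams_Union[OF D] by (metis dvd_triv_left)
qed

lemma noncrossingI:
  assumes "\<And>p q r s. {p, r} \<in> D \<Longrightarrow> {q, s} \<in> D \<Longrightarrow> bpos p < bpos q \<Longrightarrow> bpos q < bpos r \<Longrightarrow> bpos r < bpos s \<Longrightarrow> False"
  shows "noncrossing D"
  using assms unfolding noncrossing_def by blast

lemma noncrossingD:
  assumes "D \<in> diagrams a b" "{p, r} \<in> D" "{q, s} \<in> D" "bpos p < bpos q" "bpos q < bpos r" "bpos r < bpos s"
  shows False
  using assms unfolding diagrams_def noncrossing_def by blast

lemma diagrams_bpos:
  assumes "D \<in> diagrams a b" "{p, q} \<in> D"
  shows "- int a \<le> bpos p" "bpos p \<le> int b" "- int a \<le> bpos q" "bpos q \<le> int b"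
proof -
  have "p \<in> points a b" "q \<in> points a b" using assms diagrams_Union by blast+
  then show "- int a \<le> bpos p" "bpos p \<le> int b" "- int a \<le> bpos q" "bpos q \<le> int b"
    by (cases p; cases q; simp)+
qed

lemma points_Suc: "points (Suc a) (Suc b) = insert (Top (Suc a)) (insert (Bot (Suc b)) (points a b))"
  by (auto simp: points_def atLeastAtMostSuc_conv)

lemma insert_line_diagrams:
  assumes D: "D \<in> diagrams a b"
  shows "insert {Top (Suc a), Bot (Suc b)} D \<in> diagrams (Suc a) (Suc b)"
proof -
  have "partition_on (points (Suc a) (Suc b)) (insert {Top (Suc a), Bot (Suc b)} D)"
  proof (rule partition_onI)
    show "\<Union>(insert {Top (Suc a), Bot (Suc b)} D) = points (Suc a) (Suc b)"
      using diagrams_Union[OF D] by (auto simp: points_Suc)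
    have "S \<inter> {Top (Suc a), Bot (Suc b)} = {}" if "S \<in> D" for S
    proof -
      have "S \<subseteq> points a b" using that diagrams_Union[OF D] by blast
      then show ?thesis by (auto dest: subsetD)
    qed
    then show "disjnt S S'" if "S \<in> insert {Top (Suc a), Bot (Suc b)} D"
      "S' \<in> insert {Top (Suc a), Bot (Suc b)} D" "S \<noteq> S'" for S S'
      using that diagrams_disjoint[OF D] unfolding disjnt_def by blast
    show "{} \<notin> insert {Top (Suc a), Bot (Suc b)} D"
      using diagrams_card[OF D] by fastforce
  qed
  moreover have "\<forall>S\<in>insert {Top (Suc a), Bot (Suc b)} D. card S = 2"
    using diagrams_card[OF D] by auto
  moreover have "noncrossing (insert {Top (Suc a), Bot (Suc b)} D)"
  proof (rule noncrossingI)
    fix p q r s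
    assume pr: "{p, r} \<in> insert {Top (Suc a), Bot (Suc b)} D" and qs: "{q, s} \<in> insert {Top (Suc a), Bot (Suc b)} D"
      and less: "bpos p < bpos q" "bpos q < bpos r" "bpos r < bpos s"
    have "\<not> ({p, r} \<in> D \<and> {q, s} \<in> D)" using noncrossingD[OF D] less by blast
    then show False
      using pr qs less diagrams_bpos[OF D, of p r] diagrams_bpos[OF D, of q s]
      by (auto simp: doubleton_eq_iff)
  qed
  ultimately show ?thesis by (simp add: diagrams_def)
qed

lemma image_diagrams:
  assumes D: "D \<in> diagrams a b" and f: "inj_on f (points a b)" "f ` points a b = points a' b'"
    and nc: "noncrossing ((`) f ` D)"
  shows "(`) f ` D \<in> diagrams a' b'"
proof -
  have "partition_on (points a' b') ((`) f ` D)"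
  proof -
    have "(`) f ` D - {{}} = (`) f ` D" using diagrams_card[OF D] by fastforce
    then show ?thesis
      using D f partition_on_inj_image[of "points a b" D f] by (simp add: diagrams_def)
  qed
  moreover have "card S = 2" if "S \<in> (`) f ` D" for S
  proof -
    obtain S' where S': "S' \<in> D" "S = f ` S'" using \<open>S \<in> (`) f ` D\<close> by blast
    have "S' \<subseteq> points a b" using S'(1) diagrams_Union[OF D] by blast
    then have "inj_on f S'" using f(1) inj_on_subset by blast
    then show ?thesis using S' diagrams_card[OF D] by (simp add: card_image)
  qed
  ultimately show ?thesis using nc by (simp add: diagrams_def)
qed

lemma image_doubleton:
  assumes D: "D \<in> diagrams a b" and "{p, q} \<in> (`) f ` D"
  obtains p' q' where "{p', q'} \<in> D" "p = f p'" "q = f q'"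
proof -
  obtain S where S: "S \<in> D" "{p, q} = f ` S" using assms(2) by blast
  obtain u v where uv: "S = {u, v}" using diagrams_card[OF D S(1)] by (auto simp: card_2_iff)
  then have "{u, v} \<in> D" "{v, u} \<in> D" "{p, q} = {f u, f v}" using S by (auto simp: insert_commute)
  then show ?thesis using that by (auto simp: doubleton_eq_iff)
qed

text \<open>Only the top point \<open>Suc a\<close> moves, from the first to the last position in
  the order of \<open>bpos\<close>. This is a cyclic rotation of the boundary, which cannot create
  crossings.\<close>

lemma bend_point_diagrams:
  assumes D: "D \<in> diagrams (Suc a) b"
  shows "(`) (bend_point (Suc a) b 1) ` D \<in> diagrams a (Suc b)"
proof -
  let ?f = "bend_point (Suc a) b 1"
  have cases: "?f p = p \<and> bpos p > - int (Suc a) \<or> p = Top (Suc a) \<and> ?f p = Bot (Suc b)"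
    if "p \<in> points (Suc a) b" for p
    using that by (cases p) (auto simp: le_Suc_eq)
  show ?thesis
  proof (rule image_diagrams[OF D])
    show "inj_on ?f (points (Suc a) b)"
    proof (rule inj_onI)
      fix p q assume pq: "p \<in> points (Suc a) b" "q \<in> points (Suc a) b" "?f p = ?f q"
      then show "p = q" using cases[OF pq(1)] cases[OF pq(2)] by auto
    qed
    show "?f ` points (Suc a) b = points a (Suc b)"
    proof (intro Set.set_eqI iffI)
      fix p assume p: "p \<in> points a (Suc b)"
      show "p \<in> ?f ` points (Suc a) b"
      proof (cases "p = Bot (Suc b)")
        case True
        then show ?thesis by (intro image_eqI[of _ _ "Top (Suc a)"]) auto
      next
        case False
        then show ?thesis using p by (intro image_eqI[of _ _ p]; cases p) auto
      qed
    next
      fix p assume "p \<in> ?f ` points (Suc a) b"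
      then obtain q where q: "q \<in> points (Suc a) b" "p = ?f q" by blast
      then show "p \<in> points a (Suc b)" by (cases q) auto
    qed
    show "noncrossing ((`) ?f ` D)"
    proof (rule noncrossingI)
      fix p q r s
      assume pr: "{p, r} \<in> (`) ?f ` D" and qs: "{q, s} \<in> (`) ?f ` D"
        and less: "bpos p < bpos q" "bpos q < bpos r" "bpos r < bpos s"
      obtain p' r' where pr': "{p', r'} \<in> D" "p = ?f p'" "r = ?f r'"
        using pr by (rule image_doubleton[OF D])
      obtain q' s' where qs': "{q', s'} \<in> D" "q = ?f q'" "s = ?f s'"
        using qs by (rule image_doubleton[OF D])
      have pts: "p' \<in> points (Suc a) b" "r' \<in> points (Suc a) b" "q' \<in> points (Suc a) b" "s' \<in> points (Suc a) b"
        using pr'(1) qs'(1) diagrams_Union[OF D] by blast+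
      have le: "bpos p' \<le> int b" "bpos q' \<le> int b" "bpos r' \<le> int b" "bpos s' \<le> int b"
        using diagrams_bpos[OF D pr'(1)] diagrams_bpos[OF D qs'(1)] by auto
      have eq: "p = p'" "q = q'" "r = r'"
        and gt: "bpos p > - int (Suc a)" "bpos q > - int (Suc a)" "bpos r > - int (Suc a)"
        using cases[OF pts(1)] cases[OF pts(2)] cases[OF pts(3)] cases[OF pts(4)] less le
        unfolding pr' qs' by auto
      show False
      \<comment> \<open>Only \<open>s\<close>, the last of the four, can be the moved point, and
        before the move it was the first of them.\<close>
      proof (cases "s' = Top (Suc a)")
        case True
        then have "{s', q'} \<in> D" "bpos s' < bpos p" using qs'(1) gt(1) by (simp_all add: insert_commute)
        then show False using noncrossingD[OF D _ pr'(1), of s' q'] less eq by simp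
      next
        case False
        then have "s = s'" using cases[OF pts(4)] qs' by auto
        then show False using noncrossingD[OF D pr'(1) qs'(1)] less eq by simp
      qed
    qed
  qed
qed

lemma flip_flip [simp]: "flip (flip p) = p"
  by (cases p) auto

lemma bpos_flip [simp]: "bpos (flip p) = - bpos p"
  by (cases p) auto

lemma flip_diagrams:
  assumes D: "D \<in> diagrams a b"
  shows "(`) flip ` D \<in> diagrams b a"
proof (rule image_diagrams[OF D])
  show "inj_on flip (points a b)" by (rule inj_on_inverseI[of _ flip]) simp
  show "flip ` points a b = points b a" by (auto simp: points_def image_Un image_image)
  show "noncrossing ((`) flip ` D)"
  proof (rule noncrossingI)
    fix p q r s
    assume pr: "{p, r} \<in> (`) flip ` D" and qs: "{q, s} \<in> (`) flip ` D"
      and less: "bpos p < bpos q" "bpos q < bpos r" "bpos r < bpos s"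
    obtain p' r' where pr': "{p', r'} \<in> D" "p = flip p'" "r = flip r'"
      using pr by (rule image_doubleton[OF D])
    obtain q' s' where qs': "{q', s'} \<in> D" "q = flip q'" "s = flip s'"
      using qs by (rule image_doubleton[OF D])
    show False
      using noncrossingD[OF D, of s' q' r' p'] pr' qs' less by (simp add: insert_commute)
  qed
qed

lemma id_diagram_Suc: "id_diagram (Suc n) = insert {Top (Suc n), Bot (Suc n)} (id_diagram n)"
  by (auto simp: id_diagram_def atLeastAtMostSuc_conv)

lemma id_diagram_diagrams: "id_diagram n \<in> diagrams n n"
proof (induction n)
  case 0
  show ?case by (simp add: id_diagram_def diagrams_def points_def noncrossing_def partition_on_empty)
next
  case (Suc n)
  show ?case unfolding id_diagram_Suc by (rule insert_line_diagrams[OF Suc])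
qed

lemma u_diagram_diagrams:
  assumes i: "1 \<le> i" "i < n"
  shows "u_diagram n i \<in> diagrams n n"
proof -
  have "partition_on (points n n) (u_diagram n i)"
  proof (rule partition_onI)
    show "\<Union>(u_diagram n i) = points n n"
      using i by (force simp: u_diagram_def points_def)
    show "disjnt S S'" if "S \<in> u_diagram n i" "S' \<in> u_diagram n i" "S \<noteq> S'" for S S'
      using that by (auto simp: u_diagram_def disjnt_def)
    show "{} \<notin> u_diagram n i" by (auto simp: u_diagram_def)
  qed
  moreover have "\<forall>S\<in>u_diagram n i. card S = 2" by (auto simp: u_diagram_def)
  moreover have arc: "p = Top (i + 1) \<and> r = Top i \<or> p = Bot i \<and> r = Bot (i + 1) \<or> (\<exists>j. j \<noteq> i \<and> j \<noteq> i + 1 \<and> p = Top j \<and> r = Bot j)"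
    if "{p, r} \<in> u_diagram n i" "bpos p < bpos r" for p r
    using that by (auto simp: u_diagram_def doubleton_eq_iff)
  have "noncrossing (u_diagram n i)"
  proof (rule noncrossingI)
    fix p q r s
    assume "{p, r} \<in> u_diagram n i" "{q, s} \<in> u_diagram n i"
      and less: "bpos p < bpos q" "bpos q < bpos r" "bpos r < bpos s"
    then show False using arc[of p r] arc[of q s] by auto
  qed
  ultimately show ?thesis by (simp add: diagrams_def)
qed

section \<open>Matrices of added lines, bent strands, reflections and the generators\<close>

lemma sg_insert: "finite X \<Longrightarrow> i \<notin> X \<Longrightarrow> sg (insert i X) = (- 1) ^ i * sg X"
  by (simp add: sg_def power_add)

lemma sg_remove: "finite X \<Longrightarrow> sg X = (if i \<in> X then (- 1) ^ i else 1) * sg (X - {i})"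
  using sg_insert[of "X - {i}" i] by (auto simp: insert_absorb)

lemma compatible_cong:
  assumes D: "D \<in> diagrams a b" and l: "\<And>p. p \<in> points a b \<Longrightarrow> label X Y p = label X' Y' p"
  shows "compatible D X Y = compatible D X' Y'"
proof -
  have l': "label X Y p = label X' Y' p" if "S \<in> D" "p \<in> S" for S p
    using that diagrams_Union[OF D] l by blast
  show ?thesis unfolding compatible_def by (intro ball_cong refl) (simp add: l')
qed

lemma compatible_insert:
  "compatible (insert {p, q} D) X Y \<longleftrightarrow> label X Y p = label X Y q \<and> compatible D X Y"
  unfolding compatible_def by (simp del: label.simps) blast

lemma compatible_lines:
  "compatible ((\<lambda>j. {f j, g j}) ` J) X Y \<longleftrightarrow> (\<forall>j\<in>J. label X Y (f j) = label X Y (g j))"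
  unfolding compatible_def by (simp del: label.simps) blast

lemma compatible_image:
  assumes D: "D \<in> diagrams a b" and l: "\<And>p. p \<in> points a b \<Longrightarrow> label X Y (f p) = label X' Y' p"
  shows "compatible ((`) f ` D) X Y = compatible D X' Y'"
proof -
  have l': "label X Y (f p) = label X' Y' p" if "S \<in> D" "p \<in> S" for S p
    using that diagrams_Union[OF D] l by blast
  have "compatible ((`) f ` D) X Y = (\<forall>S\<in>D. \<forall>p\<in>S. \<forall>q\<in>S. label X Y (f p) = label X Y (f q))"
    by (simp add: compatible_def)
  also have "\<dots> = compatible D X' Y'"
    unfolding compatible_def by (intro ball_cong refl) (simp add: l')
  finally show ?thesis .
qed

text \<open>As \<open>a + b\<close> is even, the ends of the new line have positions of equal
  parity. They are twisted alike in \<open>label\<close>, and the signs of two marks cancel.\<close>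

lemma mat_diagram_insert_line:
  assumes D: "D \<in> diagrams a b" and XY: "finite X" "finite Y"
  shows "mat_diagram (insert {Top (Suc a), Bot (Suc b)} D) X Y =
    (if Suc a \<in> X \<longleftrightarrow> Suc b \<in> Y then mat_diagram D (X - {Suc a}) (Y - {Suc b}) else 0)"
proof -
  have ev: "even (Suc a) = even (Suc b)" using diagrams_even[OF D] by auto
  have "compatible D X Y = compatible D (X - {Suc a}) (Y - {Suc b})"
  proof (rule compatible_cong[OF D])
    fix p assume "p \<in> points a b"
    then show "label X Y p = label (X - {Suc a}) (Y - {Suc b}) p" by (cases p) auto
  qed
  moreover have "compatible (insert {Top (Suc a), Bot (Suc b)} D) X Y \<longleftrightarrow>
      (Suc a \<in> X \<longleftrightarrow> Suc b \<in> Y) \<and> compatible D X Y"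
    using ev by (auto simp: compatible_insert)
  moreover have "sg X * sg Y = sg (X - {Suc a}) * sg (Y - {Suc b})" if iff: "Suc a \<in> X \<longleftrightarrow> Suc b \<in> Y"
  proof (cases "Suc a \<in> X")
    case True
    have e: "(- 1 :: rat) ^ Suc a = (- 1) ^ Suc b" using ev by (auto simp: minus_one_power_iff)
    have "sg X = (- 1) ^ Suc b * sg (X - {Suc a})" "sg Y = (- 1) ^ Suc b * sg (Y - {Suc b})"
      using sg_remove[OF XY(1), of "Suc a"] sg_remove[OF XY(2), of "Suc b"] True iff e by simp_all
    then have "sg X * sg Y = ((- 1) ^ Suc b * (- 1) ^ Suc b) * (sg (X - {Suc a}) * sg (Y - {Suc b}))"
      by (simp only: mult_ac)
    also have "(- 1 :: rat) ^ Suc b * (- 1) ^ Suc b = 1" by (simp add: minus_one_power_iff)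
    finally show ?thesis by simp
  qed (use iff in simp)
  ultimately show ?thesis by (simp add: mat_diagram_def)
qed

text \<open>Here \<open>Suc a + b\<close> is even, so bending changes the parity of the position.
  The mark of the bent point is therefore complemented, and a mark at \<open>Suc b\<close> has the
  sign \<open>(- 1) ^ a\<close>.\<close>

lemma mat_diagram_bend_point:
  assumes D: "D \<in> diagrams (Suc a) b" and X: "X \<subseteq> {1..a}" and Y: "finite Y"
  shows "mat_diagram ((`) (bend_point (Suc a) b 1) ` D) X Y =
    (if Suc b \<in> Y then (- 1) ^ a * mat_diagram D X (Y - {Suc b})
     else (- 1) ^ Suc a * mat_diagram D (insert (Suc a) X) Y)"
proof -
  have ev: "even a \<noteq> even b" using diagrams_even[OF D] by auto
  have fin: "finite X" "Suc a \<notin> X" using X finite_subset by auto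
  show ?thesis
  proof (cases "Suc b \<in> Y")
    case True
    have "compatible ((`) (bend_point (Suc a) b 1) ` D) X Y = compatible D X (Y - {Suc b})"
    proof (rule compatible_image[OF D])
      fix p assume "p \<in> points (Suc a) b"
      then show "label X Y (bend_point (Suc a) b 1 p) = label X (Y - {Suc b}) p"
        using True ev fin by (cases p) (auto simp: le_Suc_eq)
    qed
    then show ?thesis
      using True ev sg_remove[OF Y, of "Suc b"]
      by (auto simp: mat_diagram_def minus_one_power_iff)
  next
    case False
    have "compatible ((`) (bend_point (Suc a) b 1) ` D) X Y = compatible D (insert (Suc a) X) Y"
    proof (rule compatible_image[OF D])
      fix p assume "p \<in> points (Suc a) b"
      then show "label X Y (bend_point (Suc a) b 1 p) = label (insert (Suc a) X) Y p"
        using False ev fin by (cases p) (auto simp: le_Suc_eq)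
    qed
    then show ?thesis
      using False sg_insert[OF fin] by (auto simp: mat_diagram_def minus_one_power_iff)
  qed
qed

lemma mat_diagram_flip:
  assumes D: "D \<in> diagrams a b"
  shows "mat_diagram ((`) flip ` D) X Y = mat_diagram D Y X"
proof -
  have "compatible ((`) flip ` D) X Y = compatible D Y X"
  proof (rule compatible_image[OF D])
    show "label X Y (flip p) = label Y X p" for p by (cases p) auto
  qed
  then show ?thesis by (simp add: mat_diagram_def mult.commute)
qed

lemma mat_diagram_id:
  assumes "X \<subseteq> {1..n}" "Y \<subseteq> {1..n}"
  shows "mat_diagram (id_diagram n) X Y = of_bool (X = Y)"
proof -
  have "compatible (id_diagram n) X Y \<longleftrightarrow> (\<forall>i\<in>{1..n}. i \<in> X \<longleftrightarrow> i \<in> Y)"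
    by (auto simp: compatible_def id_diagram_def)
  also have "\<dots> \<longleftrightarrow> X = Y" using assms by blast
  finally show ?thesis by (simp add: mat_diagram_def)
qed

text \<open>Compatibility asks that \<open>X\<close> and \<open>Y\<close> agree away from
  \<open>i\<close> and \<open>i + 1\<close> and that each contain exactly one of these two. Such an
  \<open>X\<close> is \<open>Y\<close> or its swap, and moving a mark by one position changes the
  sign.\<close>

lemma mat_diagram_u:
  assumes i: "1 \<le> i" "i < n" and XY: "X \<subseteq> {1..n}" "Y \<subseteq> {1..n}"
  shows "mat_diagram (u_diagram n i) X Y =
    of_bool (X = Y) - of_bool (X = Transposition.transpose i (i + 1) ` Y)"
proof -
  define W where "W = Transposition.transpose i (i + 1) ` Y"
  have W: "i \<in> W \<longleftrightarrow> i + 1 \<in> Y" "i + 1 \<in> W \<longleftrightarrow> i \<in> Y" "j \<noteq> i \<Longrightarrow> j \<noteq> i + 1 \<Longrightarrow> j \<in> W \<longleftrightarrow> j \<in> Y" for j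
    by (simp_all add: W_def in_transpose_image_iff)
  have fin: "finite X" "finite Y" using XY finite_subset by auto
  have finW: "finite W" using fin by (simp add: W_def)
  have "u_diagram n i = insert {Top i, Top (i + 1)} (insert {Bot i, Bot (i + 1)} ((\<lambda>j. {Top j, Bot j}) ` ({1..n} - {i, i + 1})))"
    by (auto simp: u_diagram_def)
  then have "compatible (u_diagram n i) X Y \<longleftrightarrow> (i \<in> X \<longleftrightarrow> i + 1 \<notin> X) \<and> (i \<in> Y \<longleftrightarrow> i + 1 \<notin> Y) \<and>
      (\<forall>j\<in>{1..n} - {i, i + 1}. (j \<in> X \<longleftrightarrow> j \<in> Y))"
    by (auto simp: compatible_insert compatible_lines)
  also have "(\<forall>j\<in>{1..n} - {i, i + 1}. (j \<in> X \<longleftrightarrow> j \<in> Y)) \<longleftrightarrow>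
      (\<forall>j. j \<noteq> i \<longrightarrow> j \<noteq> i + 1 \<longrightarrow> (j \<in> X \<longleftrightarrow> j \<in> Y))"
    using XY by blast
  finally have comp: "compatible (u_diagram n i) X Y \<longleftrightarrow> (i \<in> X \<longleftrightarrow> i + 1 \<notin> X) \<and> (i \<in> Y \<longleftrightarrow> i + 1 \<notin> Y) \<and>
      (\<forall>j. j \<noteq> i \<longrightarrow> j \<noteq> i + 1 \<longrightarrow> (j \<in> X \<longleftrightarrow> j \<in> Y))" .
  show ?thesis
    unfolding W_def[symmetric]
  proof (cases "i \<in> Y \<longleftrightarrow> i + 1 \<notin> Y")
    case False
    then have "j \<in> W \<longleftrightarrow> j \<in> Y" for j using W by metis
    then have "W = Y" by blast
    then show "mat_diagram (u_diagram n i) X Y = of_bool (X = Y) - of_bool (X = W)"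
      using False comp by (simp add: mat_diagram_def)
  next
    case True
    have ne: "Y \<noteq> W" using W True by metis
    have sgs: "sg W = - sg Y"
    proof -
      have rest: "W - {i} - {i + 1} = Y - {i} - {i + 1}" using W(3) by blast
      have "sg W = (if i \<in> W then (- 1) ^ i else 1) * ((if i + 1 \<in> W then (- 1) ^ (i + 1) else 1) * sg (Y - {i} - {i + 1}))"
        using sg_remove[OF finW, of i] sg_remove[of "W - {i}" "i + 1"] finW rest by simp
      moreover have "sg Y = (if i \<in> Y then (- 1) ^ i else 1) * ((if i + 1 \<in> Y then (- 1) ^ (i + 1) else 1) * sg (Y - {i} - {i + 1}))"
        using sg_remove[OF fin(2), of i] sg_remove[of "Y - {i}" "i + 1"] fin by simp
      ultimately show ?thesis using True W(1,2) by auto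
    qed
    have "compatible (u_diagram n i) X Y \<longleftrightarrow> X = Y \<or> X = W"
    proof
      assume C: "compatible (u_diagram n i) X Y"
      show "X = Y \<or> X = W"
      proof (cases "i \<in> X \<longleftrightarrow> i \<in> Y")
        case True
        then have "j \<in> X \<longleftrightarrow> j \<in> Y" for j using C comp by metis
        then show ?thesis by blast
      next
        case False
        then have "j \<in> X \<longleftrightarrow> j \<in> W" for j using C comp W by metis
        then show ?thesis by blast
      qed
    next
      assume "X = Y \<or> X = W"
      then show "compatible (u_diagram n i) X Y" unfolding comp using True W by metis
    qed
    then show "mat_diagram (u_diagram n i) X Y = of_bool (X = Y) - of_bool (X = W)"
      using ne sgs by (auto simp: mat_diagram_def)
  qed
qed

section \<open>The Temperley-Lieb category in matrices\<close>

lemma mat_one: "X \<subseteq> {1..n} \<Longrightarrow> Y \<subseteq> {1..n} \<Longrightarrow> mat (tl_one n) X Y = of_bool (X = Y)"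
  by (simp add: tl_one_def mat_single mat_diagram_id)

lemma Hom_one: "tl_one n \<in> Hom n n"
  unfolding tl_one_def by (rule Hom_single[OF id_diagram_diagrams])

lemma Hom_u: "1 \<le> i \<Longrightarrow> i < n \<Longrightarrow> tl_u n i \<in> Hom n n"
  unfolding tl_u_def by (rule Hom_single[OF u_diagram_diagrams])

lemma mat_u:
  "1 \<le> i \<Longrightarrow> i < n \<Longrightarrow> X \<subseteq> {1..n} \<Longrightarrow> Y \<subseteq> {1..n} \<Longrightarrow>
    mat (tl_u n i) X Y = of_bool (X = Y) - of_bool (X = Transposition.transpose i (i + 1) ` Y)"
  by (simp add: tl_u_def mat_single mat_diagram_u)

lemma Hom_star: "x \<in> Hom a b \<Longrightarrow> tl_star x \<in> Hom b a"
  unfolding tl_star_def by (rule Hom_lin_map[OF _ flip_diagrams])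

lemma mat_star: "x \<in> Hom a b \<Longrightarrow> mat (tl_star x) X Y = mat x Y X"
  unfolding tl_star_def mat_lin_map unfolding mat_def
  by (intro sum.cong refl) (auto simp: Hom_def mat_diagram_flip subset_iff)

lemma lines_Suc:
  "D \<union> (\<lambda>j. {Top (a + j), Bot (b + j)}) ` {1..Suc d} =
    insert {Top (Suc (a + d)), Bot (Suc (b + d))} (D \<union> (\<lambda>j. {Top (a + j), Bot (b + j)}) ` {1..d})"
  by (auto simp: atLeastAtMostSuc_conv)

lemma lines_diagrams:
  "D \<in> diagrams a b \<Longrightarrow> D \<union> (\<lambda>j. {Top (a + j), Bot (b + j)}) ` {1..d} \<in> diagrams (a + d) (b + d)"
proof (induction d)
  case (Suc d)
  then show ?case unfolding lines_Suc using insert_line_diagrams[of _ "a + d" "b + d"] by simp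
qed simp

lemma Hom_add_lines: "x \<in> Hom a b \<Longrightarrow> add_lines a b d x \<in> Hom (a + d) (b + d)"
  unfolding add_lines_def by (rule Hom_lin_map[OF _ lines_diagrams])

lemma mat_add_lines_0: "mat (add_lines a b 0 x) X Y = mat x X Y"
  unfolding add_lines_def mat_lin_map unfolding mat_def by simp

lemma mat_add_lines_Suc:
  assumes x: "x \<in> Hom a b" and XY: "finite X" "finite Y"
  shows "mat (add_lines a b (Suc d) x) X Y =
    (if Suc (a + d) \<in> X \<longleftrightarrow> Suc (b + d) \<in> Y
     then mat (add_lines a b d x) (X - {Suc (a + d)}) (Y - {Suc (b + d)}) else 0)"
proof -
  have "mat_diagram (D \<union> (\<lambda>j. {Top (a + j), Bot (b + j)}) ` {1..Suc d}) X Y =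
      (if Suc (a + d) \<in> X \<longleftrightarrow> Suc (b + d) \<in> Y
       then mat_diagram (D \<union> (\<lambda>j. {Top (a + j), Bot (b + j)}) ` {1..d}) (X - {Suc (a + d)}) (Y - {Suc (b + d)}) else 0)"
    if "D \<in> Poly_Mapping.keys x" for D
  proof -
    have "D \<in> diagrams a b" using that x by (auto simp: Hom_def)
    then show ?thesis unfolding lines_Suc by (intro mat_diagram_insert_line lines_diagrams XY)
  qed
  then show ?thesis by (auto simp: add_lines_def mat_lin_map simp del: image_Un)
qed

text \<open>Strands are bent one at a time, starting with the rightmost, so that everything reduces
  to a single bent strand.\<close>

lemma bend_point_Suc:
  assumes "p \<in> points a b" "Suc m \<le> a"
  shows "bend_point a b (Suc m) p = bend_point (a - m) (b + m) 1 (bend_point a b m p)"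
  using assms by (cases p) auto

lemma bend_diagram_Suc:
  assumes D: "D \<in> diagrams a b" and m: "Suc m \<le> a"
  shows "(`) (bend_point a b (Suc m)) ` D = (`) (bend_point (a - m) (b + m) 1) ` ((`) (bend_point a b m) ` D)"
proof -
  have "bend_point a b (Suc m) ` S = bend_point (a - m) (b + m) 1 ` bend_point a b m ` S" if "S \<in> D" for S
  proof -
    have "S \<subseteq> points a b" using that diagrams_Union[OF D] by blast
    then show ?thesis unfolding image_image using m by (intro image_cong refl bend_point_Suc) auto
  qed
  then show ?thesis by (simp add: image_image)
qed

lemma bend_diagram_0:
  assumes D: "D \<in> diagrams a b"
  shows "(`) (bend_point a b 0) ` D = D"
proof -
  have "bend_point a b 0 ` S = S" if "S \<in> D" for S
  proof -
    have "S \<subseteq> points a b" using that diagrams_Union[OF D] by blast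
    moreover have "bend_point a b 0 p = p" if "p \<in> points a b" for p
      using that by (cases p) auto
    ultimately show ?thesis by (simp add: subset_iff)
  qed
  then show ?thesis by simp
qed

lemma bend_diagrams:
  assumes "D \<in> diagrams a b" "m \<le> a"
  shows "(`) (bend_point a b m) ` D \<in> diagrams (a - m) (b + m)"
  using assms(2)
proof (induction m)
  case 0
  then show ?case using assms bend_diagram_0 by simp
next
  case (Suc m)
  then have "(`) (bend_point a b m) ` D \<in> diagrams (Suc (a - Suc m)) (b + m)" by (simp add: Suc_diff_Suc)
  then have "(`) (bend_point (Suc (a - Suc m)) (b + m) 1) ` ((`) (bend_point a b m) ` D) \<in> diagrams (a - Suc m) (Suc (b + m))"
    by (rule bend_point_diagrams)
  moreover have "Suc (a - Suc m) = a - m" using Suc.prems by simp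
  ultimately show ?case unfolding bend_diagram_Suc[OF assms(1) Suc.prems] by simp
qed

lemma Hom_bend: "x \<in> Hom a b \<Longrightarrow> m \<le> a \<Longrightarrow> bend a b m x \<in> Hom (a - m) (b + m)"
  unfolding bend_def by (rule Hom_lin_map[OF _ bend_diagrams])

lemma mat_bend_0: "x \<in> Hom a b \<Longrightarrow> mat (bend a b 0 x) X Y = mat x X Y"
  unfolding bend_def mat_lin_map unfolding mat_def
  by (intro sum.cong refl) (auto simp: Hom_def bend_diagram_0 subset_iff)

lemma mat_bend_Suc:
  assumes x: "x \<in> Hom a b" and m: "Suc m \<le> a" and X: "X \<subseteq> {1..a - Suc m}" and Y: "finite Y"
  shows "mat (bend a b (Suc m) x) X Y =
    (if Suc (b + m) \<in> Y then (- 1) ^ (a - Suc m) * mat (bend a b m x) X (Y - {Suc (b + m)})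
     else (- 1) ^ (a - m) * mat (bend a b m x) (insert (a - m) X) Y)"
proof -
  have am: "Suc (a - Suc m) = a - m" using m by simp
  have "mat_diagram ((`) (bend_point a b (Suc m)) ` D) X Y =
    (if Suc (b + m) \<in> Y then (- 1) ^ (a - Suc m) * mat_diagram ((`) (bend_point a b m) ` D) X (Y - {Suc (b + m)})
     else (- 1) ^ (a - m) * mat_diagram ((`) (bend_point a b m) ` D) (insert (a - m) X) Y)"
    if "D \<in> Poly_Mapping.keys x" for D
  proof -
    have D: "D \<in> diagrams a b" using that x by (auto simp: Hom_def)
    then have "(`) (bend_point a b m) ` D \<in> diagrams (Suc (a - Suc m)) (b + m)"
      using bend_diagrams[OF D, of m] m am by simp
    from mat_diagram_bend_point[OF this X Y] show ?thesis
      unfolding am bend_diagram_Suc[OF D m] .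
  qed
  then show ?thesis unfolding bend_def mat_lin_map
    by (auto simp: sum_distrib_left mult_ac intro!: sum.cong)
qed

lemma scale_add_left: "scale (c + d) x = scale c x + scale d x"
  by (rule poly_mapping_eqI) (simp add: lookup_scale lookup_add distrib_right)

lemma scale_add_right: "scale c (x + y) = scale c x + scale c y"
  by (rule poly_mapping_eqI) (simp add: lookup_scale lookup_add distrib_left)

lemma scale_scale: "scale c (scale d x) = scale (c * d) x"
  by (rule poly_mapping_eqI) (simp add: lookup_scale)

lemma scale_0 [simp]: "scale 0 x = 0"
  by (rule poly_mapping_eqI) (simp add: lookup_scale)

lemma scale_1 [simp]: "scale 1 x = x"
  by (rule poly_mapping_eqI) (simp add: lookup_scale)

lemma scale_zero_right [simp]: "scale c 0 = 0"
  by (rule poly_mapping_eqI) (simp add: lookup_scale)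

lemma scale_sum_right: "scale c (\<Sum>i\<in>I. x i) = (\<Sum>i\<in>I. scale c (x i))"
  by (induction I rule: infinite_finite_induct) (auto simp: scale_add_right)

section \<open>The homomorphism from the group algebra\<close>

text \<open>A transposition of \<open>i\<close> and \<open>j + 1\<close> is the conjugate of that of
  \<open>i\<close> and \<open>j\<close> by an adjacent one, and transpositions generate all
  permutations.\<close>

lemma adjacent_permutes_induct [consumes 1, case_names id adjacent comp]:
  assumes p: "p permutes {1..n::nat}"
    and id: "P id"
    and adj: "\<And>i. 1 \<le> i \<Longrightarrow> i < n \<Longrightarrow> P (Transposition.transpose i (i + 1))"
    and comp: "\<And>p q. p permutes {1..n} \<Longrightarrow> q permutes {1..n} \<Longrightarrow> P p \<Longrightarrow> P q \<Longrightarrow> P (p \<circ> q)"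
  shows "P p"
proof -
  have tr: "P (Transposition.transpose i (i + Suc k))" if "1 \<le> i" "i + Suc k \<le> n" for i k
    using that
  proof (induction k)
    case 0
    then show ?case using adj[of i] by simp
  next
    case (Suc k)
    let ?j = "i + Suc k"
    have eq: "Transposition.transpose i (i + Suc (Suc k)) =
        Transposition.transpose ?j (?j + 1) \<circ> (Transposition.transpose i ?j \<circ> Transposition.transpose ?j (?j + 1))"
      by (auto simp: fun_eq_iff transpose_def)
    have perm: "Transposition.transpose ?j (?j + 1) permutes {1..n}" "Transposition.transpose i ?j permutes {1..n}"
      using Suc.prems by (auto intro: permutes_swap_id)
    have "P (Transposition.transpose i ?j)" "P (Transposition.transpose ?j (?j + 1))"
      using Suc.IH Suc.prems adj[of ?j] by simp_all
    then show ?case unfolding eq using perm by (intro comp permutes_compose) auto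
  qed
  have tr': "P (Transposition.transpose i j)" if "i \<in> {1..n}" "j \<in> {1..n}" "i \<noteq> j" for i j
  proof (cases "i < j")
    case True
    then show ?thesis using tr[of i "j - i - 1"] that by simp
  next
    case False
    then show ?thesis using tr[of j "i - j - 1"] that by (simp add: transpose_commute)
  qed
  show ?thesis
    using p finite_atLeastAtMost
  proof (induction p rule: permutes_induct)
    case id
    show ?case by (rule assms(2))
  next
    case (swap i j p)
    then show ?case by (intro comp tr' permutes_swap_id) auto
  qed
qed

lemma permutes_image_subset: "p permutes S \<Longrightarrow> X \<subseteq> S \<Longrightarrow> p ` X \<subseteq> S"
  using permutes_image by blast

lemma sum_Pow_delta:
  fixes f :: "nat set \<Rightarrow> rat"
  assumes "A \<subseteq> {1..n::nat}"
  shows "(\<Sum>Y\<in>Pow {1..n}. f Y * of_bool (Y = A)) = f A" "(\<Sum>Y\<in>Pow {1..n}. of_bool (Y = A) * f Y) = f A"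
proof -
  have "(\<Sum>Y\<in>Pow {1..n}. f Y * of_bool (Y = A)) = (\<Sum>Y\<in>Pow {1..n}. if Y = A then f A else 0)"
    by (intro sum.cong) auto
  also have "\<dots> = f A" using assms by simp
  finally show "(\<Sum>Y\<in>Pow {1..n}. f Y * of_bool (Y = A)) = f A" .
  then show "(\<Sum>Y\<in>Pow {1..n}. of_bool (Y = A) * f Y) = f A" by (simp add: mult.commute)
qed

text \<open>For adjacent transpositions the element is \<open>tl_u n i - tl_one n\<close>.
  Composition multiplies the signed permutation matrices, which yields all other
  permutations.\<close>

lemma perm_tl_exists:
  assumes "p permutes {1..n}"
  shows "\<exists>x\<in>Hom n n. \<forall>X Y. X \<subseteq> {1..n} \<longrightarrow> Y \<subseteq> {1..n} \<longrightarrow> mat x X Y = of_int (sign p) * of_bool (X = p ` Y)"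
  using assms
proof (induction rule: adjacent_permutes_induct)
  case id
  show ?case by (rule bexI[OF _ Hom_one]) (simp add: mat_one)
next
  case (adjacent i)
  show ?case
  proof (intro bexI[OF _ Hom_diff[OF Hom_u Hom_one]] allI impI)
    fix X Y assume "X \<subseteq> {1..n}" "Y \<subseteq> {1..n}"
    then show "mat (tl_u n i - tl_one n) X Y =
        of_int (sign (Transposition.transpose i (i + 1))) * of_bool (X = Transposition.transpose i (i + 1) ` Y)"
      using adjacent by (simp add: mat_diff mat_u mat_one sign_swap_id)
  qed (use adjacent in auto)
next
  case (comp p q)
  then obtain x y where xy: "x \<in> Hom n n" "y \<in> Hom n n"
    and mx: "\<And>X Y. X \<subseteq> {1..n} \<Longrightarrow> Y \<subseteq> {1..n} \<Longrightarrow> mat x X Y = of_int (sign p) * of_bool (X = p ` Y)"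
    and my: "\<And>X Y. X \<subseteq> {1..n} \<Longrightarrow> Y \<subseteq> {1..n} \<Longrightarrow> mat y X Y = of_int (sign q) * of_bool (X = q ` Y)"
    by blast
  have sgn: "sign (p \<circ> q) = sign p * sign q"
    using comp by (intro sign_compose) (auto simp: permutation_permutes)
  show ?case
  proof (intro bexI[OF _ Hom_comp[OF xy]] allI impI)
    fix X Z assume XZ: "X \<subseteq> {1..n}" "Z \<subseteq> {1..n}"
    have "mat (x \<odot> y) X Z = (\<Sum>Y\<in>Pow {1..n}. (of_int (sign p * sign q) * of_bool (X = p ` Y)) * of_bool (Y = q ` Z))"
      unfolding mat_comp[OF xy] using XZ by (intro sum.cong) (auto simp: mx my)
    also have "\<dots> = of_int (sign p * sign q) * of_bool (X = p ` q ` Z)"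
      by (rule sum_Pow_delta) (rule permutes_image_subset[OF comp(2) XZ(2)])
    finally show "mat (x \<odot> y) X Z = of_int (sign (p \<circ> q)) * of_bool (X = (p \<circ> q) ` Z)"
      by (simp add: sgn image_comp)
  qed
qed

text \<open>Specified by its matrix, which determines it by \<open>mat_inj\<close>, so no choice of
  a word in the generators enters.\<close>

definition perm_tl :: "nat \<Rightarrow> (nat \<Rightarrow> nat) \<Rightarrow> tl" where
  "perm_tl n p = (SOME x. x \<in> Hom n n \<and>
     (\<forall>X Y. X \<subseteq> {1..n} \<longrightarrow> Y \<subseteq> {1..n} \<longrightarrow> mat x X Y = of_int (sign p) * of_bool (X = p ` Y)))"

lemma perm_tl:
  assumes "p permutes {1..n}"
  shows "perm_tl n p \<in> Hom n n"
    and "X \<subseteq> {1..n} \<Longrightarrow> Y \<subseteq> {1..n} \<Longrightarrow> mat (perm_tl n p) X Y = of_int (sign p) * of_bool (X = p ` Y)"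
proof -
  have "\<exists>x. x \<in> Hom n n \<and> (\<forall>X Y. X \<subseteq> {1..n} \<longrightarrow> Y \<subseteq> {1..n} \<longrightarrow> mat x X Y = of_int (sign p) * of_bool (X = p ` Y))"
    using perm_tl_exists[OF assms] by blast
  then have *: "perm_tl n p \<in> Hom n n \<and> (\<forall>X Y. X \<subseteq> {1..n} \<longrightarrow> Y \<subseteq> {1..n} \<longrightarrow> mat (perm_tl n p) X Y = of_int (sign p) * of_bool (X = p ` Y))"
    unfolding perm_tl_def by (rule someI_ex)
  show "perm_tl n p \<in> Hom n n" using * by blast
  show "X \<subseteq> {1..n} \<Longrightarrow> Y \<subseteq> {1..n} \<Longrightarrow> mat (perm_tl n p) X Y = of_int (sign p) * of_bool (X = p ` Y)"
    using * by blast
qed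

definition perm_ext :: "nat \<Rightarrow> ((nat \<Rightarrow> nat) \<Rightarrow>\<^sub>0 rat) \<Rightarrow> tl" where
  "perm_ext n x = (\<Sum>p\<in>Poly_Mapping.keys x. scale (Poly_Mapping.lookup x p) (perm_tl n p))"

lemma perm_ext_superset:
  assumes "finite A" "Poly_Mapping.keys x \<subseteq> A"
  shows "perm_ext n x = (\<Sum>p\<in>A. scale (Poly_Mapping.lookup x p) (perm_tl n p))"
  unfolding perm_ext_def using assms by (intro sum.mono_neutral_left) (auto simp: in_keys_iff)

lemma perm_ext_add: "perm_ext n (x + y) = perm_ext n x + perm_ext n y"
  using Poly_Mapping.keys_add[of x y]
  by (simp add: perm_ext_superset[of "Poly_Mapping.keys x \<union> Poly_Mapping.keys y"] lookup_add
      scale_add_left sum.distrib)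

lemma perm_ext_0 [simp]: "perm_ext n 0 = 0"
  by (simp add: perm_ext_def)

lemma perm_ext_sum: "perm_ext n (\<Sum>i\<in>I. x i) = (\<Sum>i\<in>I. perm_ext n (x i))"
  by (induction I rule: infinite_finite_induct) (auto simp: perm_ext_add)

lemma perm_ext_scale: "perm_ext n (scale c x) = scale c (perm_ext n x)"
  by (subst perm_ext_superset[OF _ keys_scale])
    (simp_all add: lookup_scale scale_sum_right scale_scale perm_ext_def)

lemma perm_ext_single: "perm_ext n (Poly_Mapping.single p c) = scale c (perm_tl n p)"
  by (simp add: perm_ext_def)

lemma carrier_QS: "x \<in> carrier (QS n) \<longleftrightarrow> Poly_Mapping.keys x \<subseteq> {p. p permutes {1..n}}"
  by (simp add: QS_def)

lemma perm_ext_Hom: "x \<in> carrier (QS n) \<Longrightarrow> perm_ext n x \<in> Hom n n"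
  unfolding perm_ext_def carrier_QS by (intro Hom_sum Hom_scale perm_tl) auto

lemma perm_tl_comp:
  assumes p: "p permutes {1..n}" and q: "q permutes {1..n}"
  shows "perm_tl n (p \<circ> q) = perm_tl n p \<odot> perm_tl n q"
proof (rule mat_inj[where a=n and b=n])
  fix X Z assume XZ: "X \<subseteq> {1..n}" "Z \<subseteq> {1..n}"
  have "mat (perm_tl n p \<odot> perm_tl n q) X Z = (\<Sum>Y\<in>Pow {1..n}. (of_int (sign p * sign q) * of_bool (X = p ` Y)) * of_bool (Y = q ` Z))"
    unfolding mat_comp[OF perm_tl(1)[OF p] perm_tl(1)[OF q]] using XZ p q by (intro sum.cong) (auto simp: perm_tl)
  also have "\<dots> = of_int (sign p * sign q) * of_bool (X = p ` q ` Z)"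
    by (rule sum_Pow_delta) (rule permutes_image_subset[OF q XZ(2)])
  moreover have "sign (p \<circ> q) = sign p * sign q"
    using p q by (intro sign_compose) (auto simp: permutation_permutes)
  ultimately show "mat (perm_tl n (p \<circ> q)) X Z = mat (perm_tl n p \<odot> perm_tl n q) X Z"
    using XZ perm_tl(2)[OF permutes_compose[OF q p]] by (simp add: image_comp)
qed (fact perm_tl(1)[OF permutes_compose[OF q p]] Hom_comp[OF perm_tl(1)[OF p] perm_tl(1)[OF q]])+

lemma perm_tl_id: "perm_tl n id = tl_one n"
  using perm_tl[OF permutes_id] mat_one by (intro mat_inj[OF _ Hom_one]) simp_all

lemma perm_tl_adjacent:
  assumes "1 \<le> i" "i < n"
  shows "perm_tl n (Transposition.transpose i (i + 1)) = tl_u n i - tl_one n"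
proof -
  have "Transposition.transpose i (i + 1) permutes {1..n}" using assms by (intro permutes_swap_id) auto
  note perm = perm_tl[OF this]
  show ?thesis
  proof (rule mat_inj[OF perm(1) Hom_diff[OF Hom_u[OF assms] Hom_one]])
    fix X Y assume XY: "X \<subseteq> {1..n}" "Y \<subseteq> {1..n}"
    show "mat (perm_tl n (Transposition.transpose i (i + 1))) X Y = mat (tl_u n i - tl_one n) X Y"
      using perm(2)[OF XY] mat_u[OF assms XY] mat_one[OF XY] by (simp add: mat_diff sign_swap_id)
  qed
qed

lemma QS_simps:
  "mult (QS n) x y = (\<Sum>p\<in>Poly_Mapping.keys x. \<Sum>q\<in>Poly_Mapping.keys y.
     Poly_Mapping.single (p \<circ> q) (Poly_Mapping.lookup x p * Poly_Mapping.lookup y q))"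
  "one (QS n) = Poly_Mapping.single id 1" "zero (QS n) = 0" "add (QS n) x y = x + y"
  by (simp_all add: QS_def)

lemma TL_simps: "carrier (TL n) = Hom n n" "mult (TL n) = (\<odot>)" "one (TL n) = tl_one n" "zero (TL n) = 0" "add (TL n) = (+)"
  by (simp_all add: TL_def)

lemma QS_single: "p permutes {1..n} \<Longrightarrow> Poly_Mapping.single p c \<in> carrier (QS n)"
  by (simp add: carrier_QS)

lemma QS_add: "x \<in> carrier (QS n) \<Longrightarrow> y \<in> carrier (QS n) \<Longrightarrow> x + y \<in> carrier (QS n)"
  using Poly_Mapping.keys_add[of x y] unfolding carrier_QS by blast

lemma QS_0: "0 \<in> carrier (QS n)"
  by (simp add: carrier_QS)

lemma QS_sum: "(\<And>i. i \<in> I \<Longrightarrow> x i \<in> carrier (QS n)) \<Longrightarrow> (\<Sum>i\<in>I. x i) \<in> carrier (QS n)"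
  by (induction I rule: infinite_finite_induct) (auto simp: QS_0 QS_add)

lemma QS_scale: "x \<in> carrier (QS n) \<Longrightarrow> scale c x \<in> carrier (QS n)"
  using keys_scale[of c x] unfolding carrier_QS by blast

lemma QS_mult: "x \<in> carrier (QS n) \<Longrightarrow> y \<in> carrier (QS n) \<Longrightarrow> mult (QS n) x y \<in> carrier (QS n)"
  unfolding QS_simps by (intro QS_sum QS_single permutes_compose) (auto simp: carrier_QS)

lemma perm_ext_mult:
  assumes x: "x \<in> carrier (QS n)" and y: "y \<in> carrier (QS n)"
  shows "perm_ext n (mult (QS n) x y) = perm_ext n x \<odot> perm_ext n y"
proof (rule mat_inj[OF perm_ext_Hom[OF QS_mult[OF x y]] Hom_comp[OF perm_ext_Hom[OF x] perm_ext_Hom[OF y]]])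
  fix X Z assume XZ: "X \<subseteq> {1..n}" "Z \<subseteq> {1..n}"
  let ?l = Poly_Mapping.lookup and ?k = Poly_Mapping.keys
  have kx: "p permutes {1..n}" if "p \<in> ?k x" for p using that x by (auto simp: carrier_QS)
  have ky: "p permutes {1..n}" if "p \<in> ?k y" for p using that y by (auto simp: carrier_QS)
  have "mat (perm_ext n (mult (QS n) x y)) X Z =
      (\<Sum>p\<in>?k x. \<Sum>q\<in>?k y. ?l x p * ?l y q * mat (perm_tl n (p \<circ> q)) X Z)"
    by (simp add: QS_simps perm_ext_sum perm_ext_single mat_sum mat_scale)
  also have "\<dots> = (\<Sum>p\<in>?k x. \<Sum>q\<in>?k y. ?l x p * ?l y q *
      (\<Sum>Y\<in>Pow {1..n}. mat (perm_tl n p) X Y * mat (perm_tl n q) Y Z))"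
  proof (intro sum.cong refl)
    fix p q assume pq: "p \<in> ?k x" "q \<in> ?k y"
    show "?l x p * ?l y q * mat (perm_tl n (p \<circ> q)) X Z =
      ?l x p * ?l y q * (\<Sum>Y\<in>Pow {1..n}. mat (perm_tl n p) X Y * mat (perm_tl n q) Y Z)"
      unfolding perm_tl_comp[OF kx[OF pq(1)] ky[OF pq(2)]]
        mat_comp[OF perm_tl(1)[OF kx[OF pq(1)]] perm_tl(1)[OF ky[OF pq(2)]]] by (rule refl)
  qed
  also have "\<dots> = (\<Sum>p\<in>?k x. \<Sum>q\<in>?k y. \<Sum>Y\<in>Pow {1..n}.
      (?l x p * mat (perm_tl n p) X Y) * (?l y q * mat (perm_tl n q) Y Z))"
    by (simp add: sum_distrib_left mult_ac)
  also have "\<dots> = (\<Sum>p\<in>?k x. \<Sum>Y\<in>Pow {1..n}. \<Sum>q\<in>?k y.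
      (?l x p * mat (perm_tl n p) X Y) * (?l y q * mat (perm_tl n q) Y Z))"
    by (intro sum.cong refl sum.swap)
  also have "\<dots> = (\<Sum>Y\<in>Pow {1..n}. \<Sum>p\<in>?k x. \<Sum>q\<in>?k y.
      (?l x p * mat (perm_tl n p) X Y) * (?l y q * mat (perm_tl n q) Y Z))"
    by (rule sum.swap)
  also have "\<dots> = (\<Sum>Y\<in>Pow {1..n}. mat (perm_ext n x) X Y * mat (perm_ext n y) Y Z)"
    by (simp add: perm_ext_def mat_sum mat_scale sum_product)
  also have "\<dots> = mat (perm_ext n x \<odot> perm_ext n y) X Z"
    by (simp add: mat_comp[OF perm_ext_Hom[OF x] perm_ext_Hom[OF y]])
  finally show "mat (perm_ext n (mult (QS n) x y)) X Z = mat (perm_ext n x \<odot> perm_ext n y) X Z" .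
qed

lemma sum_scale_single: "(\<Sum>p\<in>Poly_Mapping.keys x. scale (Poly_Mapping.lookup x p) (Poly_Mapping.single p 1)) = x"
proof (rule poly_mapping_eqI)
  fix q
  have "Poly_Mapping.lookup (\<Sum>p\<in>Poly_Mapping.keys x. scale (Poly_Mapping.lookup x p) (Poly_Mapping.single p 1)) q =
      (\<Sum>p\<in>Poly_Mapping.keys x. if p = q then Poly_Mapping.lookup x q else 0)"
    unfolding lookup_sum by (intro sum.cong refl) (auto simp: lookup_scale lookup_single when_def)
  also have "\<dots> = Poly_Mapping.lookup x q" by (simp add: in_keys_iff)
  finally show "Poly_Mapping.lookup (\<Sum>p\<in>Poly_Mapping.keys x. scale (Poly_Mapping.lookup x p) (Poly_Mapping.single p 1)) q =
    Poly_Mapping.lookup x q" .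
qed

text \<open>The linear extension of \<open>perm_tl\<close> has all the required properties.
  Conversely, a map with these properties agrees with it on adjacent transpositions, hence on
  permutations by multiplicativity and on the carrier by linearity; outside the carrier its values
  are fixed by \<open>extensional\<close>.\<close>

lemma \<Phi>_eq: "\<Phi> n = restrict (perm_ext n) (carrier (QS n))"
  unfolding \<Phi>_def
proof (rule the_equality, intro conjI ballI allI impI)
  let ?\<phi> = "restrict (perm_ext n) (carrier (QS n))"
  show "?\<phi> \<in> extensional (carrier (QS n))" by simp
  show "?\<phi> \<in> ring_hom (QS n) (TL n)"
  proof (rule ring_hom_memI)
    show "?\<phi> x \<in> carrier (TL n)" if "x \<in> carrier (QS n)" for x
      using that by (simp add: TL_simps perm_ext_Hom)
    show "?\<phi> (x \<otimes>\<^bsub>QS n\<^esub> y) = ?\<phi> x \<otimes>\<^bsub>TL n\<^esub> ?\<phi> y" if "x \<in> carrier (QS n)" "y \<in> carrier (QS n)" for x y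
      using that by (simp add: TL_simps perm_ext_mult QS_mult)
    show "?\<phi> (x \<oplus>\<^bsub>QS n\<^esub> y) = ?\<phi> x \<oplus>\<^bsub>TL n\<^esub> ?\<phi> y" if "x \<in> carrier (QS n)" "y \<in> carrier (QS n)" for x y
      using that by (simp add: TL_simps QS_simps perm_ext_add QS_add)
    show "?\<phi> \<one>\<^bsub>QS n\<^esub> = \<one>\<^bsub>TL n\<^esub>"
      by (simp add: TL_simps QS_simps perm_ext_single perm_tl_id QS_single permutes_id del: id_apply)
  qed
  show "?\<phi> (scale c x) = scale c (?\<phi> x)" if "x \<in> carrier (QS n)" for c x
    using that by (simp add: perm_ext_scale QS_scale)
  show "?\<phi> (transp i (i + 1)) = tl_u n i - tl_one n" if i: "1 \<le> i \<and> i < n" for i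
  proof -
    have "Transposition.transpose i (i + 1) permutes {1..n}" using i by (intro permutes_swap_id) auto
    from QS_single[OF this, of 1] show ?thesis
      using i perm_tl_adjacent[of i n] by (simp add: transp_def perm_ext_single)
  qed
next
  fix \<phi>
  assume *: "\<phi> \<in> extensional (carrier (QS n)) \<and> \<phi> \<in> ring_hom (QS n) (TL n) \<and>
     (\<forall>c. \<forall>x\<in>carrier (QS n). \<phi> (scale c x) = scale c (\<phi> x)) \<and>
     (\<forall>i. 1 \<le> i \<and> i < n \<longrightarrow> \<phi> (transp i (i + 1)) = tl_u n i - tl_one n)"
  then have ext: "\<phi> \<in> extensional (carrier (QS n))" and hom: "\<phi> \<in> ring_hom (QS n) (TL n)"
    and sc: "\<And>c x. x \<in> carrier (QS n) \<Longrightarrow> \<phi> (scale c x) = scale c (\<phi> x)"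
    and adj: "\<And>i. 1 \<le> i \<Longrightarrow> i < n \<Longrightarrow> \<phi> (transp i (i + 1)) = tl_u n i - tl_one n" by blast+
  have single: "\<phi> (Poly_Mapping.single p 1) = perm_tl n p" if "p permutes {1..n}" for p
    using that
  proof (induction rule: adjacent_permutes_induct)
    case id
    show ?case using ring_hom_one[OF hom] unfolding QS_simps TL_simps perm_tl_id .
  next
    case (adjacent i)
    then show ?case using adj[of i] perm_tl_adjacent[of i n] by (simp add: transp_def)
  next
    case (comp p q)
    have "\<phi> (Poly_Mapping.single p 1 \<otimes>\<^bsub>QS n\<^esub> Poly_Mapping.single q 1) = perm_tl n p \<odot> perm_tl n q"
      using ring_hom_mult[OF hom QS_single[OF comp(1), of 1] QS_single[OF comp(2), of 1]] comp
      by (simp add: TL_simps)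
    then have "\<phi> (Poly_Mapping.single (p \<circ> q) 1) = perm_tl n p \<odot> perm_tl n q"
      by (simp add: QS_simps)
    then show ?case unfolding perm_tl_comp[OF comp(1,2)] .
  qed
  have zero: "\<phi> 0 = 0" using sc[OF QS_0, of 0] by simp
  have sum: "\<phi> (\<Sum>p\<in>A. scale (c p) (Poly_Mapping.single p 1)) = (\<Sum>p\<in>A. scale (c p) (perm_tl n p))"
    if "finite A" "A \<subseteq> {p. p permutes {1..n}}" for A c
    using that
  proof (induction A rule: finite_induct)
    case (insert p A)
    have p: "Poly_Mapping.single p 1 \<in> carrier (QS n)" using insert.prems QS_single[of p n 1] by simp
    have A: "(\<Sum>p\<in>A. scale (c p) (Poly_Mapping.single p 1)) \<in> carrier (QS n)"
      using insert.prems by (intro QS_sum QS_scale QS_single) auto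
    have "\<phi> (scale (c p) (Poly_Mapping.single p 1) + (\<Sum>p\<in>A. scale (c p) (Poly_Mapping.single p 1))) =
        scale (c p) (perm_tl n p) + (\<Sum>p\<in>A. scale (c p) (perm_tl n p))"
      using ring_hom_add[OF hom QS_scale[OF p] A, of "c p"] insert sc[OF p] single[of p]
      by (simp add: QS_simps TL_simps)
    then show ?case using insert.hyps by simp
  qed (simp add: zero)
  show "\<phi> = restrict (perm_ext n) (carrier (QS n))"
  proof (rule extensionalityI[OF ext])
    fix x assume x: "x \<in> carrier (QS n)"
    then show "\<phi> x = restrict (perm_ext n) (carrier (QS n)) x"
      using sum[of "Poly_Mapping.keys x" "Poly_Mapping.lookup x"]
      by (simp add: carrier_QS sum_scale_single perm_ext_def)
  qed simp
qed

section \<open>Jucys-Murphy elements as sums of swaps\<close>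

lemma \<Phi>_JM:
  assumes "1 \<le> i" "i \<le> n"
  shows "\<Phi> n (JM i) = (\<Sum>j\<in>{1..<i}. perm_tl n (Transposition.transpose j i))"
proof -
  have "transp j i \<in> carrier (QS n)" if "j \<in> {1..<i}" for j
    unfolding transp_def using that assms by (intro QS_single permutes_swap_id) auto
  then have "JM i \<in> carrier (QS n)" unfolding JM_def by (rule QS_sum)
  then show ?thesis by (simp add: \<Phi>_eq) (simp add: JM_def perm_ext_sum transp_def perm_ext_single)
qed

lemma transpose_permutes: "(1::nat) \<le> j \<Longrightarrow> j < i \<Longrightarrow> i \<le> n \<Longrightarrow> Transposition.transpose j i permutes {1..n}"
  by (rule permutes_swap_id) auto

lemma Hom_JM: "1 \<le> i \<Longrightarrow> i \<le> n \<Longrightarrow> \<Phi> n (JM i) \<in> Hom n n"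
  by (auto simp: \<Phi>_JM intro!: Hom_sum perm_tl(1) permutes_swap_id)

lemma mat_perm_transpose:
  assumes "1 \<le> j" "j < i" "i \<le> n" "X \<subseteq> {1..n}" "Y \<subseteq> {1..n}"
  shows "mat (perm_tl n (Transposition.transpose j i)) X Y = - of_bool (X = Transposition.transpose j i ` Y)"
  using perm_tl(2)[OF transpose_permutes[OF assms(1-3)] assms(4,5)] assms by (simp add: sign_swap_id)

lemma transpose_image_image: "Transposition.transpose j i ` Transposition.transpose j i ` Y = Y"
  by (simp add: image_comp)

lemma transpose_image_swap: "X = Transposition.transpose j i ` Y \<longleftrightarrow> Y = Transposition.transpose j i ` X"
  using transpose_image_image[of j i X] transpose_image_image[of j i Y] by auto

text \<open>The sign twist makes each transposition act as minus the swap of the two positions;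
  hence the minus sign in front of the sum.\<close>

lemma mat_comp_JM:
  assumes z: "z \<in> Hom a n" and i: "1 \<le> i" "i \<le> n" and Z: "Z \<subseteq> {1..n}"
  shows "mat (z \<odot> \<Phi> n (JM i)) X Z = - (\<Sum>j\<in>{1..<i}. mat z X (Transposition.transpose j i ` Z))"
proof -
  have "mat (z \<odot> \<Phi> n (JM i)) X Z = (\<Sum>Y\<in>Pow {1..n}. \<Sum>j\<in>{1..<i}.
      - (mat z X Y * of_bool (Y = Transposition.transpose j i ` Z)))"
    unfolding mat_comp[OF z Hom_JM[OF i]] unfolding \<Phi>_JM[OF i] mat_sum
    using i Z by (intro sum.cong refl) (simp add: sum_distrib_left mat_perm_transpose)
  also have "\<dots> = (\<Sum>j\<in>{1..<i}. \<Sum>Y\<in>Pow {1..n}. - (mat z X Y * of_bool (Y = Transposition.transpose j i ` Z)))"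
    by (rule sum.swap)
  also have "\<dots> = (\<Sum>j\<in>{1..<i}. - mat z X (Transposition.transpose j i ` Z))"
  proof (rule sum.cong[OF refl])
    fix j assume "j \<in> {1..<i}"
    then have "Transposition.transpose j i ` Z \<subseteq> {1..n}"
      using i by (intro permutes_image_subset[OF transpose_permutes Z]) auto
    then show "(\<Sum>Y\<in>Pow {1..n}. - (mat z X Y * of_bool (Y = Transposition.transpose j i ` Z))) = - mat z X (Transposition.transpose j i ` Z)"
      using sum_Pow_delta(1) by (simp add: sum_negf)
  qed
  finally show ?thesis by (simp add: sum_negf)
qed

lemma mat_JM_comp:
  assumes z: "z \<in> Hom n b" and i: "1 \<le> i" "i \<le> n" and X: "X \<subseteq> {1..n}"
  shows "mat (\<Phi> n (JM i) \<odot> z) X Z = - (\<Sum>j\<in>{1..<i}. mat z (Transposition.transpose j i ` X) Z)"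
proof -
  have "mat (\<Phi> n (JM i) \<odot> z) X Z = (\<Sum>Y\<in>Pow {1..n}. \<Sum>j\<in>{1..<i}.
      - (of_bool (Y = Transposition.transpose j i ` X) * mat z Y Z))"
    unfolding mat_comp[OF Hom_JM[OF i] z] unfolding \<Phi>_JM[OF i] mat_sum
    using i X by (intro sum.cong refl) (simp add: sum_distrib_right mat_perm_transpose transpose_image_swap[of X])
  also have "\<dots> = (\<Sum>j\<in>{1..<i}. \<Sum>Y\<in>Pow {1..n}. - (of_bool (Y = Transposition.transpose j i ` X) * mat z Y Z))"
    by (rule sum.swap)
  also have "\<dots> = (\<Sum>j\<in>{1..<i}. - mat z (Transposition.transpose j i ` X) Z)"
  proof (rule sum.cong[OF refl])
    fix j assume "j \<in> {1..<i}"
    then have "Transposition.transpose j i ` X \<subseteq> {1..n}"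
      using i by (intro permutes_image_subset[OF transpose_permutes X]) auto
    then show "(\<Sum>Y\<in>Pow {1..n}. - (of_bool (Y = Transposition.transpose j i ` X) * mat z Y Z)) = - mat z (Transposition.transpose j i ` X) Z"
      using sum_Pow_delta(2) by (simp add: sum_negf)
  qed
  finally show ?thesis by (simp add: sum_negf)
qed

section \<open>The Jones-Wenzl idempotent\<close>

text \<open>The projection onto symmetric tensors: it averages over all labelings with the same
  number of marks.\<close>

definition symm :: "nat \<Rightarrow> nat set \<Rightarrow> nat set \<Rightarrow> rat" where
  "symm m X Y = of_bool (card X = card Y) / of_nat (m choose card X)"

lemma transpose_image_same: "(j \<in> X \<longleftrightarrow> i \<in> X) \<Longrightarrow> Transposition.transpose j i ` X = X"
  by (intro Set.set_eqI) (auto simp only: in_transpose_image_iff transpose_def split: if_splits)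

lemma transpose_image_in: "i \<in> X \<Longrightarrow> j \<notin> X \<Longrightarrow> Transposition.transpose j i ` X = insert j (X - {i})"
  by (intro Set.set_eqI) (auto simp only: in_transpose_image_iff transpose_def split: if_splits)

lemma transpose_image_out: "i \<notin> X \<Longrightarrow> j \<in> X \<Longrightarrow> Transposition.transpose j i ` X = insert i (X - {j})"
  by (intro Set.set_eqI) (auto simp only: in_transpose_image_iff transpose_def split: if_splits)

lemma sum_if_mem:
  fixes s t :: rat
  assumes "X \<subseteq> {1..m}"
  shows "(\<Sum>j\<in>{1..<Suc m}. if j \<in> X then s else t) = of_nat (card X) * s + (of_nat m - of_nat (card X)) * t"
proof -
  have "{1..<Suc m} = {1..m}" by auto
  moreover have "{1..m} \<inter> {j. j \<in> X} = X" "{1..m} \<inter> - {j. j \<in> X} = {1..m} - X" using assms by auto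
  moreover have "card X \<le> m" using card_mono[OF _ assms] by simp
  moreover have "card ({1..m} - X) = m - card X"
    using assms by (simp add: card_Diff_subset finite_subset)
  ultimately show ?thesis by (simp add: sum.If_cases of_nat_diff)
qed

lemma card_subset_le: "X \<subseteq> {1..m} \<Longrightarrow> card X \<le> m"
  using card_mono[of "{1..m}" X] by simp

text \<open>The identity and the swaps with the last position represent the cosets of the symmetric
  group on \<open>m\<close> letters in the one on \<open>M = m + 1\<close> letters. Averaging over
  them extends the symmetrizer by one position; since transpositions act as negated swaps, this
  average is \<open>(1 - L) / M\<close>. The four cases distinguish whether the last position is
  marked in \<open>X\<close> and in \<open>Z\<close>.\<close>

lemma symm_exists: "\<exists>e\<in>Hom m m. \<forall>X Y. X \<subseteq> {1..m} \<longrightarrow> Y \<subseteq> {1..m} \<longrightarrow> mat e X Y = symm m X Y"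
proof (induction m)
  case 0
  show ?case by (rule bexI[OF _ Hom_one]) (auto simp: mat_one symm_def)
next
  case (Suc m)
  then obtain e where e: "e \<in> Hom m m"
    and me: "\<And>X Y. X \<subseteq> {1..m} \<Longrightarrow> Y \<subseteq> {1..m} \<Longrightarrow> mat e X Y = symm m X Y" by blast
  define M where "M = Suc m"
  define z where "z = add_lines m m 1 e"
  have z: "z \<in> Hom M M" using Hom_add_lines[OF e, of 1] by (simp add: z_def M_def)
  have mz: "mat z X Y = (if M \<in> X \<longleftrightarrow> M \<in> Y then symm m (X - {M}) (Y - {M}) else 0)"
    if "X \<subseteq> {1..M}" "Y \<subseteq> {1..M}" for X Y
  proof -
    have fin: "finite X" "finite Y" using that finite_subset by auto
    have sub: "X - {M} \<subseteq> {1..m}" "Y - {M} \<subseteq> {1..m}" using that by (auto simp: M_def)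
    show ?thesis using mat_add_lines_Suc[OF e fin, of 0] me[OF sub]
      by (simp add: z_def M_def mat_add_lines_0)
  qed
  define L where "L = \<Phi> M (JM M)"
  have L: "L \<in> Hom M M" unfolding L_def by (rule Hom_JM) (auto simp: M_def)
  define e' where "e' = scale (1 / of_nat M) ((tl_one M - L) \<odot> z)"
  have e': "e' \<in> Hom M M" unfolding e'_def by (intro Hom_scale Hom_comp[OF Hom_diff[OF Hom_one L] z])
  have "mat e' X Z = symm M X Z" if XZ: "X \<subseteq> {1..M}" "Z \<subseteq> {1..M}" for X Z
  proof -
    have one: "mat ((tl_one M - L) \<odot> z) X Z = mat z X Z - mat (L \<odot> z) X Z"
    proof -
      have "mat ((tl_one M - L) \<odot> z) X Z = (\<Sum>Y\<in>Pow {1..M}. mat (tl_one M) X Y * mat z Y Z - mat L X Y * mat z Y Z)"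
        unfolding mat_comp[OF Hom_diff[OF Hom_one L] z] by (simp add: mat_diff left_diff_distrib)
      also have "\<dots> = (\<Sum>Y\<in>Pow {1..M}. of_bool (Y = X) * mat z Y Z) - mat (L \<odot> z) X Z"
        unfolding mat_comp[OF L z] sum_subtractf using XZ by (intro arg_cong2[of _ _ _ _ "(-)"] sum.cong) (auto simp: mat_one)
      also have "\<dots> = mat z X Z - mat (L \<odot> z) X Z" by (simp only: sum_Pow_delta(2)[OF XZ(1)])
      finally show ?thesis .
    qed
    have "mat (L \<odot> z) X Z = - (\<Sum>j\<in>{1..<M}. mat z (Transposition.transpose j M ` X) Z)"
      unfolding L_def by (rule mat_JM_comp[OF z _ _ XZ(1)]) (auto simp: M_def)
    then have eq: "mat e' X Z = (mat z X Z + (\<Sum>j\<in>{1..<M}. mat z (Transposition.transpose j M ` X) Z)) / of_nat M"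
      unfolding e'_def mat_scale one by simp
    have sub: "X - {M} \<subseteq> {1..m}" "Z - {M} \<subseteq> {1..m}" using XZ by (auto simp: M_def)
    have fin: "finite X" "finite Z" using XZ finite_subset by auto
    let ?k = "card (X - {M})" and ?l = "card (Z - {M})"
    have kl: "?k \<le> m" "?l \<le> m" using sub card_subset_le by auto
    \<comment> \<open>The effect of swapping \<open>j\<close> with the last position depends only on
      whether \<open>j\<close> is marked, so there are two kinds of summands.\<close>
    have sum_eq: "(\<Sum>j\<in>{1..<M}. mat z (Transposition.transpose j M ` X) Z) = of_nat ?k * s + (of_nat m - of_nat ?k) * t"
      if st: "\<And>j. j \<in> {1..m} \<Longrightarrow> j \<in> X \<Longrightarrow> mat z (Transposition.transpose j M ` X) Z = s"
        "\<And>j. j \<in> {1..m} \<Longrightarrow> j \<notin> X \<Longrightarrow> mat z (Transposition.transpose j M ` X) Z = t" for s t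
    proof -
      have "(\<Sum>j\<in>{1..<M}. mat z (Transposition.transpose j M ` X) Z) = (\<Sum>j\<in>{1..<Suc m}. if j \<in> X - {M} then s else t)"
      proof (rule sum.cong)
        fix j assume "j \<in> {1..<Suc m}"
        then have "j \<in> {1..m}" "j \<noteq> M" by (auto simp: M_def)
        then show "mat z (Transposition.transpose j M ` X) Z = (if j \<in> X - {M} then s else t)"
          using st[of j] by simp
      qed (simp add: M_def)
      then show ?thesis using sum_if_mem[OF sub(1)] by simp
    qed
    have subj: "Transposition.transpose j M ` X \<subseteq> {1..M}" if "j \<in> {1..m}" for j
      using that by (intro permutes_image_subset[OF transpose_permutes XZ(1)]) (auto simp: M_def)
    \<comment> \<open>Removing the last position changes the binomial coefficient by the fraction of
      marked positions (\<open>bin1\<close>) or of unmarked positions (\<open>bin2\<close>).\<close>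
    have bin1: "(of_nat M * of_nat (m choose k) :: rat) = of_nat (Suc k) * of_nat (M choose Suc k)" for k
      using Suc_times_binomial[of k m] unfolding M_def by (metis of_nat_mult)
    have bin2: "(of_nat M * of_nat (m choose k) :: rat) = (of_nat M - of_nat k) * of_nat (M choose k)" if "k \<le> m" for k
    proof -
      have "(M - k) * (M choose k) = M * (m choose k)"
        using binomial_absorb_comp[of M k] by (simp add: M_def)
      then have "(of_nat M * of_nat (m choose k) :: rat) = of_nat (M - k) * of_nat (M choose k)"
        by (metis of_nat_mult)
      moreover have "k \<le> M" using that by (simp add: M_def)
      ultimately show ?thesis by (simp add: of_nat_diff)
    qed
    have M0: "of_nat M \<noteq> (0 :: rat)" by (simp add: M_def)
    have div: "t * (1 / A) / of_nat M = 1 / B" if "of_nat M * A = t * B" "A \<noteq> 0" "B \<noteq> 0" for t A B :: rat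
    proof -
      have t: "t = of_nat M * A / B" using that by (simp add: field_simps)
      show ?thesis unfolding t using that(2,3) M0 by simp
    qed
    show ?thesis
    proof (cases "M \<in> X")
      case MX: True
      have cX: "card X = Suc ?k" by (rule card.remove[OF fin(1) MX])
      show ?thesis
      proof (cases "M \<in> Z")
        case MZ: True
        have cZ: "card Z = Suc ?l" by (rule card.remove[OF fin(2) MZ])
        have zX: "mat z X Z = symm m (X - {M}) (Z - {M})" using mz[OF XZ] MX MZ by simp
        have "(\<Sum>j\<in>{1..<M}. mat z (Transposition.transpose j M ` X) Z) =
            of_nat ?k * symm m (X - {M}) (Z - {M}) + (of_nat m - of_nat ?k) * 0"
        proof (rule sum_eq)
          fix j assume "j \<in> {1..m}" "j \<in> X"
          then show "mat z (Transposition.transpose j M ` X) Z = symm m (X - {M}) (Z - {M})"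
            using zX MX by (simp add: transpose_image_same)
        next
          fix j assume j: "j \<in> {1..m}" "j \<notin> X"
          then have "M \<notin> Transposition.transpose j M ` X" using MX by (auto simp: transpose_image_in M_def)
          then show "mat z (Transposition.transpose j M ` X) Z = 0" using mz[OF subj[OF j(1)] XZ(2)] MZ by simp
        qed
        then have "mat e' X Z = of_nat (Suc ?k) * symm m (X - {M}) (Z - {M}) / of_nat M"
          unfolding eq zX by (simp add: algebra_simps)
        also have "\<dots> = symm M X Z"
          unfolding symm_def cX cZ using bin1[of ?k] kl by (auto simp: M_def field_simps simp del: of_nat_Suc binomial_Suc_Suc)
        finally show ?thesis .
      next
        case MZ: False
        have cZ: "card Z = ?l" using MZ by simp
        have zX: "mat z X Z = 0" using mz[OF XZ] MX MZ by simp
        have "(\<Sum>j\<in>{1..<M}. mat z (Transposition.transpose j M ` X) Z) =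
            of_nat ?k * 0 + (of_nat m - of_nat ?k) * (of_bool (Suc ?k = ?l) / of_nat (m choose Suc ?k))"
        proof (rule sum_eq)
          fix j assume "j \<in> {1..m}" "j \<in> X"
          then show "mat z (Transposition.transpose j M ` X) Z = 0"
            using zX MX by (simp add: transpose_image_same)
        next
          fix j assume j: "j \<in> {1..m}" "j \<notin> X"
          then have t: "Transposition.transpose j M ` X = insert j (X - {M})" using MX by (simp add: transpose_image_in)
          moreover have "M \<notin> insert j (X - {M})" using j by (auto simp: M_def)
          moreover have "card (insert j (X - {M})) = Suc ?k" using j fin by simp
          ultimately show "mat z (Transposition.transpose j M ` X) Z = of_bool (Suc ?k = ?l) / of_nat (m choose Suc ?k)"
            using mz[OF subj[OF j(1)] XZ(2)] MZ unfolding t symm_def by simp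
        qed
        then have "mat e' X Z = (of_nat m - of_nat ?k) * (of_bool (Suc ?k = ?l) / of_nat (m choose Suc ?k)) / of_nat M"
          unfolding eq zX by simp
        also have "\<dots> = symm M X Z"
        proof (cases "Suc ?k = ?l")
          case True
          then have "Suc ?k \<le> m" using kl by simp
          have "of_nat M * of_nat (m choose Suc ?k) = (of_nat m - of_nat ?k) * (of_nat (M choose Suc ?k) :: rat)"
            using bin2[OF \<open>Suc ?k \<le> m\<close>] by (simp add: M_def del: binomial_Suc_Suc)
          from div[OF this] \<open>Suc ?k \<le> m\<close>
          have "(of_nat m - of_nat ?k) * (1 / of_nat (m choose Suc ?k)) / of_nat M = (1 :: rat) / of_nat (M choose Suc ?k)"
            by (simp add: M_def del: binomial_Suc_Suc of_nat_Suc)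
          then show ?thesis
            using True unfolding symm_def cX cZ by (simp del: binomial_Suc_Suc of_nat_Suc)
        qed (simp add: symm_def cX cZ)
        finally show ?thesis .
      qed
    next
      case MX: False
      have cX: "card X = ?k" using MX by simp
      show ?thesis
      proof (cases "M \<in> Z")
        case MZ: True
        have cZ: "card Z = Suc ?l" by (rule card.remove[OF fin(2) MZ])
        have zX: "mat z X Z = 0" using mz[OF XZ] MX MZ by simp
        have "(\<Sum>j\<in>{1..<M}. mat z (Transposition.transpose j M ` X) Z) =
            of_nat ?k * (of_bool (?k = Suc ?l) / of_nat (m choose ?l)) + (of_nat m - of_nat ?k) * 0"
        proof (rule sum_eq)
          fix j assume j: "j \<in> {1..m}" "j \<in> X"
          then have t: "Transposition.transpose j M ` X = insert M (X - {j})" using MX by (simp add: transpose_image_out)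
          have "insert M (X - {j}) - {M} = X - {j}" using MX by auto
          moreover have "card X = Suc (card (X - {j}))" by (rule card.remove[OF fin(1) j(2)])
          ultimately show "mat z (Transposition.transpose j M ` X) Z = of_bool (?k = Suc ?l) / of_nat (m choose ?l)"
            using mz[OF subj[OF j(1)] XZ(2)] MZ MX unfolding t symm_def by auto
        next
          fix j assume "j \<in> {1..m}" "j \<notin> X"
          then show "mat z (Transposition.transpose j M ` X) Z = 0"
            using zX MX by (simp add: transpose_image_same)
        qed
        then have "mat e' X Z = of_nat ?k * (of_bool (?k = Suc ?l) / of_nat (m choose ?l)) / of_nat M"
          unfolding eq zX by simp
        also have "\<dots> = symm M X Z"
        proof (cases "?k = Suc ?l")
          case True
          then show ?thesis
            unfolding symm_def cX cZ using bin1[of ?l] kl by (auto simp: M_def field_simps simp del: of_nat_Suc binomial_Suc_Suc)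
        qed (simp add: symm_def cX cZ)
        finally show ?thesis .
      next
        case MZ: False
        have cZ: "card Z = ?l" using MZ by simp
        have zX: "mat z X Z = symm m X Z" using mz[OF XZ] MX MZ by simp
        have "(\<Sum>j\<in>{1..<M}. mat z (Transposition.transpose j M ` X) Z) =
            of_nat ?k * 0 + (of_nat m - of_nat ?k) * symm m X Z"
        proof (rule sum_eq)
          fix j assume j: "j \<in> {1..m}" "j \<in> X"
          then have "M \<in> Transposition.transpose j M ` X" using MX by (simp add: transpose_image_out)
          then show "mat z (Transposition.transpose j M ` X) Z = 0" using mz[OF subj[OF j(1)] XZ(2)] MZ by simp
        next
          fix j assume "j \<in> {1..m}" "j \<notin> X"
          then show "mat z (Transposition.transpose j M ` X) Z = symm m X Z"
            using zX MX by (simp add: transpose_image_same)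
        qed
        then have "mat e' X Z = (of_nat M - of_nat ?k) * symm m X Z / of_nat M"
          unfolding eq zX by (simp add: algebra_simps M_def)
        also have "\<dots> = symm M X Z"
        proof (cases "?k = card Z")
          case True
          from div[OF bin2[OF kl(1)]] kl(1)
          have "(of_nat M - of_nat ?k) * (1 / of_nat (m choose ?k)) / of_nat M = (1 :: rat) / of_nat (M choose ?k)"
            by (simp add: M_def del: of_nat_Suc)
          then show ?thesis
            using True unfolding symm_def cX by (simp del: binomial_Suc_Suc of_nat_Suc)
        qed (simp add: symm_def cX)
        finally show ?thesis .
      qed
    qed
  qed
  then show ?case using e' unfolding M_def by blast
qed

section \<open>The symmetrizer annihilates every diagram except the identity\<close>

definition straight :: "nat \<Rightarrow> diagram \<Rightarrow> bool" where
  "straight m D \<longleftrightarrow> (\<forall>i\<in>{1..m}. \<forall>j\<in>{1..m}. mate D (Top i) \<noteq> Top j)"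

text \<open>Every top point is joined to a bottom point, and by counting this uses up all the bottom
  points.\<close>

lemma openers_straight:
  assumes D: "D \<in> diagrams m m" and s: "straight m D"
  shows "openers m m D = Top ` {1..m}"
proof -
  have top: "\<exists>j\<in>{1..m}. mate D (Top i) = Bot j" if "i \<in> {1..m}" for i
  proof -
    have "mate D (Top i) \<in> points m m" using mate(3)[OF D, of "Top i"] that by simp
    then show ?thesis using s that by (cases "mate D (Top i)") (auto simp: straight_def)
  qed
  define h where "h i = (SOME j. j \<in> {1..m} \<and> mate D (Top i) = Bot j)" for i
  have h: "h i \<in> {1..m} \<and> mate D (Top i) = Bot (h i)" if "i \<in> {1..m}" for i
    unfolding h_def by (rule someI_ex) (use top[OF that] in blast)
  have "inj_on h {1..m}"
  proof (rule inj_onI)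
    fix i j assume ij: "i \<in> {1..m}" "j \<in> {1..m}" "h i = h j"
    then have "mate D (Top i) = mate D (Top j)" using h by simp
    moreover have "mate D (mate D (Top k)) = Top k" if "k \<in> {1..m}" for k
      using that by (intro mate_mate[OF D]) simp
    ultimately have "Top i = Top j" using ij by metis
    then show "i = j" by simp
  qed
  then have surj: "h ` {1..m} = {1..m}" using h by (intro endo_inj_surj) auto
  have "p \<in> openers m m D \<longleftrightarrow> p \<in> Top ` {1..m}" for p
  proof (cases p)
    case (Top i)
    then show ?thesis using h[of i] by (auto simp: openers_def)
  next
    case (Bot j)
    have "p \<notin> openers m m D"
    proof
      assume p: "p \<in> openers m m D"
      then have "j \<in> {1..m}" using Bot by (simp add: openers_def)
      then obtain i where i: "i \<in> {1..m}" "j = h i" using surj by blast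
      then have "mate D p = Top i" using h[OF i(1)] mate_mate[OF D, of "Top i"] Bot by simp
      then show False using p Bot by (simp add: openers_def)
    qed
    then show ?thesis using Bot by auto
  qed
  then show ?thesis by blast
qed

lemma straight_eq_id:
  assumes D: "D \<in> diagrams m m" and s: "straight m D"
  shows "D = id_diagram m"
proof -
  have "mate (id_diagram m) (Top i) = Bot i" if "i \<in> {1..m}" for i
    using that by (intro mate_eqI[OF id_diagram_diagrams]) (auto simp: id_diagram_def)
  then have "straight m (id_diagram m)" by (simp add: straight_def)
  then show ?thesis
    using openers_straight[OF D s] openers_straight[OF id_diagram_diagrams]
    by (intro openers_determine[OF D id_diagram_diagrams]) simp
qed

text \<open>An arc between two top points acts antisymmetrically: compatibility marks exactly one of
  its ends, and the ends have opposite parity, so moving the mark across changes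
  \<open>sg\<close>.\<close>

lemma mat_diagram_transpose:
  assumes D: "D \<in> diagrams a b" and i: "i \<in> {1..a}" and j: "mate D (Top i) = Top j" and Y: "finite Y"
  shows "mat_diagram D (Transposition.transpose j i ` Y) Z = - mat_diagram D Y Z"
proof -
  define W where "W = Transposition.transpose j i ` Y"
  have W: "i \<in> W \<longleftrightarrow> j \<in> Y" "j \<in> W \<longleftrightarrow> i \<in> Y" "k \<noteq> i \<Longrightarrow> k \<noteq> j \<Longrightarrow> k \<in> W \<longleftrightarrow> k \<in> Y" for k
    by (simp_all add: W_def in_transpose_image_iff)
  have pi: "Top i \<in> points a b" using i by simp
  have mj: "mate D (Top j) = Top i" using mate_mate[OF D pi] j by simp
  have pj: "Top j \<in> points a b" using mate(3)[OF D pi] j by simp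
  have par: "even i \<noteq> even j" using label_mate[OF D pi, of "{}" "{}"] j by simp
  have "side_label W Z p \<noteq> side_label W Z (mate D p) \<longleftrightarrow> side_label Y Z p \<noteq> side_label Y Z (mate D p)"
    if p: "p \<in> points a b" for p
  proof (cases "p = Top i \<or> p = Top j")
    case True
    then show ?thesis using W(1,2) j mj by auto
  next
    case False
    then have "mate D p \<noteq> Top i" "mate D p \<noteq> Top j" using mate_mate[OF D p] j mj by auto
    moreover have "side_label W Z q = side_label Y Z q" if "q \<noteq> Top i" "q \<noteq> Top j" for q
      using that W(3) by (cases q) auto
    ultimately show ?thesis using False by simp
  qed
  then have comp: "compatible D W Z \<longleftrightarrow> compatible D Y Z" unfolding compatible_iff[OF D] by blast
  have "sg W = - sg Y" if C: "compatible D Y Z"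
  proof -
    have "side_label Y Z (Top i) \<noteq> side_label Y Z (mate D (Top i))"
      using C pi unfolding compatible_iff[OF D] by blast
    then have "i \<in> Y \<longleftrightarrow> j \<notin> Y" by (simp add: j)
    then consider "i \<in> Y" "j \<notin> Y" | "i \<notin> Y" "j \<in> Y" by blast
    then show ?thesis
    proof cases
      case 1
      then have "W = insert j (Y - {i})" by (simp add: W_def transpose_image_in)
      then have "sg W = (- 1) ^ j * sg (Y - {i})" using 1 Y sg_insert[of "Y - {i}" j] by simp
      then show ?thesis using sg_remove[OF Y, of i] 1 par by (auto simp: minus_one_power_iff)
    next
      case 2
      then have "W = insert i (Y - {j})" by (simp add: W_def transpose_image_out)
      then have "sg W = (- 1) ^ i * sg (Y - {j})" using 2 Y sg_insert[of "Y - {j}" i] by simp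
      then show ?thesis using sg_remove[OF Y, of j] 2 par by (auto simp: minus_one_power_iff)
    qed
  qed
  then show ?thesis using comp by (auto simp: mat_diagram_def W_def)
qed

lemma card_transpose_image: "finite X \<Longrightarrow> card (Transposition.transpose j i ` X) = card X"
  by (intro card_image inj_on_subset[OF inj_transpose]) auto

text \<open>A diagram other than the identity has an arc between two top points. Swapping its ends
  preserves \<open>symm\<close> and negates the entries of \<open>D\<close>, so the sum equals its
  own negative.\<close>

lemma symm_mat_diagram:
  assumes D: "D \<in> diagrams m m" and X: "X \<subseteq> {1..m}" and Z: "Z \<subseteq> {1..m}"
  shows "(\<Sum>Y\<in>Pow {1..m}. symm m X Y * mat_diagram D Y Z) = (if D = id_diagram m then symm m X Z else 0)"
proof (cases "straight m D")
  case True
  then have id: "D = id_diagram m" by (rule straight_eq_id[OF D])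
  have "(\<Sum>Y\<in>Pow {1..m}. symm m X Y * mat_diagram D Y Z) = (\<Sum>Y\<in>Pow {1..m}. symm m X Y * of_bool (Y = Z))"
    using Z by (intro sum.cong refl) (simp add: id mat_diagram_id)
  then show ?thesis using sum_Pow_delta(1)[OF Z] id by simp
next
  case False
  then obtain i j where ij: "i \<in> {1..m}" "j \<in> {1..m}" "mate D (Top i) = Top j" by (auto simp: straight_def)
  let ?t = "(`) (Transposition.transpose j i)"
  have "Transposition.transpose j i permutes {1..m}" using ij by (intro permutes_swap_id)
  then have sub: "?t Y \<subseteq> {1..m}" if "Y \<subseteq> {1..m}" for Y using that by (rule permutes_image_subset)
  have "(\<Sum>Y\<in>Pow {1..m}. symm m X Y * mat_diagram D Y Z) = (\<Sum>Y\<in>Pow {1..m}. symm m X (?t Y) * mat_diagram D (?t Y) Z)"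
    by (rule sum.reindex_bij_witness[of _ ?t ?t]) (use sub in \<open>auto simp: image_comp transpose_comp_involutory\<close>)
  also have "\<dots> = (\<Sum>Y\<in>Pow {1..m}. - (symm m X Y * mat_diagram D Y Z))"
  proof (rule sum.cong[OF refl])
    fix Y assume "Y \<in> Pow {1..m}"
    then have "finite Y" using finite_subset by blast
    then show "symm m X (?t Y) * mat_diagram D (?t Y) Z = - (symm m X Y * mat_diagram D Y Z)"
      using mat_diagram_transpose[OF D ij(1,3), of Y] card_transpose_image[of Y j i] by (simp add: symm_def)
  qed
  finally have "(\<Sum>Y\<in>Pow {1..m}. symm m X Y * mat_diagram D Y Z) = 0" by (simp add: sum_negf)
  moreover have "D \<noteq> id_diagram m"
  proof
    assume id: "D = id_diagram m"
    have "mate D (Top i) = Bot i"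
      unfolding id using ij by (intro mate_eqI[OF id_diagram_diagrams]) (auto simp: id_diagram_def)
    then show False using ij by simp
  qed
  ultimately show ?thesis by simp
qed

text \<open>Only the coefficient at the identity diagram survives multiplication by the symmetrizer.
  This gives both the uniqueness of \<open>JW\<close> and the one-dimensional corner behind
  primitivity.\<close>

lemma symm_mat:
  assumes x: "x \<in> Hom m m" and X: "X \<subseteq> {1..m}" and Z: "Z \<subseteq> {1..m}"
  shows "(\<Sum>Y\<in>Pow {1..m}. symm m X Y * mat x Y Z) = Poly_Mapping.lookup x (id_diagram m) * symm m X Z"
proof -
  have "(\<Sum>Y\<in>Pow {1..m}. symm m X Y * mat x Y Z) = (\<Sum>Y\<in>Pow {1..m}. \<Sum>D\<in>Poly_Mapping.keys x.
      Poly_Mapping.lookup x D * (symm m X Y * mat_diagram D Y Z))"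
    by (simp add: mat_def sum_distrib_left mult_ac)
  also have "\<dots> = (\<Sum>D\<in>Poly_Mapping.keys x. \<Sum>Y\<in>Pow {1..m}. Poly_Mapping.lookup x D * (symm m X Y * mat_diagram D Y Z))"
    by (rule sum.swap)
  also have "\<dots> = (\<Sum>D\<in>Poly_Mapping.keys x. if D = id_diagram m then Poly_Mapping.lookup x (id_diagram m) * symm m X Z else 0)"
  proof (rule sum.cong[OF refl])
    fix D assume "D \<in> Poly_Mapping.keys x"
    then have D: "D \<in> diagrams m m" using x by (auto simp: Hom_def)
    show "(\<Sum>Y\<in>Pow {1..m}. Poly_Mapping.lookup x D * (symm m X Y * mat_diagram D Y Z)) =
      (if D = id_diagram m then Poly_Mapping.lookup x (id_diagram m) * symm m X Z else 0)"
      using symm_mat_diagram[OF D X Z] by (simp flip: sum_distrib_left)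
  qed
  also have "\<dots> = Poly_Mapping.lookup x (id_diagram m) * symm m X Z"
    by (simp add: in_keys_iff)
  finally show ?thesis .
qed

definition sum_card :: "nat \<Rightarrow> nat \<Rightarrow> (nat set \<Rightarrow> rat) \<Rightarrow> rat" where
  "sum_card m k g = (\<Sum>Y\<in>{Y \<in> Pow {1..m}. card Y = k}. g Y)"

lemma sum_symm: "(\<Sum>Y\<in>Pow {1..m}. symm m X Y * g Y) = sum_card m (card X) g / of_nat (m choose card X)"
proof -
  have "(\<Sum>Y\<in>Pow {1..m}. symm m X Y * g Y) = (\<Sum>Y\<in>Pow {1..m}. if card Y = card X then g Y / of_nat (m choose card X) else 0)"
    by (intro sum.cong) (auto simp: symm_def)
  also have "\<dots> = (\<Sum>Y\<in>{Y \<in> Pow {1..m}. card Y = card X}. g Y / of_nat (m choose card X))"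
    by (rule sum.inter_filter[symmetric]) simp
  finally show ?thesis by (simp add: sum_card_def sum_divide_distrib)
qed

lemma sum_card_const:
  assumes "\<And>Y. Y \<subseteq> {1..m} \<Longrightarrow> card Y = k \<Longrightarrow> g Y = c"
  shows "sum_card m k g = of_nat (m choose k) * c"
proof -
  have "sum_card m k g = (\<Sum>Y\<in>{Y \<in> Pow {1..m}. card Y = k}. c)"
    unfolding sum_card_def using assms by (intro sum.cong) auto
  moreover have "card {Y \<in> Pow {1..m}. card Y = k} = m choose k"
    using n_subsets[of "{1..m}" k] by (simp add: Pow_def)
  ultimately show ?thesis by simp
qed

lemma sum_symm_const:
  assumes X: "X \<subseteq> {1..m}" and g: "\<And>Y. Y \<subseteq> {1..m} \<Longrightarrow> card Y = card X \<Longrightarrow> g Y = g X"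
  shows "(\<Sum>Y\<in>Pow {1..m}. symm m X Y * g Y) = g X"
  using sum_card_const[of m "card X" g "g X"] g card_subset_le[OF X] unfolding sum_symm by simp

lemma downward_closed_eq:
  assumes X: "X \<subseteq> {1..n}" and c: "\<And>i. 1 \<le> i \<Longrightarrow> i + 1 \<in> X \<Longrightarrow> i \<in> X"
  shows "X = {1..card X}"
proof -
  have fin: "finite X" using X finite_subset by blast
  have down: "j \<in> X" if "i \<in> X" "1 \<le> j" "j \<le> i" for i j
    using that(3,1)
  proof (induction rule: inc_induct)
    case (step k)
    then show ?case using c[of k] that(2) by simp
  qed
  show ?thesis
  proof (cases "X = {}")
    case False
    have "X = {1..Max X}"
    proof
      show "X \<subseteq> {1..Max X}" using X fin by auto
      show "{1..Max X} \<subseteq> X" using down[OF Max_in[OF fin False]] by auto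
    qed
    then have "card X = Max X" by (metis card_atLeastAtMost diff_Suc_1)
    then show ?thesis using \<open>X = {1..Max X}\<close> by simp
  qed simp
qed

text \<open>Moving a mark into a free position to its left lowers the sum of the marked positions,
  and this ends at the initial segment.\<close>

lemma adjacent_invariant_card:
  fixes g :: "nat set \<Rightarrow> 'a"
  assumes inv: "\<And>X i. X \<subseteq> {1..n} \<Longrightarrow> 1 \<le> i \<Longrightarrow> i < n \<Longrightarrow> g (Transposition.transpose i (i + 1) ` X) = g X"
    and X: "X \<subseteq> {1..n}"
  shows "g X = g {1..card X}"
  using X
proof (induction "\<Sum>X" arbitrary: X rule: less_induct)
  case less
  show ?case
  proof (cases "\<exists>i. 1 \<le> i \<and> i + 1 \<in> X \<and> i \<notin> X")
    case True
    then obtain i where i: "1 \<le> i" "i + 1 \<in> X" "i \<notin> X" by blast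
    have fin: "finite X" using less.prems finite_subset by blast
    have "i < n" using i less.prems by auto
    define W where "W = Transposition.transpose i (i + 1) ` X"
    have W: "W = insert i (X - {i + 1})" using i by (simp add: W_def transpose_image_in)
    have "\<Sum>W = i + \<Sum>(X - {i + 1})" unfolding W using i fin by simp
    moreover have "\<Sum>X = (i + 1) + \<Sum>(X - {i + 1})" using i fin by (simp add: sum.remove)
    ultimately have "\<Sum>W < \<Sum>X" by simp
    moreover have "W \<subseteq> {1..n}" unfolding W using less.prems i \<open>i < n\<close> by auto
    ultimately have "g W = g {1..card W}" by (rule less.hyps)
    moreover have "card W = card X" unfolding W_def by (rule card_transpose_image[OF fin])
    moreover have "g W = g X" unfolding W_def using inv[OF less.prems i(1) \<open>i < n\<close>] .
    ultimately show ?thesis by simp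
  next
    case False
    then have "X = {1..card X}" using less.prems by (intro downward_closed_eq) auto
    then show ?thesis by simp
  qed
qed

lemma symm_idem:
  assumes "X \<subseteq> {1..m}"
  shows "(\<Sum>Y\<in>Pow {1..m}. symm m X Y * symm m Y Z) = symm m X Z"
  using assms by (intro sum_symm_const) (auto simp: symm_def)

lemma mat_u_comp:
  assumes z: "z \<in> Hom n b" and i: "1 \<le> i" "i < n" and X: "X \<subseteq> {1..n}"
  shows "mat (tl_u n i \<odot> z) X Z = mat z X Z - mat z (Transposition.transpose i (i + 1) ` X) Z"
proof -
  have sub: "Transposition.transpose i (i + 1) ` X \<subseteq> {1..n}"
    using i by (intro permutes_image_subset[OF transpose_permutes X]) auto
  have "mat (tl_u n i \<odot> z) X Z = (\<Sum>Y\<in>Pow {1..n}. of_bool (Y = X) * mat z Y Z -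
      of_bool (Y = Transposition.transpose i (i + 1) ` X) * mat z Y Z)"
    unfolding mat_comp[OF Hom_u[OF i] z]
  proof (rule sum.cong[OF refl])
    fix Y assume Y: "Y \<in> Pow {1..n}"
    have "mat (tl_u n i) X Y = of_bool (Y = X) - of_bool (Y = Transposition.transpose i (i + 1) ` X)"
      unfolding mat_u[OF i X PowD[OF Y]] transpose_image_swap[of X i "i + 1" Y] eq_commute[of X Y] by (rule refl)
    then show "mat (tl_u n i) X Y * mat z Y Z = of_bool (Y = X) * mat z Y Z -
        of_bool (Y = Transposition.transpose i (i + 1) ` X) * mat z Y Z"
      by (simp add: left_diff_distrib)
  qed
  also have "\<dots> = mat z X Z - mat z (Transposition.transpose i (i + 1) ` X) Z"
    unfolding sum_subtractf sum_Pow_delta(2)[OF X] sum_Pow_delta(2)[OF sub] ..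
  finally show ?thesis .
qed

lemma mat_comp_u:
  assumes z: "z \<in> Hom a n" and i: "1 \<le> i" "i < n" and X: "X \<subseteq> {1..n}"
  shows "mat (z \<odot> tl_u n i) Z X = mat z Z X - mat z Z (Transposition.transpose i (i + 1) ` X)"
proof -
  have sub: "Transposition.transpose i (i + 1) ` X \<subseteq> {1..n}"
    using i by (intro permutes_image_subset[OF transpose_permutes X]) auto
  have "mat (z \<odot> tl_u n i) Z X = (\<Sum>Y\<in>Pow {1..n}. mat z Z Y * of_bool (Y = X) -
      mat z Z Y * of_bool (Y = Transposition.transpose i (i + 1) ` X))"
    unfolding mat_comp[OF z Hom_u[OF i]] using X
    by (intro sum.cong refl) (simp add: mat_u[OF i] right_diff_distrib)
  also have "\<dots> = mat z Z X - mat z Z (Transposition.transpose i (i + 1) ` X)"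
    unfolding sum_subtractf sum_Pow_delta(1)[OF X] sum_Pow_delta(1)[OF sub] ..
  finally show ?thesis .
qed

text \<open>The symmetrizer \<open>s\<close> qualifies. For uniqueness,
  \<open>u\<^sub>i e = 0\<close> makes the entries of \<open>e\<close> depend on the row label only
  through its number of marks, so \<open>s e = e\<close>; on the other hand, \<open>s e\<close> is a
  multiple of \<open>s\<close> by \<open>symm_mat\<close>. Idempotence forces the factor 1, as
  \<open>e\<close> is nonzero.\<close>

lemma JW: "JW m \<in> Hom m m" and mat_JW: "X \<subseteq> {1..m} \<Longrightarrow> Y \<subseteq> {1..m} \<Longrightarrow> mat (JW m) X Y = symm m X Y"
proof -
  define P where "P e \<longleftrightarrow> e \<in> Hom m m \<and> e \<noteq> 0 \<and> e \<odot> e = e \<and>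
     (\<forall>i. 1 \<le> i \<and> i < m \<longrightarrow> tl_u m i \<odot> e = 0 \<and> e \<odot> tl_u m i = 0)" for e
  obtain s where s: "s \<in> Hom m m" and ms: "\<And>X Y. X \<subseteq> {1..m} \<Longrightarrow> Y \<subseteq> {1..m} \<Longrightarrow> mat s X Y = symm m X Y"
    using symm_exists by blast
  have s1: "mat s {} {} = 1" using ms[of "{}" "{}"] by (simp add: symm_def)
  have "P s"
    unfolding P_def
  proof (intro conjI allI impI)
    show "s \<noteq> 0" using s1 by auto
    show "s \<odot> s = s"
    proof (rule mat_inj[OF Hom_comp[OF s s] s])
      fix X Z assume XZ: "X \<subseteq> {1..m}" "Z \<subseteq> {1..m}"
      have "mat (s \<odot> s) X Z = (\<Sum>Y\<in>Pow {1..m}. symm m X Y * symm m Y Z)"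
        unfolding mat_comp[OF s s] using XZ by (intro sum.cong) (auto simp: ms)
      then show "mat (s \<odot> s) X Z = mat s X Z" unfolding symm_idem[OF XZ(1)] ms[OF XZ] .
    qed
    fix i assume i: "1 \<le> i \<and> i < m"
    have sub: "Transposition.transpose i (i + 1) ` X \<subseteq> {1..m}" if "X \<subseteq> {1..m}" for X
      using i by (intro permutes_image_subset[OF transpose_permutes that]) auto
    have card: "card (Transposition.transpose i (i + 1) ` X) = card X" if "X \<subseteq> {1..m}" for X
      using that finite_subset by (intro card_transpose_image) blast
    show "tl_u m i \<odot> s = 0"
    proof (rule mat_eq_0[OF Hom_comp[OF Hom_u s]])
      fix X Z assume XZ: "X \<subseteq> {1..m}" "Z \<subseteq> {1..m}"
      show "mat (tl_u m i \<odot> s) X Z = 0"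
        using i mat_u_comp[OF s _ _ XZ(1), of i Z] XZ sub card by (simp add: ms symm_def)
    qed (use i in auto)
    show "s \<odot> tl_u m i = 0"
    proof (rule mat_eq_0[OF Hom_comp[OF s Hom_u]])
      fix X Z assume XZ: "X \<subseteq> {1..m}" "Z \<subseteq> {1..m}"
      show "mat (s \<odot> tl_u m i) X Z = 0"
        using i mat_comp_u[OF s _ _ XZ(2), of i X] XZ sub card by (simp add: ms symm_def)
    qed (use i in auto)
  qed (rule s)
  moreover have "e = s" if "P e" for e
  proof -
    have e: "e \<in> Hom m m" and e0: "e \<noteq> 0" and ee: "e \<odot> e = e"
      and eu: "\<And>i. 1 \<le> i \<Longrightarrow> i < m \<Longrightarrow> tl_u m i \<odot> e = 0" using that by (auto simp: P_def)
    define c where "c = Poly_Mapping.lookup e (id_diagram m)"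
    have me: "mat e X Z = c * symm m X Z" if XZ: "X \<subseteq> {1..m}" "Z \<subseteq> {1..m}" for X Z
    proof -
      have inv: "mat e (Transposition.transpose i (i + 1) ` Y) Z = mat e Y Z"
        if "Y \<subseteq> {1..m}" "1 \<le> i" "i < m" for Y i
        using mat_u_comp[OF e that(2,3,1), of Z] eu[OF that(2,3)] by simp
      have "mat e Y Z = mat e X Z" if "Y \<subseteq> {1..m}" "card Y = card X" for Y
        using adjacent_invariant_card[of m "\<lambda>Y. mat e Y Z" Y] adjacent_invariant_card[of m "\<lambda>Y. mat e Y Z" X]
          inv that XZ by simp
      then have "mat e X Z = (\<Sum>Y\<in>Pow {1..m}. symm m X Y * mat e Y Z)"
        using sum_symm_const[OF XZ(1), of "\<lambda>Y. mat e Y Z"] by simp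
      then show ?thesis using symm_mat[OF e XZ] by (simp add: c_def)
    qed
    have "c \<noteq> 0"
    proof
      assume "c = 0"
      then have "e = 0" using me by (intro mat_eq_0[OF e]) simp
      then show False using e0 by simp
    qed
    \<comment> \<open>One entry is enough to compare the factors, and at the empty labelings the
      symmetrizer has the entry 1.\<close>
    have "mat (e \<odot> e) {} {} = (\<Sum>Y\<in>Pow {1..m}. c * c * (symm m {} Y * symm m Y {}))"
      unfolding mat_comp[OF e e] by (intro sum.cong) (auto simp: me mult_ac)
    also have "\<dots> = c * c * symm m {} {}"
      using symm_idem[of "{}" m "{}"] by (simp flip: sum_distrib_left)
    finally have "c * c = c" using ee me[of "{}" "{}"] by (simp add: symm_def)
    then have "c = 1" using \<open>c \<noteq> 0\<close> by simp
    then show ?thesis using me ms by (intro mat_inj[OF e s]) simp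
  qed
  ultimately have "JW m = s"
    unfolding JW_def P_def[symmetric] by (intro the_equality)
  then show "JW m \<in> Hom m m" "X \<subseteq> {1..m} \<Longrightarrow> Y \<subseteq> {1..m} \<Longrightarrow> mat (JW m) X Y = symm m X Y"
    using s ms by auto
qed

section \<open>Lattice words and their vectors\<close>

text \<open>
  Words in the letters 1 and 2 are read from right to left, so that the head of the list is the
  letter added last. For a fixed \<open>k\<close>, the function \<open>phi w k\<close> is the common row of the matrix
  of the element \<open>f\<close> of the word at all the labelings \<open>X\<close> of the top points with \<open>card X = k\<close>.
\<close>

primrec height :: "nat list \<Rightarrow> nat" where
  "height [] = 0"
| "height (c # w) = (if c = 1 then Suc (height w) else height w - 1)"

primrec lattice :: "nat list \<Rightarrow> bool" where
  "lattice [] = True"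
| "lattice (c # w) = (lattice w \<and> (c = 1 \<or> c = 2 \<and> 0 < height w))"

text \<open>For letter 1, the symmetrizer on \<open>a + 1\<close> strands averages over all
  positions of \<open>k\<close> marks, and the last strand is marked with frequency
  \<open>k / (a + 1)\<close>. For letter 2, the signs are those of bending the last of
  \<open>a\<close> strands. The companion \<open>idx\<close> is the number of marks at the top of
  the shorter word, where a bent strand is marked exactly if the new bottom point is not.\<close>

definition coef :: "nat \<Rightarrow> nat \<Rightarrow> nat \<Rightarrow> bool \<Rightarrow> rat" where
  "coef c a k b = (if c = 1 then (if b then of_nat k / (of_nat a + 1) else (of_nat a + 1 - of_nat k) / (of_nat a + 1))
     else (if b then (- 1) ^ (a + 1) else (- 1) ^ a))"

definition idx :: "nat \<Rightarrow> nat \<Rightarrow> bool \<Rightarrow> nat" where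
  "idx c k b = (if c = 1 then (if b then k - 1 else k) else (if b then k else k + 1))"

primrec phi :: "nat list \<Rightarrow> nat \<Rightarrow> nat set \<Rightarrow> rat" where
  "phi [] k Y = 1"
| "phi (c # w) k Y = coef c (height w) k (Suc (length w) \<in> Y) *
     phi w (idx c k (Suc (length w) \<in> Y)) (Y - {Suc (length w)})"

primrec gam :: "nat list \<Rightarrow> rat" where
  "gam [] = 1"
| "gam (c # w) = (if c = 1 then gam w else gam w * ((of_nat (height w) + 1) / of_nat (height w)))"

text \<open>Column minus row, where the row of a new entry is one more than the number of earlier
  entries in its column.\<close>

primrec word_content :: "nat list \<Rightarrow> nat \<Rightarrow> int" where
  "word_content [] i = 0"
| "word_content (c # w) i = (if i = Suc (length w)
     then (if c = 1 then - int (count_list w 1) else 1 - int (count_list w 2)) else word_content w i)"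

definition lattice_words :: "nat \<Rightarrow> nat list set" where
  "lattice_words n = {w. length w = n \<and> lattice w}"

text \<open>The matrix of \<open>EE'\<close>: the binomial coefficient counts the labelings of the
  intermediate points with \<open>k\<close> marks, which all contribute the same product.\<close>

definition word_idem :: "nat list \<Rightarrow> nat set \<Rightarrow> nat set \<Rightarrow> rat" where
  "word_idem w Y Z = (\<Sum>k\<le>height w. of_nat (height w choose k) * (phi w k Y * phi w k Z)) / gam w"

lemma gam_pos: "lattice w \<Longrightarrow> 0 < gam w"
  by (induction w) auto

lemma lattice_counts:
  "lattice w \<Longrightarrow> count_list w 1 = height w + count_list w 2 \<and> length w = count_list w 1 + count_list w 2"
  by (induction w) auto

text \<open>The index leaves the range only for letter 1, if all \<open>height w + 1\<close> top
  points are marked and the new bottom point is not; there the coefficient vanishes.\<close>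

lemma idx_le:
  assumes "lattice (c # w)" "k \<le> height (c # w)"
  shows "coef c (height w) k b = 0 \<or> idx c k b \<le> height w"
  using assms by (auto simp: coef_def idx_def)

text \<open>An added line passes its mark on, while a bent strand trades a mark at the top for an
  unmarked bottom point and vice versa. So each letter 2 raises the difference between
  \<open>card Y\<close> and \<open>k\<close> by one.\<close>

lemma phi_weight:
  assumes "lattice w" "k \<le> height w" "phi w k Y \<noteq> 0" "Y \<subseteq> {1..length w}"
  shows "card Y = k + count_list w 2"
  using assms
proof (induction w arbitrary: k Y)
  case (Cons c w)
  let ?N = "Suc (length w)"
  have ne: "coef c (height w) k (?N \<in> Y) \<noteq> 0" "phi w (idx c k (?N \<in> Y)) (Y - {?N}) \<noteq> 0"
    using Cons.prems by auto
  then have le: "idx c k (?N \<in> Y) \<le> height w" using idx_le[OF Cons.prems(1,2)] by blast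
  have sub: "Y - {?N} \<subseteq> {1..length w}" using Cons.prems(4) by auto
  have IH: "card (Y - {?N}) = idx c k (?N \<in> Y) + count_list w 2"
    using Cons.IH[OF _ le ne(2) sub] Cons.prems(1) by simp
  have fin: "finite Y" using Cons.prems(4) finite_subset by blast
  show ?case
  proof (cases "?N \<in> Y")
    case True
    then have "card Y = Suc (card (Y - {?N}))" by (rule card.remove[OF fin])
    then show ?thesis using IH True ne(1) Cons.prems(1) by (auto simp: idx_def coef_def)
  next
    case False
    then have "Y - {?N} = Y" by simp
    then show ?thesis using IH False Cons.prems(1) by (auto simp: idx_def)
  qed
qed auto

lemma phi_nonzero:
  assumes "lattice w" "k \<le> height w"
  shows "\<exists>Y\<subseteq>{1..length w}. phi w k Y \<noteq> 0"
  using assms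
proof (induction w arbitrary: k)
  case (Cons c w)
  let ?N = "Suc (length w)"
  have *: "\<exists>Y\<subseteq>{1..?N}. phi (c # w) k Y \<noteq> 0"
    if b: "coef c (height w) k b \<noteq> 0" for b
  proof -
    have "idx c k b \<le> height w" using idx_le[OF Cons.prems] b by blast
    then obtain Y where Y: "Y \<subseteq> {1..length w}" "phi w (idx c k b) Y \<noteq> 0"
      using Cons.IH Cons.prems(1) by auto
    define Y' where "Y' = (if b then insert ?N Y else Y)"
    have "?N \<notin> Y" using Y(1) by auto
    then have "?N \<in> Y' \<longleftrightarrow> b" "Y' - {?N} = Y" by (auto simp: Y'_def)
    then have "phi (c # w) k Y' \<noteq> 0" using Y b by simp
    moreover have "Y' \<subseteq> {1..?N}" using Y(1) by (auto simp: Y'_def)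
    ultimately show ?thesis by blast
  qed
  have "coef c (height w) k False \<noteq> 0 \<or> coef c (height w) k True \<noteq> 0"
  proof (cases "k = Suc (height w)")
    case True
    then show ?thesis by (simp add: coef_def add.commute add_eq_0_iff)
  next
    case False
    then have "k \<le> height w" using Cons.prems by (auto split: if_splits)
    then have "(of_nat k :: rat) \<le> of_nat (height w)" by simp
    then have "of_nat (height w) + 1 - of_nat k \<noteq> (0 :: rat)" by linarith
    moreover have "of_nat (height w) + 1 \<noteq> (0 :: rat)" by (simp add: add_eq_0_iff)
    ultimately show ?thesis by (simp add: coef_def)
  qed
  then show ?case using * by auto
qed auto

text \<open>The scalar identities for letter 1 in the cases where both labels of the last position
  contribute.\<close>

lemma raise_lower_algebra:
  fixes A l p :: rat
  assumes "A \<noteq> 0"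
  shows "(l + 1) / A * p + (A - (l + 1)) / A * ((l + 1) * p) = (l + 1) * ((A - l) / A * p)"
    and "(A - (l + 1)) / A * p + (l + 1) / A * ((A - 1 - l) * p) = (A - (l + 1)) * ((l + 1 + 1) / A * p)"
  using assms by (simp_all add: field_simps)

text \<open>
  \<^const>\<open>phi\<close> intertwines the raising (\<open>phi_raise\<close>) and lowering (\<open>phi_lower\<close>) operators of the tensor powers
  of the two-dimensional representation.
\<close>
lemma phi_raise:
  assumes "lattice w" "k \<le> height w" "Y \<subseteq> {1..length w}"
  shows "(\<Sum>j\<in>{1..length w} - Y. phi w k (insert j Y)) = of_nat k * phi w (k - 1) Y"
  using assms
proof (induction w arbitrary: k Y)
  case (Cons c w)
  let ?N = "Suc (length w)" and ?a = "height w"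
  have lw: "lattice w" using Cons.prems by simp
  have sub: "Y - {?N} \<subseteq> {1..length w}" using Cons.prems(3) by auto
  \<comment> \<open>The coefficient is carried along because the induction hypothesis requires an
    index in the range, and outside of it the coefficient is 0.\<close>
  have IH: "coef c ?a k b * (\<Sum>j\<in>{1..length w} - (Y - {?N}). phi w (idx c k b) (insert j (Y - {?N}))) =
      coef c ?a k b * (of_nat (idx c k b) * phi w (idx c k b - 1) (Y - {?N}))" for b
    using idx_le[OF Cons.prems(1,2), of b] Cons.IH[OF lw _ sub] by auto
  have a1: "of_nat ?a + 1 \<noteq> (0 :: rat)" by (simp add: add_eq_0_iff)
  show ?case
  proof (cases "?N \<in> Y")
    case True
    have "(\<Sum>j\<in>{1..length (c # w)} - Y. phi (c # w) k (insert j Y)) =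
        (\<Sum>j\<in>{1..length w} - (Y - {?N}). coef c ?a k True * phi w (idx c k True) (insert j (Y - {?N})))"
    proof (rule sum.cong)
      show "{1..length (c # w)} - Y = {1..length w} - (Y - {?N})" using True by (auto simp: le_Suc_eq)
      fix j assume "j \<in> {1..length w} - (Y - {?N})"
      then have "insert j Y - {?N} = insert j (Y - {?N})" by auto
      then show "phi (c # w) k (insert j Y) = coef c ?a k True * phi w (idx c k True) (insert j (Y - {?N}))"
        using True by simp
    qed
    also have "\<dots> = coef c ?a k True * (of_nat (idx c k True) * phi w (idx c k True - 1) (Y - {?N}))"
      using IH[of True] by (simp add: sum_distrib_left)
    also have "\<dots> = of_nat k * phi (c # w) (k - 1) Y"
      using True by (cases k) (auto simp: coef_def idx_def)
    finally show ?thesis .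
  next
    case False
    have Y: "Y - {?N} = Y" using False by simp
    have "{1..length (c # w)} - Y = insert ?N ({1..length w} - Y)" using False by auto
    then have "(\<Sum>j\<in>{1..length (c # w)} - Y. phi (c # w) k (insert j Y)) =
        phi (c # w) k (insert ?N Y) + (\<Sum>j\<in>{1..length w} - Y. phi (c # w) k (insert j Y))"
      by (simp del: phi.simps)
    also have "(\<Sum>j\<in>{1..length w} - Y. phi (c # w) k (insert j Y)) =
        (\<Sum>j\<in>{1..length w} - Y. coef c ?a k False * phi w (idx c k False) (insert j Y))"
    proof (rule sum.cong[OF refl])
      fix j assume "j \<in> {1..length w} - Y"
      then have "?N \<notin> insert j Y" using False by auto
      then show "phi (c # w) k (insert j Y) = coef c ?a k False * phi w (idx c k False) (insert j Y)" by simp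
    qed
    also have "\<dots> = coef c ?a k False * (of_nat (idx c k False) * phi w (idx c k False - 1) Y)"
      using IH[of False] Y by (simp add: sum_distrib_left)
    also have "phi (c # w) k (insert ?N Y) = coef c ?a k True * phi w (idx c k True) Y"
      using Y by simp
    also have "coef c ?a k True * phi w (idx c k True) Y +
        coef c ?a k False * (of_nat (idx c k False) * phi w (idx c k False - 1) Y) = of_nat k * phi (c # w) (k - 1) Y"
    proof (cases "c = 1")
      case True
      show ?thesis
      proof (cases k)
        case (Suc l)
        then show ?thesis using raise_lower_algebra(1)[OF a1, of "of_nat l" "phi w l Y"] True False Y
          by (simp add: coef_def idx_def ac_simps)
      qed (use True in \<open>simp add: coef_def idx_def\<close>)
    next
      case c: False
      show ?thesis
      proof (cases k)
        case (Suc l)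
        then show ?thesis using c False Y by (simp add: coef_def idx_def algebra_simps)
      qed (use c in \<open>simp add: coef_def idx_def\<close>)
    qed
    finally show ?thesis .
  qed
qed auto

lemma phi_lower:
  assumes "lattice w" "k \<le> height w" "Y \<subseteq> {1..length w}"
  shows "(\<Sum>j\<in>Y. phi w k (Y - {j})) = (of_nat (height w) - of_nat k) * phi w (k + 1) Y"
  using assms
proof (induction w arbitrary: k Y)
  case (Cons c w)
  let ?N = "Suc (length w)" and ?a = "height w"
  have lw: "lattice w" using Cons.prems by simp
  have sub: "Y - {?N} \<subseteq> {1..length w}" using Cons.prems(3) by auto
  have IH: "coef c ?a k b * (\<Sum>j\<in>Y - {?N}. phi w (idx c k b) (Y - {?N} - {j})) =
      coef c ?a k b * ((of_nat ?a - of_nat (idx c k b)) * phi w (idx c k b + 1) (Y - {?N}))" for b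
    using idx_le[OF Cons.prems(1,2), of b] Cons.IH[OF lw _ sub] by auto
  have a1: "of_nat ?a + 1 \<noteq> (0 :: rat)" by (simp add: add_eq_0_iff)
  have fin: "finite Y" using Cons.prems(3) finite_subset by blast
  have hc: "c \<noteq> 1 \<Longrightarrow> (of_nat (?a - 1) :: rat) = of_nat ?a - 1" using Cons.prems(1) by (auto simp: of_nat_diff)
  show ?case
  proof (cases "?N \<in> Y")
    case True
    have "(\<Sum>j\<in>Y. phi (c # w) k (Y - {j})) = phi (c # w) k (Y - {?N}) + (\<Sum>j\<in>Y - {?N}. phi (c # w) k (Y - {j}))"
      using True fin by (simp add: sum.remove del: phi.simps)
    also have "(\<Sum>j\<in>Y - {?N}. phi (c # w) k (Y - {j})) =
        (\<Sum>j\<in>Y - {?N}. coef c ?a k True * phi w (idx c k True) (Y - {?N} - {j}))"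
    proof (rule sum.cong[OF refl])
      fix j assume "j \<in> Y - {?N}"
      then have "?N \<in> Y - {j}" "Y - {j} - {?N} = Y - {?N} - {j}" using True by auto
      then show "phi (c # w) k (Y - {j}) = coef c ?a k True * phi w (idx c k True) (Y - {?N} - {j})"
        by (simp only: phi.simps)
    qed
    also have "\<dots> = coef c ?a k True * ((of_nat ?a - of_nat (idx c k True)) * phi w (idx c k True + 1) (Y - {?N}))"
      using IH[of True] by (simp add: sum_distrib_left)
    also have "phi (c # w) k (Y - {?N}) = coef c ?a k False * phi w (idx c k False) (Y - {?N})"
      by simp
    also have "coef c ?a k False * phi w (idx c k False) (Y - {?N}) +
        coef c ?a k True * ((of_nat ?a - of_nat (idx c k True)) * phi w (idx c k True + 1) (Y - {?N})) =
        (of_nat (height (c # w)) - of_nat k) * phi (c # w) (k + 1) Y"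
    proof (cases "c = 1")
      case c: True
      show ?thesis
      proof (cases k)
        case 0
        then show ?thesis using c True a1 by (simp add: coef_def idx_def ac_simps)
      next
        case (Suc l)
        then show ?thesis using raise_lower_algebra(2)[OF a1, of "of_nat l" "phi w (Suc l) (Y - {?N})"] c True
          by (simp add: coef_def idx_def ac_simps)
      qed
    next
      case c: False
      then show ?thesis using True hc by (simp add: coef_def idx_def algebra_simps)
    qed
    finally show ?thesis .
  next
    case False
    have Y: "Y - {?N} = Y" using False by simp
    have "(\<Sum>j\<in>Y. phi (c # w) k (Y - {j})) =
        (\<Sum>j\<in>Y. coef c ?a k False * phi w (idx c k False) (Y - {j}))"
    proof (rule sum.cong[OF refl])
      fix j assume "j \<in> Y"
      have "?N \<notin> Y - {j}" "Y - {j} - {?N} = Y - {j}" using False by auto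
      then show "phi (c # w) k (Y - {j}) = coef c ?a k False * phi w (idx c k False) (Y - {j})"
        by (simp only: phi.simps)
    qed
    also have "\<dots> = coef c ?a k False * ((of_nat ?a - of_nat (idx c k False)) * phi w (idx c k False + 1) Y)"
      using IH[of False] Y by (simp add: sum_distrib_left)
    also have "\<dots> = (of_nat (height (c # w)) - of_nat k) * phi (c # w) (k + 1) Y"
    proof (cases "c = 1")
      case c: True
      then show ?thesis using False Y a1 by (simp add: coef_def idx_def field_simps)
    next
      case c: False
      then show ?thesis using False Y hc by (simp add: coef_def idx_def algebra_simps)
    qed
    finally show ?thesis .
  qed
qed auto

text \<open>For \<open>i\<close> before the last position \<open>N\<close>, the swaps do not touch
  \<open>N\<close> and the claim passes to \<open>w\<close>. For \<open>i = N\<close>, swaps with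
  equally marked positions do nothing and are merely counted. The others move one mark between
  \<open>N\<close> and the rest, so their sum is a raising or lowering operator on \<open>w\<close>,
  evaluated by \<open>phi_raise\<close> or \<open>phi_lower\<close>. Finally
  \<open>phi_weight\<close> supplies the number of marks, which turns the total into the
  content.\<close>

lemma phi_eigen:
  assumes "lattice w" "k \<le> height w" "Z \<subseteq> {1..length w}" "1 \<le> i" "i \<le> length w"
  shows "- (\<Sum>j\<in>{1..<i}. phi w k (Transposition.transpose j i ` Z)) = of_int (word_content w i) * phi w k Z"
  using assms
proof (induction w arbitrary: k Z)
  case (Cons c w)
  let ?N = "Suc (length w)" and ?a = "height w"
  have lw: "lattice w" using Cons.prems by simp
  have sub: "Z - {?N} \<subseteq> {1..length w}" using Cons.prems(3) by auto
  have fin: "finite Z" using Cons.prems(3) finite_subset by blast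
  show ?case
  proof (cases "i = ?N")
    case False
    then have i: "1 \<le> i" "i \<le> length w" using Cons.prems by auto
    define b where "b \<longleftrightarrow> ?N \<in> Z"
    have "phi (c # w) k (Transposition.transpose j i ` Z) =
        coef c ?a k b * phi w (idx c k b) (Transposition.transpose j i ` (Z - {?N}))" if "j \<in> {1..<i}" for j
    proof -
      have t: "Transposition.transpose j i ?N = ?N" using that i by (simp add: transpose_def)
      then have "?N \<in> Transposition.transpose j i ` Z \<longleftrightarrow> b" by (simp only: in_transpose_image_iff b_def)
      moreover have "Transposition.transpose j i ` Z - {?N} = Transposition.transpose j i ` (Z - {?N})"
        using t by (simp add: image_set_diff[OF inj_transpose])
      ultimately show ?thesis by (simp only: phi.simps)
    qed
    then have "- (\<Sum>j\<in>{1..<i}. phi (c # w) k (Transposition.transpose j i ` Z)) =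
        coef c ?a k b * - (\<Sum>j\<in>{1..<i}. phi w (idx c k b) (Transposition.transpose j i ` (Z - {?N})))"
      by (simp add: sum_distrib_left sum_negf)
    also have "\<dots> = coef c ?a k b * (of_int (word_content w i) * phi w (idx c k b) (Z - {?N}))"
      using idx_le[OF Cons.prems(1,2), of b] Cons.IH[OF lw _ sub i, of "idx c k b"] by (metis mult_zero_left)
    also have "\<dots> = of_int (word_content (c # w) i) * phi (c # w) k Z"
      using False by (simp add: b_def)
    finally show ?thesis .
  next
    case i: True
    have cnt: "count_list w 1 = ?a + count_list w 2" "length w = ?a + 2 * count_list w 2"
      using lattice_counts[OF lw] by auto
    have wt: "phi (c # w) k Z = 0 \<or> card Z = k + count_list (c # w) 2"
      using phi_weight[OF Cons.prems(1,2) _ Cons.prems(3)] by blast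
    have intv: "{1..<i} = {1..length w}" using i by auto
    have a1: "of_nat ?a + 1 \<noteq> (0 :: rat)" by (simp add: add_eq_0_iff)
    have split: "(\<Sum>j\<in>{1..<i}. phi (c # w) k (Transposition.transpose j i ` Z)) =
      (\<Sum>j\<in>{1..length w} \<inter> Z. phi (c # w) k (Transposition.transpose j i ` Z)) +
      (\<Sum>j\<in>{1..length w} - Z. phi (c # w) k (Transposition.transpose j i ` Z))"
      unfolding intv by (rule sum.Int_Diff) simp
    show ?thesis
    proof (cases "?N \<in> Z")
      case True
      have int: "{1..length w} \<inter> Z = Z - {?N}" "{1..length w} - Z = {1..length w} - (Z - {?N})"
        using Cons.prems(3) by auto
      have card: "card Z = Suc (card (Z - {?N}))" by (rule card.remove[OF fin True])
      have "(\<Sum>j\<in>{1..length w} \<inter> Z. phi (c # w) k (Transposition.transpose j i ` Z)) = (\<Sum>j\<in>Z - {?N}. phi (c # w) k Z)"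
        unfolding int(1) using True i by (intro sum.cong refl) (simp add: transpose_image_same)
      moreover have "(\<Sum>j\<in>{1..length w} - Z. phi (c # w) k (Transposition.transpose j i ` Z)) =
          (\<Sum>j\<in>{1..length w} - (Z - {?N}). coef c ?a k False * phi w (idx c k False) (insert j (Z - {?N})))"
        unfolding int(2)
      proof (rule sum.cong[OF refl])
        fix j assume j: "j \<in> {1..length w} - (Z - {?N})"
        then have "j \<notin> Z" by auto
        then have t: "Transposition.transpose j i ` Z = insert j (Z - {?N})"
          using True i by (simp add: transpose_image_in)
        have "?N \<notin> insert j (Z - {?N})" using j by auto
        then show "phi (c # w) k (Transposition.transpose j i ` Z) = coef c ?a k False * phi w (idx c k False) (insert j (Z - {?N}))"
          unfolding t by simp
      qed
      moreover have "\<dots> = coef c ?a k False * (of_nat (idx c k False) * phi w (idx c k False - 1) (Z - {?N}))"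
        using idx_le[OF Cons.prems(1,2), of False] phi_raise[OF lw _ sub, of "idx c k False"]
        by (auto simp flip: sum_distrib_left)
      ultimately have sum: "(\<Sum>j\<in>{1..<i}. phi (c # w) k (Transposition.transpose j i ` Z)) =
          of_nat (card (Z - {?N})) * phi (c # w) k Z +
          coef c ?a k False * (of_nat (idx c k False) * phi w (idx c k False - 1) (Z - {?N}))"
        unfolding split by simp
      show ?thesis
      proof (cases "c = 1")
        case c: True
        \<comment> \<open>Raising in \<open>w\<close>, from the branch where \<open>N\<close> is
          unmarked, leads to the index of the branch where \<open>N\<close> is marked, so the result
          is a multiple of the original value of \<open>phi\<close>.\<close>
        have h: "coef c ?a k False * (of_nat (idx c k False) * phi w (idx c k False - 1) (Z - {?N})) =
            (of_nat ?a + 1 - of_nat k) * phi (c # w) k Z"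
          using c True by (simp add: coef_def idx_def algebra_simps)
        have eq: "- (\<Sum>j\<in>{1..<i}. phi (c # w) k (Transposition.transpose j i ` Z)) =
            - (of_nat (card (Z - {?N})) + of_nat ?a + 1 - of_nat k) * phi (c # w) k Z"
          unfolding sum h by (simp add: algebra_simps del: phi.simps)
        show ?thesis
        proof (cases "phi (c # w) k Z = 0")
          case False
          then have "Suc (card (Z - {?N})) = k + count_list w 2" using wt card c by simp
          then have "(of_nat (card (Z - {?N})) + 1 :: rat) = of_nat k + of_nat (count_list w 2)"
            by (metis Suc_eq_plus1 of_nat_1 of_nat_add)
          then have "- (of_nat (card (Z - {?N})) + of_nat ?a + 1 - of_nat k) = (of_int (word_content (c # w) i) :: rat)"
            using c i cnt(1) by simp
          then show ?thesis unfolding eq by simp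
        qed (simp only: eq mult_zero_right)
      next
        case c: False
        have h: "coef c ?a k False * (of_nat (idx c k False) * phi w (idx c k False - 1) (Z - {?N})) =
            - (of_nat k + 1) * phi (c # w) k Z"
          using c True by (simp add: coef_def idx_def algebra_simps)
        have eq: "- (\<Sum>j\<in>{1..<i}. phi (c # w) k (Transposition.transpose j i ` Z)) =
            - (of_nat (card (Z - {?N})) - of_nat k - 1) * phi (c # w) k Z"
          unfolding sum h by (simp add: algebra_simps del: phi.simps)
        have c2: "c = 2" using c Cons.prems(1) by simp
        show ?thesis
        proof (cases "phi (c # w) k Z = 0")
          case False
          then have "card (Z - {?N}) = k + count_list w 2" using wt card c2 by simp
          then have "- (of_nat (card (Z - {?N})) - of_nat k - 1) = (of_int (word_content (c # w) i) :: rat)"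
            using c2 i by simp
          then show ?thesis unfolding eq by simp
        qed (simp only: eq mult_zero_right)
      qed
    next
      case False
      have Z: "Z - {?N} = Z" using False by simp
      have int: "{1..length w} \<inter> Z = Z" using Cons.prems(3) False by (auto simp: le_Suc_eq)
      have cardc: "card ({1..length w} - Z) = length w - card Z" "card Z \<le> length w"
        using sub Z card_subset_le[of Z "length w"] by (simp_all add: card_Diff_subset fin)
      have "(\<Sum>j\<in>{1..length w} - Z. phi (c # w) k (Transposition.transpose j i ` Z)) = (\<Sum>j\<in>{1..length w} - Z. phi (c # w) k Z)"
        using False i by (intro sum.cong refl) (simp add: transpose_image_same)
      moreover have "(\<Sum>j\<in>{1..length w} \<inter> Z. phi (c # w) k (Transposition.transpose j i ` Z)) =
          (\<Sum>j\<in>Z. coef c ?a k True * phi w (idx c k True) (Z - {j}))"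
        unfolding int
      proof (rule sum.cong[OF refl])
        fix j assume j: "j \<in> Z"
        then have t: "Transposition.transpose j i ` Z = insert ?N (Z - {j})"
          using False i by (simp add: transpose_image_out)
        have "insert ?N (Z - {j}) - {?N} = Z - {j}" using False by auto
        then show "phi (c # w) k (Transposition.transpose j i ` Z) = coef c ?a k True * phi w (idx c k True) (Z - {j})"
          unfolding t by simp
      qed
      moreover have "\<dots> = coef c ?a k True * ((of_nat ?a - of_nat (idx c k True)) * phi w (idx c k True + 1) Z)"
        using idx_le[OF Cons.prems(1,2), of True] phi_lower[OF lw _ sub, of "idx c k True"] Z
        by (auto simp flip: sum_distrib_left)
      ultimately have sum: "(\<Sum>j\<in>{1..<i}. phi (c # w) k (Transposition.transpose j i ` Z)) =
          coef c ?a k True * ((of_nat ?a - of_nat (idx c k True)) * phi w (idx c k True + 1) Z) +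
          (of_nat (length w) - of_nat (card Z)) * phi (c # w) k Z"
        unfolding split using cardc by (simp add: of_nat_diff)
      show ?thesis
      proof (cases "c = 1")
        case c: True
        have h: "coef c ?a k True * ((of_nat ?a - of_nat (idx c k True)) * phi w (idx c k True + 1) Z) =
            of_nat k * phi (c # w) k Z"
          using c False Z by (cases k) (simp_all add: coef_def idx_def)
        have eq: "- (\<Sum>j\<in>{1..<i}. phi (c # w) k (Transposition.transpose j i ` Z)) =
            - (of_nat k + of_nat (length w) - of_nat (card Z)) * phi (c # w) k Z"
          unfolding sum h by (simp add: algebra_simps del: phi.simps)
        show ?thesis
        proof (cases "phi (c # w) k Z = 0")
          case False
          then have "card Z = k + count_list w 2" using wt c by simp
          then have "- (of_nat k + of_nat (length w) - of_nat (card Z)) = (of_int (word_content (c # w) i) :: rat)"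
            using c i cnt by simp
          then show ?thesis unfolding eq by simp
        qed (simp only: eq mult_zero_right)
      next
        case c: False
        have h: "coef c ?a k True * ((of_nat ?a - of_nat (idx c k True)) * phi w (idx c k True + 1) Z) =
            - (of_nat ?a - of_nat k) * phi (c # w) k Z"
          using c False Z by (simp add: coef_def idx_def algebra_simps)
        have eq: "- (\<Sum>j\<in>{1..<i}. phi (c # w) k (Transposition.transpose j i ` Z)) =
            - (of_nat (length w) - of_nat (card Z) - of_nat ?a + of_nat k) * phi (c # w) k Z"
          unfolding sum h by (simp add: algebra_simps del: phi.simps)
        have c2: "c = 2" using c Cons.prems(1) by simp
        show ?thesis
        proof (cases "phi (c # w) k Z = 0")
          case False
          then have "card Z = k + count_list w 2 + 1" using wt c2 by simp
          then have "- (of_nat (length w) - of_nat (card Z) - of_nat ?a + of_nat k) = (of_int (word_content (c # w) i) :: rat)"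
            using c2 i cnt by simp
          then show ?thesis unfolding eq by simp
        qed (simp only: eq mult_zero_right)
      qed
    qed
  qed
qed auto

text \<open>Rewrites the letter-1 sums over \<open>a + 1\<close> strands as sums over
  \<open>a\<close> strands. The three cases are that the last position is marked in both labelings,
  in neither, or in exactly one.\<close>

lemma shift_sum:
  fixes p q :: "nat \<Rightarrow> rat"
  shows "(\<Sum>k\<le>Suc a. of_nat (Suc a choose k) * ((of_nat k / (of_nat a + 1)) * p (k - 1) * ((of_nat k / (of_nat a + 1)) * q (k - 1)))) =
      (\<Sum>k\<le>a. of_nat (a choose k) * ((of_nat k + 1) / (of_nat a + 1)) * (p k * q k))"
    and "(\<Sum>k\<le>Suc a. of_nat (Suc a choose k) * ((of_nat a + 1 - of_nat k) / (of_nat a + 1) * p k * ((of_nat a + 1 - of_nat k) / (of_nat a + 1) * q k))) =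
      (\<Sum>k\<le>a. of_nat (a choose k) * ((of_nat a + 1 - of_nat k) / (of_nat a + 1)) * (p k * q k))"
    and "(\<Sum>k\<le>Suc a. of_nat (Suc a choose k) * (of_nat k / (of_nat a + 1) * p (k - 1) * ((of_nat a + 1 - of_nat k) / (of_nat a + 1) * q k))) =
      (\<Sum>k\<le>a. of_nat (a choose k) * ((of_nat a - of_nat k) / (of_nat a + 1)) * (p k * q (k + 1)))"
proof -
  have a1: "of_nat a + 1 \<noteq> (0 :: rat)" by (simp add: add_eq_0_iff)
  have up: "(of_nat (Suc a choose Suc k) :: rat) = (of_nat a + 1) * of_nat (a choose k) / (of_nat k + 1)" for k
  proof -
    have "(of_nat (Suc k * (Suc a choose Suc k)) :: rat) = of_nat (Suc a * (a choose k))"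
      by (simp only: Suc_times_binomial)
    then have "(of_nat k + 1) * (of_nat (Suc a choose Suc k) :: rat) = (of_nat a + 1) * of_nat (a choose k)"
      by (simp only: of_nat_mult of_nat_Suc add.commute)
    moreover have "(of_nat k + 1 :: rat) \<noteq> 0" by (simp add: add_eq_0_iff)
    ultimately show ?thesis by (simp add: field_simps)
  qed
  have same: "(of_nat a + 1 - of_nat k) * (of_nat (Suc a choose k) :: rat) = (of_nat a + 1) * of_nat (a choose k)" if "k \<le> a" for k
  proof -
    have "(of_nat ((Suc a - k) * (Suc a choose k)) :: rat) = of_nat (Suc a * (a choose k))"
      using binomial_absorb_comp[of "Suc a" k] by simp
    moreover have "(of_nat (Suc a - k) :: rat) = of_nat a + 1 - of_nat k" using that by (simp add: of_nat_diff)
    ultimately show ?thesis by (simp only: of_nat_mult of_nat_Suc add.commute)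
  qed
  show "(\<Sum>k\<le>Suc a. of_nat (Suc a choose k) * ((of_nat k / (of_nat a + 1)) * p (k - 1) * ((of_nat k / (of_nat a + 1)) * q (k - 1)))) =
      (\<Sum>k\<le>a. of_nat (a choose k) * ((of_nat k + 1) / (of_nat a + 1)) * (p k * q k))"
  proof (subst sum.atMost_Suc_shift, simp del: binomial_Suc_Suc of_nat_Suc, rule sum.cong[OF refl])
    fix k
    have k1: "(of_nat (Suc k) :: rat) \<noteq> 0" by simp
    show "of_nat (Suc a choose Suc k) * (of_nat (Suc k) * p k * (of_nat (Suc k) * q k)) / ((of_nat a + 1) * (of_nat a + 1)) =
      of_nat (a choose k) * (of_nat k + 1) * (p k * q k) / (of_nat a + 1)"
      unfolding up using a1 k1 by (simp add: divide_simps) (simp add: algebra_simps)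
  qed
  show "(\<Sum>k\<le>Suc a. of_nat (Suc a choose k) * ((of_nat a + 1 - of_nat k) / (of_nat a + 1) * p k * ((of_nat a + 1 - of_nat k) / (of_nat a + 1) * q k))) =
      (\<Sum>k\<le>a. of_nat (a choose k) * ((of_nat a + 1 - of_nat k) / (of_nat a + 1)) * (p k * q k))"
  proof -
    have "of_nat (Suc a choose k) * ((of_nat a + 1 - of_nat k) / (of_nat a + 1) * p k * ((of_nat a + 1 - of_nat k) / (of_nat a + 1) * q k)) =
        of_nat (a choose k) * ((of_nat a + 1 - of_nat k) / (of_nat a + 1)) * (p k * q k)" if "k \<le> a" for k
    proof -
      have "of_nat (Suc a choose k) * ((of_nat a + 1 - of_nat k) / (of_nat a + 1) * p k * ((of_nat a + 1 - of_nat k) / (of_nat a + 1) * q k)) =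
        ((of_nat a + 1 - of_nat k) * of_nat (Suc a choose k)) / (of_nat a + 1) * ((of_nat a + 1 - of_nat k) / (of_nat a + 1) * (p k * q k))"
        by (simp add: mult_ac)
      also have "((of_nat a + 1 - of_nat k) * (of_nat (Suc a choose k) :: rat)) / (of_nat a + 1) = of_nat (a choose k)"
        unfolding same[OF that] using a1 by simp
      finally show ?thesis by (simp add: mult.assoc)
    qed
    then show ?thesis by simp
  qed
  show "(\<Sum>k\<le>Suc a. of_nat (Suc a choose k) * (of_nat k / (of_nat a + 1) * p (k - 1) * ((of_nat a + 1 - of_nat k) / (of_nat a + 1) * q k))) =
      (\<Sum>k\<le>a. of_nat (a choose k) * ((of_nat a - of_nat k) / (of_nat a + 1)) * (p k * q (k + 1)))"
  proof (subst sum.atMost_Suc_shift, simp del: binomial_Suc_Suc of_nat_Suc, rule sum.cong[OF refl])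
    fix k
    have k1: "(of_nat (Suc k) :: rat) \<noteq> 0" by simp
    show "of_nat (Suc a choose Suc k) * (of_nat (Suc k) * p k * ((of_nat a + 1 - of_nat (Suc k)) * q (Suc k))) / ((of_nat a + 1) * (of_nat a + 1)) =
      of_nat (a choose k) * (of_nat a - of_nat k) * (p k * q (Suc k)) / (of_nat a + 1)"
      unfolding up using a1 k1 by (simp add: divide_simps)
  qed
qed

text \<open>The counterpart for letter 2, which goes from \<open>a - 1\<close> strands up to
  \<open>a\<close> strands.\<close>

lemma down_sum:
  fixes r :: "nat \<Rightarrow> rat"
  assumes a: "0 < a"
  shows "of_nat a / (of_nat a + 1) * (\<Sum>k\<le>a - 1. of_nat (a - 1 choose k) * r k) =
      (\<Sum>k\<le>a. of_nat (a choose k) * ((of_nat a - of_nat k) / (of_nat a + 1)) * r k)"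
    and "of_nat a / (of_nat a + 1) * (\<Sum>k\<le>a - 1. of_nat (a - 1 choose k) * r (k + 1)) =
      (\<Sum>k\<le>a. of_nat (a choose k) * (of_nat k / (of_nat a + 1)) * r k)"
proof -
  obtain b where b: "a = Suc b" using a by (cases a) auto
  have "(of_nat b + 1 - of_nat k) * (of_nat (Suc b choose k) :: rat) = (of_nat b + 1) * of_nat (b choose k)" if "k \<le> b" for k
  proof -
    have "(of_nat ((Suc b - k) * (Suc b choose k)) :: rat) = of_nat (Suc b * (b choose k))"
      using binomial_absorb_comp[of "Suc b" k] by simp
    moreover have "(of_nat (Suc b - k) :: rat) = of_nat b + 1 - of_nat k" using that by (simp add: of_nat_diff)
    ultimately show ?thesis by (simp only: of_nat_mult of_nat_Suc add.commute)
  qed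
  then have e: "of_nat (b choose k) * (of_nat a * s) = of_nat (Suc b choose k) * ((of_nat a - of_nat k) * s)" if "k \<le> b" for k and s :: rat
    using that unfolding b of_nat_Suc by (metis (no_types, opaque_lifting) add.commute mult.assoc mult.commute)
  have "of_nat a / (of_nat a + 1) * (\<Sum>k\<le>a - 1. of_nat (a - 1 choose k) * r k) =
      (\<Sum>k\<le>b. of_nat (b choose k) * (of_nat a * (r k / (of_nat a + 1))))"
    unfolding b by (simp add: sum_distrib_left sum_divide_distrib mult_ac)
  also have "\<dots> = (\<Sum>k\<le>b. of_nat (Suc b choose k) * ((of_nat a - of_nat k) * (r k / (of_nat a + 1))))"
    by (intro sum.cong refl e) simp
  also have "\<dots> = (\<Sum>k\<le>a. of_nat (a choose k) * ((of_nat a - of_nat k) / (of_nat a + 1)) * r k)"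
    unfolding b sum.atMost_Suc by (simp add: mult_ac del: binomial_Suc_Suc)
  finally show "of_nat a / (of_nat a + 1) * (\<Sum>k\<le>a - 1. of_nat (a - 1 choose k) * r k) =
      (\<Sum>k\<le>a. of_nat (a choose k) * ((of_nat a - of_nat k) / (of_nat a + 1)) * r k)" .
  have e2: "of_nat (Suc b choose Suc k) * (of_nat (Suc k) * s) = of_nat a * (of_nat (b choose k) * s)" for k and s :: rat
  proof -
    have "(of_nat (Suc k * (Suc b choose Suc k)) :: rat) = of_nat (Suc b * (b choose k))"
      by (simp only: Suc_times_binomial)
    then show ?thesis unfolding b of_nat_mult by (metis (no_types, opaque_lifting) mult.assoc mult.commute)
  qed
  have "(\<Sum>k\<le>a. of_nat (a choose k) * (of_nat k / (of_nat a + 1)) * r k) =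
      (\<Sum>k\<le>b. of_nat (Suc b choose Suc k) * (of_nat (Suc k) * (r (Suc k) / (of_nat a + 1))))"
    unfolding b sum.atMost_Suc_shift by (simp add: mult_ac del: binomial_Suc_Suc of_nat_Suc)
  also have "\<dots> = (\<Sum>k\<le>b. of_nat a * (of_nat (b choose k) * (r (Suc k) / (of_nat a + 1))))"
    by (simp only: e2)
  also have "\<dots> = of_nat a / (of_nat a + 1) * (\<Sum>k\<le>a - 1. of_nat (a - 1 choose k) * r (k + 1))"
    unfolding b by (simp add: sum_distrib_left mult_ac)
  finally show "of_nat a / (of_nat a + 1) * (\<Sum>k\<le>a - 1. of_nat (a - 1 choose k) * r (k + 1)) =
      (\<Sum>k\<le>a. of_nat (a choose k) * (of_nat k / (of_nat a + 1)) * r k)" by simp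
qed

text \<open>The branching rule, a form of the Clebsch-Gordan decomposition: adding a line splits the
  idempotent of \<open>w\<close> into those of its extensions by 1 and 2. For equal last labels the
  two weights of each summand add up to 1; for different ones the contributions cancel because of
  the bending sign.\<close>

lemma word_idem_extend:
  assumes w: "lattice w"
  shows "word_idem (1 # w) Y Z + (if 0 < height w then word_idem (2 # w) Y Z else 0) =
    (if Suc (length w) \<in> Y \<longleftrightarrow> Suc (length w) \<in> Z
     then word_idem w (Y - {Suc (length w)}) (Z - {Suc (length w)}) else 0)"
proof -
  let ?N = "Suc (length w)" and ?a = "height w"
  define p where "p k = phi w k (Y - {?N})" for k
  define q where "q k = phi w k (Z - {?N})" for k
  have a1: "of_nat ?a + 1 \<noteq> (0 :: rat)" by (simp add: add_eq_0_iff)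
  have g0: "gam w \<noteq> 0" using gam_pos[OF w] by simp
  define D where "D = (\<Sum>k\<le>Suc ?a. of_nat (Suc ?a choose k) * (phi (1 # w) k Y * phi (1 # w) k Z))"
  have D: "word_idem (1 # w) Y Z = D / gam w" by (simp add: word_idem_def D_def del: phi.simps binomial_Suc_Suc sum.atMost_Suc)
  \<comment> \<open>The factor is \<open>gam w / gam (2 # w)\<close>, so that both summands get the
    denominator \<open>gam w\<close>.\<close>
  define M where "M = (if 0 < ?a then of_nat ?a / (of_nat ?a + 1) *
      (\<Sum>k\<le>?a - 1. of_nat (?a - 1 choose k) * (phi (2 # w) k Y * phi (2 # w) k Z)) else 0)"
  have M: "(if 0 < ?a then word_idem (2 # w) Y Z else 0) = M / gam w"
    by (simp add: word_idem_def M_def mult_ac del: phi.simps)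
  have sgn: "((- 1) ^ ?a :: rat) * (- 1) ^ ?a = 1" by (simp add: minus_one_power_iff)
  have DM: "D + M = (if ?N \<in> Y \<longleftrightarrow> ?N \<in> Z then (\<Sum>k\<le>?a. of_nat (?a choose k) * (p k * q k)) else 0)"
  proof (cases "?N \<in> Y")
    case Y: True
    show ?thesis
    proof (cases "?N \<in> Z")
      case Z: True
      have "D = (\<Sum>k\<le>?a. of_nat (?a choose k) * ((of_nat k + 1) / (of_nat ?a + 1)) * (p k * q k))"
        unfolding D_def shift_sum(1)[symmetric] using Y Z by (simp add: coef_def idx_def p_def q_def del: sum.atMost_Suc binomial_Suc_Suc)
      moreover have "M = (\<Sum>k\<le>?a. of_nat (?a choose k) * ((of_nat ?a - of_nat k) / (of_nat ?a + 1)) * (p k * q k))"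
      proof (cases "0 < ?a")
        case True
        have "phi (2 # w) k Y * phi (2 # w) k Z = p k * q k" for k
          using Y Z sgn by (simp add: coef_def idx_def p_def q_def mult.left_commute)
        then show ?thesis unfolding M_def using True down_sum(1)[OF True, of "\<lambda>k. p k * q k"] by simp
      qed (simp add: M_def)
      ultimately have "D + M = (\<Sum>k\<le>?a. of_nat (?a choose k) * (p k * q k))"
        by (simp add: sum.distrib[symmetric] distrib_right[symmetric] distrib_left[symmetric] add_divide_distrib[symmetric] a1 add.commute)
      then show ?thesis using Y Z by simp
    next
      case Z: False
      have "D = (\<Sum>k\<le>?a. of_nat (?a choose k) * ((of_nat ?a - of_nat k) / (of_nat ?a + 1)) * (p k * q (k + 1)))"
        unfolding D_def shift_sum(3)[symmetric] using Y Z by (simp add: coef_def idx_def p_def q_def del: sum.atMost_Suc binomial_Suc_Suc)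
      moreover have "M = - (\<Sum>k\<le>?a. of_nat (?a choose k) * ((of_nat ?a - of_nat k) / (of_nat ?a + 1)) * (p k * q (k + 1)))"
      proof (cases "0 < ?a")
        case True
        have "phi (2 # w) k Y * phi (2 # w) k Z = - (p k * q (k + 1))" for k
          using Y Z sgn by (simp add: coef_def idx_def p_def q_def mult.left_commute)
        then show ?thesis unfolding M_def using True down_sum(1)[OF True, of "\<lambda>k. p k * q (k + 1)"] by (simp add: sum_negf)
      qed (simp add: M_def)
      ultimately show ?thesis using Y Z by simp
    qed
  next
    case Y: False
    show ?thesis
    proof (cases "?N \<in> Z")
      case Z: True
      have "D = (\<Sum>k\<le>Suc ?a. of_nat (Suc ?a choose k) * (of_nat k / (of_nat ?a + 1) * q (k - 1) * ((of_nat ?a + 1 - of_nat k) / (of_nat ?a + 1) * p k)))"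
        unfolding D_def using Y Z by (intro sum.cong refl) (simp add: coef_def idx_def p_def q_def mult_ac)
      also have "\<dots> = (\<Sum>k\<le>?a. of_nat (?a choose k) * ((of_nat ?a - of_nat k) / (of_nat ?a + 1)) * (q k * p (k + 1)))"
        by (rule shift_sum(3))
      moreover have "M = - (\<Sum>k\<le>?a. of_nat (?a choose k) * ((of_nat ?a - of_nat k) / (of_nat ?a + 1)) * (q k * p (k + 1)))"
      proof (cases "0 < ?a")
        case True
        have "phi (2 # w) k Y * phi (2 # w) k Z = - (q k * p (k + 1))" for k
          using Y Z sgn by (simp add: coef_def idx_def p_def q_def mult_ac)
        then show ?thesis unfolding M_def using True down_sum(1)[OF True, of "\<lambda>k. q k * p (k + 1)"] by (simp add: sum_negf)
      qed (simp add: M_def)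
      ultimately show ?thesis using Y Z by simp
    next
      case Z: False
      have "D = (\<Sum>k\<le>?a. of_nat (?a choose k) * ((of_nat ?a + 1 - of_nat k) / (of_nat ?a + 1)) * (p k * q k))"
        unfolding D_def shift_sum(2)[symmetric] using Y Z by (simp add: coef_def idx_def p_def q_def del: sum.atMost_Suc binomial_Suc_Suc)
      moreover have "M = (\<Sum>k\<le>?a. of_nat (?a choose k) * (of_nat k / (of_nat ?a + 1)) * (p k * q k))"
      proof (cases "0 < ?a")
        case True
        have "phi (2 # w) k Y * phi (2 # w) k Z = p (k + 1) * q (k + 1)" for k
          using Y Z sgn by (simp add: coef_def idx_def p_def q_def mult.left_commute)
        then show ?thesis unfolding M_def using True down_sum(2)[OF True, of "\<lambda>k. p k * q k"] by simp
      qed (simp add: M_def)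
      ultimately have "D + M = (\<Sum>k\<le>?a. of_nat (?a choose k) * (p k * q k))"
        by (simp add: sum.distrib[symmetric] distrib_right[symmetric] distrib_left[symmetric] add_divide_distrib[symmetric] a1)
      then show ?thesis using Y Z by simp
    qed
  qed
  have "word_idem (1 # w) Y Z + (if 0 < ?a then word_idem (2 # w) Y Z else 0) = (D + M) / gam w"
    unfolding D M by (simp add: add_divide_distrib)
  then show ?thesis unfolding DM by (simp add: word_idem_def p_def q_def)
qed

lemma lattice_words_0: "lattice_words 0 = {[]}"
  by (auto simp: lattice_words_def)

lemma lattice_words_Suc:
  "lattice_words (Suc n) = (#) 1 ` lattice_words n \<union> (#) 2 ` {w \<in> lattice_words n. 0 < height w}"
  by (auto simp: lattice_words_def image_iff length_Suc_conv)

lemma finite_lattice_words: "finite (lattice_words n)"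
  by (induction n) (simp_all add: lattice_words_0 lattice_words_Suc)

lemma sum_word_idem:
  assumes "Y \<subseteq> {1..n}" "Z \<subseteq> {1..n}"
  shows "(\<Sum>w\<in>lattice_words n. word_idem w Y Z) = of_bool (Y = Z)"
  using assms
proof (induction n arbitrary: Y Z)
  case 0
  then show ?case by (simp add: lattice_words_0 word_idem_def)
next
  case (Suc n)
  have fin: "finite (lattice_words n)" by (rule finite_lattice_words)
  have "(\<Sum>w\<in>lattice_words (Suc n). word_idem w Y Z) =
      (\<Sum>w\<in>lattice_words n. word_idem (1 # w) Y Z) + (\<Sum>w\<in>{w \<in> lattice_words n. 0 < height w}. word_idem (2 # w) Y Z)"
    unfolding lattice_words_Suc using fin
    by (subst sum.union_disjoint) (auto simp: sum.reindex)
  also have "(\<Sum>w\<in>{w \<in> lattice_words n. 0 < height w}. word_idem (2 # w) Y Z) =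
      (\<Sum>w\<in>lattice_words n. if 0 < height w then word_idem (2 # w) Y Z else 0)"
    by (rule sum.inter_filter[OF fin])
  also have "(\<Sum>w\<in>lattice_words n. word_idem (1 # w) Y Z) + \<dots> =
      (\<Sum>w\<in>lattice_words n. if Suc n \<in> Y \<longleftrightarrow> Suc n \<in> Z then word_idem w (Y - {Suc n}) (Z - {Suc n}) else 0)"
    unfolding sum.distrib[symmetric] using word_idem_extend by (intro sum.cong refl) (auto simp: lattice_words_def)
  also have "\<dots> = (if Suc n \<in> Y \<longleftrightarrow> Suc n \<in> Z then of_bool (Y - {Suc n} = Z - {Suc n}) else 0)"
  proof -
    have "Y - {Suc n} \<subseteq> {1..n}" "Z - {Suc n} \<subseteq> {1..n}" using Suc.prems by (auto simp: le_Suc_eq)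
    then show ?thesis using Suc.IH[of "Y - {Suc n}" "Z - {Suc n}"] by simp
  qed
  also have "\<dots> = of_bool (Y = Z)" by auto
  finally show ?case .
qed

section \<open>The elements built from Jones-Wenzl idempotents\<close>

lemma lattice_appendD: "lattice (u @ w) \<Longrightarrow> lattice w"
  by (induction u) auto

lemma height_replicate [simp]:
  "height (replicate e 1 @ w) = height w + e" "height (replicate e (Suc 0) @ w) = height w + e"
  "height (replicate e 2 @ w) = height w - e"
  by (induction e) auto

lemma lattice_replicate:
  "lattice (replicate e 1 @ w) = lattice w"
  "lattice (replicate e 2 @ w) \<longleftrightarrow> lattice w \<and> e \<le> height w"
  by (induction e) auto

text \<open>Within a run of letters 2 the factors \<open>(a + 1) / a\<close> telescope to the factor
  of a block in \<open>gamma_t\<close>.\<close>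

lemma gam_replicate:
  "gam (replicate e 1 @ w) = gam w" "gam (replicate e (Suc 0) @ w) = gam w"
  "e \<le> height w \<Longrightarrow> gam (replicate e 2 @ w) = gam w * ((of_nat (height w) + 1) / (of_nat (height w) - of_nat e + 1))"
proof -
  show "gam (replicate e 1 @ w) = gam w" "gam (replicate e (Suc 0) @ w) = gam w" by (induction e) auto
  show "e \<le> height w \<Longrightarrow> gam (replicate e 2 @ w) = gam w * ((of_nat (height w) + 1) / (of_nat (height w) - of_nat e + 1))"
  proof (induction e)
    case 0
    have "of_nat (height w) + 1 \<noteq> (0 :: rat)" by (simp add: add_eq_0_iff)
    then show ?case by simp
  next
    case (Suc e)
    define r :: rat where "r = of_nat (height w - e)"
    have r: "of_nat (height w) - of_nat e = r" using Suc.prems by (simp add: r_def of_nat_diff)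
    have "0 < r" using Suc.prems by (simp add: r_def)
    have "gam (replicate (Suc e) 2 @ w) = gam (replicate e 2 @ w) * ((r + 1) / r)"
      by (simp add: r_def)
    also have "gam (replicate e 2 @ w) = gam w * ((of_nat (height w) + 1) / (r + 1))"
      using Suc.IH Suc.prems unfolding r by simp
    also have "gam w * ((of_nat (height w) + 1) / (r + 1)) * ((r + 1) / r) = gam w * ((of_nat (height w) + 1) / r)"
      using \<open>0 < r\<close> by simp
    also have "r = of_nat (height w) - of_nat (Suc e) + 1" using r by simp
    finally show ?case .
  qed
qed

lemma sum_card_Suc:
  "sum_card (Suc a) k g = sum_card a k g + (if k = 0 then 0 else sum_card a (k - 1) (\<lambda>X. g (insert (Suc a) X)))"
proof -
  let ?P = "\<lambda>k. {Y \<in> Pow {1..a}. card Y = k}"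
  have fin: "finite (?P k)" for k by simp
  show ?thesis
  proof (cases k)
    case 0
    have "{Y \<in> Pow {1..Suc a}. card Y = 0} = ?P 0"
    proof -
      have "Y = {}" if "Y \<subseteq> {1..Suc a}" "card Y = 0" for Y
        using that finite_subset[of Y "{1..Suc a}"] by simp
      then show ?thesis by auto
    qed
    then show ?thesis using 0 by (simp add: sum_card_def)
  next
    case (Suc l)
    have "{Y \<in> Pow {1..Suc a}. card Y = Suc l} = ?P (Suc l) \<union> insert (Suc a) ` ?P l"
    proof (intro equalityI subsetI)
      fix Y assume "Y \<in> {Y \<in> Pow {1..Suc a}. card Y = Suc l}"
      then have Y: "Y \<subseteq> {1..Suc a}" "card Y = Suc l" by auto
      then have finY: "finite Y" using finite_subset by blast
      show "Y \<in> ?P (Suc l) \<union> insert (Suc a) ` ?P l"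
      proof (cases "Suc a \<in> Y")
        case True
        have "Y - {Suc a} \<in> ?P l" using Y finY True by auto
        moreover have "Y = insert (Suc a) (Y - {Suc a})" using True by auto
        ultimately show ?thesis by blast
      next
        case False
        then have "Y \<subseteq> {1..a}" using Y by (auto simp: le_Suc_eq)
        then show ?thesis using Y by simp
      qed
    next
      fix Y assume "Y \<in> ?P (Suc l) \<union> insert (Suc a) ` ?P l"
      then show "Y \<in> {Y \<in> Pow {1..Suc a}. card Y = Suc l}"
      proof
        assume "Y \<in> insert (Suc a) ` ?P l"
        then obtain X where X: "X \<subseteq> {1..a}" "card X = l" "Y = insert (Suc a) X" by auto
        then have "finite X" "Suc a \<notin> X" using finite_subset by auto
        then show ?thesis using X by auto
      qed auto
    qed
    moreover have "?P (Suc l) \<inter> insert (Suc a) ` ?P l = {}" by auto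
    moreover have "inj_on (insert (Suc a)) (?P l)"
    proof (rule inj_onI)
      fix X Y assume XY: "X \<in> ?P l" "Y \<in> ?P l" "insert (Suc a) X = insert (Suc a) Y"
      then have "Suc a \<notin> X" "Suc a \<notin> Y" by auto
      then show "X = Y" using XY(3) by (metis insert_ident)
    qed
    ultimately show ?thesis
      using Suc fin by (simp add: sum_card_def sum.union_disjoint sum.reindex)
  qed
qed

lemma sum_card_cong:
  "(\<And>X. X \<subseteq> {1..a} \<Longrightarrow> card X = k \<Longrightarrow> g X = h X) \<Longrightarrow> sum_card a k g = sum_card a k h"
  unfolding sum_card_def by (intro sum.cong) auto

lemma sum_card_0: "sum_card a k (\<lambda>X. 0) = 0"
  by (simp add: sum_card_def)

lemma sum_card_too_large:
  assumes "a < k"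
  shows "sum_card a k g = 0"
proof -
  have "card Y \<noteq> k" if "Y \<subseteq> {1..a}" for Y using card_subset_le[OF that] assms by simp
  then show ?thesis unfolding sum_card_def by (intro sum.neutral) auto
qed

definition realizes :: "tl \<Rightarrow> nat list \<Rightarrow> bool" where
  "realizes g w \<longleftrightarrow> g \<in> Hom (height w) (length w) \<and>
     (\<forall>X Y. X \<subseteq> {1..height w} \<longrightarrow> Y \<subseteq> {1..length w} \<longrightarrow> mat g X Y = phi w (card X) Y)"

text \<open>The last line forces its top point to carry the mark of its bottom point, which leaves
  one of the two terms of \<open>sum_card_Suc\<close>; the quotient of the binomial coefficients is
  \<open>coef\<close>. Only sums over all \<open>X\<close> with \<open>k\<close> marks are
  considered, because the symmetrizer on top averages over them. In this way one \<open>JW\<close>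
  for a whole run of lines has the same effect as one after each line.\<close>

lemma add_lines_phi:
  assumes g: "realizes g w" and k: "k \<le> height w + e" and Y: "Y \<subseteq> {1..length w + e}"
  shows "sum_card (height w + e) k (\<lambda>X. mat (add_lines (height w) (length w) e g) X Y) =
    of_nat (height w + e choose k) * phi (replicate e 1 @ w) k Y"
  using k Y
proof (induction e arbitrary: k Y)
  case 0
  then show ?case using g by (intro sum_card_const) (simp add: mat_add_lines_0 realizes_def)
next
  case (Suc e)
  let ?a = "height w + e" and ?N = "Suc (length w + e)"
  let ?G = "\<lambda>e X Y. mat (add_lines (height w) (length w) e g) X Y"
  have gH: "g \<in> Hom (height w) (length w)" using g by (simp add: realizes_def)
  have finY: "finite Y" using Suc.prems(2) finite_subset by blast
  have sub: "Y - {?N} \<subseteq> {1..length w + e}" using Suc.prems(2) by (auto simp: le_Suc_eq)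
  have G: "?G (Suc e) X Y = (if Suc ?a \<in> X \<longleftrightarrow> ?N \<in> Y then ?G e (X - {Suc ?a}) (Y - {?N}) else 0)"
    if "finite X" for X
    using mat_add_lines_Suc[OF gH that finY] .
  have low: "sum_card ?a l (\<lambda>X. ?G (Suc e) X Y) = (if ?N \<in> Y then 0 else sum_card ?a l (\<lambda>X. ?G e X (Y - {?N})))" for l
  proof (cases "?N \<in> Y")
    case True
    have "sum_card ?a l (\<lambda>X. ?G (Suc e) X Y) = sum_card ?a l (\<lambda>X. 0)"
    proof (rule sum_card_cong)
      fix X assume "X \<subseteq> {1..?a}"
      then have "finite X" "Suc ?a \<notin> X" using finite_subset by auto
      then show "?G (Suc e) X Y = 0" using G[of X] True by simp
    qed
    then show ?thesis using True by (simp add: sum_card_0)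
  next
    case False
    have "sum_card ?a l (\<lambda>X. ?G (Suc e) X Y) = sum_card ?a l (\<lambda>X. ?G e X (Y - {?N}))"
    proof (rule sum_card_cong)
      fix X assume "X \<subseteq> {1..?a}"
      then have "finite X" "Suc ?a \<notin> X" using finite_subset by auto
      then show "?G (Suc e) X Y = ?G e X (Y - {?N})" using G[of X] False by simp
    qed
    then show ?thesis using False by simp
  qed
  have high: "sum_card ?a l (\<lambda>X. ?G (Suc e) (insert (Suc ?a) X) Y) = (if ?N \<in> Y then sum_card ?a l (\<lambda>X. ?G e X (Y - {?N})) else 0)" for l
  proof (cases "?N \<in> Y")
    case True
    have "sum_card ?a l (\<lambda>X. ?G (Suc e) (insert (Suc ?a) X) Y) = sum_card ?a l (\<lambda>X. ?G e X (Y - {?N}))"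
    proof (rule sum_card_cong)
      fix X assume "X \<subseteq> {1..?a}"
      then have "finite X" "Suc ?a \<notin> X" using finite_subset by auto
      then show "?G (Suc e) (insert (Suc ?a) X) Y = ?G e X (Y - {?N})" using G[of "insert (Suc ?a) X"] True by simp
    qed
    then show ?thesis using True by simp
  next
    case False
    have "sum_card ?a l (\<lambda>X. ?G (Suc e) (insert (Suc ?a) X) Y) = sum_card ?a l (\<lambda>X. 0)"
    proof (rule sum_card_cong)
      fix X assume "X \<subseteq> {1..?a}"
      then have "finite X" using finite_subset by auto
      then show "?G (Suc e) (insert (Suc ?a) X) Y = 0" using G[of "insert (Suc ?a) X"] False by simp
    qed
    then show ?thesis using False by (simp add: sum_card_0)
  qed
  have split: "sum_card (height w + Suc e) k (\<lambda>X. ?G (Suc e) X Y) =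
      sum_card ?a k (\<lambda>X. ?G (Suc e) X Y) + (if k = 0 then 0 else sum_card ?a (k - 1) (\<lambda>X. ?G (Suc e) (insert (Suc ?a) X) Y))"
    unfolding add_Suc_right by (rule sum_card_Suc)
  have ph: "phi (replicate (Suc e) 1 @ w) k Y = coef 1 ?a k (?N \<in> Y) * phi (replicate e 1 @ w) (idx 1 k (?N \<in> Y)) (Y - {?N})"
    by (simp add: add.commute)
  have a1: "of_nat ?a + 1 \<noteq> (0 :: rat)" using of_nat_0_le_iff[of ?a, where 'a=rat] by linarith
  show ?case
  proof (cases "?N \<in> Y")
    case True
    show ?thesis
    proof (cases k)
      case 0
      then show ?thesis unfolding split low ph using True by (simp add: coef_def)
    next
      case (Suc l)
      then have l: "l \<le> ?a" using Suc.prems(1) by simp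
      have "sum_card (height w + Suc e) k (\<lambda>X. ?G (Suc e) X Y) = of_nat (?a choose l) * phi (replicate e 1 @ w) l (Y - {?N})"
        unfolding split low high using True Suc Suc.IH[OF l sub] by simp
      moreover have "of_nat (?a choose l) = of_nat (height w + Suc e choose k) * (of_nat k / (of_nat ?a + 1) :: rat)"
      proof -
        have "(of_nat (Suc l * (Suc ?a choose Suc l)) :: rat) = of_nat (Suc ?a * (?a choose l))"
          by (simp only: Suc_times_binomial)
        then have "of_nat k * (of_nat (Suc ?a choose k) :: rat) = (of_nat ?a + 1) * of_nat (?a choose l)"
          unfolding Suc by (simp only: of_nat_mult of_nat_Suc add.commute)
        then show ?thesis using a1 by (simp add: field_simps del: binomial_Suc_Suc)
      qed
      moreover have "phi (replicate (Suc e) 1 @ w) k Y = of_nat k / (of_nat ?a + 1) * phi (replicate e 1 @ w) l (Y - {?N})"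
        unfolding ph using True Suc by (simp add: coef_def idx_def)
      ultimately show ?thesis by (simp only: mult.assoc)
    qed
  next
    case False
    have "sum_card (height w + Suc e) k (\<lambda>X. ?G (Suc e) X Y) = sum_card ?a k (\<lambda>X. ?G e X (Y - {?N}))"
      unfolding split low high using False by simp
    also have "\<dots> = of_nat (height w + Suc e choose k) * phi (replicate (Suc e) 1 @ w) k Y"
    proof (cases "k \<le> ?a")
      case True
      have "of_nat (?a choose k) = of_nat (height w + Suc e choose k) * ((of_nat ?a + 1 - of_nat k) / (of_nat ?a + 1) :: rat)"
      proof -
        have "(of_nat ((Suc ?a - k) * (Suc ?a choose k)) :: rat) = of_nat (Suc ?a * (?a choose k))"
          using binomial_absorb_comp[of "Suc ?a" k] by simp
        moreover have "(of_nat (Suc ?a - k) :: rat) = of_nat ?a + 1 - of_nat k" using True by (simp add: of_nat_diff)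
        ultimately have "(of_nat ?a + 1 - of_nat k) * (of_nat (Suc ?a choose k) :: rat) = (of_nat ?a + 1) * of_nat (?a choose k)"
          by (simp only: of_nat_mult of_nat_Suc add.commute)
        then show ?thesis using a1 by (simp add: field_simps del: binomial_Suc_Suc)
      qed
      moreover have "phi (replicate (Suc e) 1 @ w) k Y = (of_nat ?a + 1 - of_nat k) / (of_nat ?a + 1) * phi (replicate e 1 @ w) k (Y - {?N})"
        unfolding ph using False by (simp add: coef_def idx_def)
      ultimately show ?thesis using Suc.IH[OF True sub] by (simp only: mult.assoc)
    next
      case k: False
      then have "k = Suc ?a" using Suc.prems(1) by simp
      then show ?thesis unfolding ph using False by (simp add: coef_def sum_card_too_large)
    qed
    finally show ?thesis .
  qed
qed

lemma realizes_JW: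
  assumes g: "realizes g w"
  shows "realizes (JW (height w + e) \<odot> add_lines (height w) (length w) e g) (replicate e 1 @ w)"
proof -
  let ?a = "height w + e"
  have H: "add_lines (height w) (length w) e g \<in> Hom ?a (length w + e)"
    using g by (intro Hom_add_lines) (simp add: realizes_def)
  have "mat (JW ?a \<odot> add_lines (height w) (length w) e g) X Y = phi (replicate e 1 @ w) (card X) Y"
    if XY: "X \<subseteq> {1..?a}" "Y \<subseteq> {1..length w + e}" for X Y
  proof -
    have "mat (JW ?a \<odot> add_lines (height w) (length w) e g) X Y =
        (\<Sum>X'\<in>Pow {1..?a}. symm ?a X X' * mat (add_lines (height w) (length w) e g) X' Y)"
      unfolding mat_comp[OF JW H] using XY by (intro sum.cong refl) (simp add: mat_JW)
    also have "\<dots> = phi (replicate e 1 @ w) (card X) Y"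
      unfolding sum_symm add_lines_phi[OF g card_subset_le[OF XY(1)] XY(2)] using card_subset_le[OF XY(1)] by simp
    finally show ?thesis .
  qed
  then show ?thesis using Hom_comp[OF JW H] by (simp add: realizes_def add.commute)
qed

lemma realizes_bend:
  assumes g: "realizes g w" and e: "e \<le> height w"
  shows "realizes (bend (height w) (length w) e g) (replicate e 2 @ w)"
proof -
  have gH: "g \<in> Hom (height w) (length w)" using g by (simp add: realizes_def)
  have "mat (bend (height w) (length w) e g) X Y = phi (replicate e 2 @ w) (card X) Y"
    if "X \<subseteq> {1..height w - e}" "Y \<subseteq> {1..length w + e}" for X Y
    using e that
  proof (induction e arbitrary: X Y)
    case 0
    then show ?case using g by (simp add: mat_bend_0[OF gH] realizes_def)
  next
    case (Suc e)
    let ?N = "Suc (length w + e)" and ?a = "height w"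
    have fin: "finite X" "finite Y" using Suc.prems finite_subset by blast+
    have sub: "Y - {?N} \<subseteq> {1..length w + e}" using Suc.prems(3) by (auto simp: le_Suc_eq)
    have "{1..?a - Suc e} \<subseteq> {1..?a - e}" by auto
    then have X1: "X \<subseteq> {1..?a - e}" using Suc.prems(2) by blast
    moreover have "?a - e \<in> {1..?a - e}" using Suc.prems(1) by simp
    ultimately have X: "X \<subseteq> {1..?a - e}" "insert (?a - e) X \<subseteq> {1..?a - e}" by blast+
    have "?a - e \<notin> X"
    proof
      assume "?a - e \<in> X"
      then have "?a - e \<le> ?a - Suc e" using Suc.prems(2) by auto
      then show False using Suc.prems(1) by simp
    qed
    then have card: "card (insert (?a - e) X) = Suc (card X)" using fin by simp
    have "?a - e = Suc (?a - Suc e)" using Suc.prems(1) by simp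
    then have sgn: "(- 1 :: rat) ^ (?a - e + 1) = (- 1) ^ (?a - Suc e)" by simp
    have "mat (bend ?a (length w) (Suc e) g) X Y =
      (if ?N \<in> Y then (- 1) ^ (?a - Suc e) * phi (replicate e 2 @ w) (card X) (Y - {?N})
       else (- 1) ^ (?a - e) * phi (replicate e 2 @ w) (Suc (card X)) (Y - {?N}))"
      unfolding mat_bend_Suc[OF gH Suc.prems(1,2) fin(2)]
      using Suc.IH[OF _ X(1) sub] Suc.IH[OF _ X(2) sub] Suc.prems(1) card by auto
    also have "\<dots> = phi (replicate (Suc e) 2 @ w) (card X) Y"
      using sgn by (simp add: coef_def idx_def add.commute)
    finally show ?case .
  qed
  then show ?thesis using Hom_bend[OF gH e] by (simp add: realizes_def add.commute)
qed

section \<open>Blocks of letters and the recursion for \<open>g_elem\<close>\<close>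

definition block_word :: "(nat \<times> nat) list \<Rightarrow> nat list" where
  "block_word bs = concat (map (\<lambda>(d, m). replicate d 1 @ replicate m 2) bs)"

text \<open>After reversal the letter added last is at the head, so a new block is prepended, its
  letters 2 in front of its letters 1.\<close>

lemma block_word_take_Suc:
  assumes "i < length bs"
  shows "rev (block_word (take (Suc i) bs)) =
    replicate (snd (bs ! i)) 2 @ replicate (fst (bs ! i)) 1 @ rev (block_word (take i bs))"
  using assms by (simp add: block_word_def take_Suc_conv_app_nth case_prod_beta)

lemma block_word_counts:
  assumes "i \<le> length bs"
  shows "count_list (block_word (take i bs)) 1 = (\<Sum>j<i. fst (bs ! j))"
    and "count_list (block_word (take i bs)) 2 = (\<Sum>j<i. snd (bs ! j))"
    and "length (block_word (take i bs)) = (\<Sum>j<i. fst (bs ! j) + snd (bs ! j))"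
proof -
  have rep: "count_list (replicate k x) y = (if x = y then k else 0)" for k and x y :: nat
    by (induction k) auto
  have "count_list (block_word (take i bs)) 1 = (\<Sum>j<i. fst (bs ! j)) \<and>
    count_list (block_word (take i bs)) 2 = (\<Sum>j<i. snd (bs ! j)) \<and>
    length (block_word (take i bs)) = (\<Sum>j<i. fst (bs ! j) + snd (bs ! j))"
    using assms
    by (induction i) (simp_all add: block_word_def take_Suc_conv_app_nth case_prod_beta rep)
  then show "count_list (block_word (take i bs)) 1 = (\<Sum>j<i. fst (bs ! j))"
    "count_list (block_word (take i bs)) 2 = (\<Sum>j<i. snd (bs ! j))"
    "length (block_word (take i bs)) = (\<Sum>j<i. fst (bs ! j) + snd (bs ! j))" by blast+
qed

lemma block_word_take_lattice:
  assumes "lattice (rev (block_word bs))"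
  shows "lattice (rev (block_word (take i bs)))"
proof -
  have "block_word bs = block_word (take i bs) @ block_word (drop i bs)"
    unfolding block_word_def by (metis append_take_drop_id concat_append map_append)
  then show ?thesis using assms lattice_appendD by (metis rev_append)
qed

text \<open>In a lattice word, every stage has at least as many letters 1 as letters 2, so the
  subtraction in \<open>block_width\<close> is exact.\<close>

lemma block_width_height:
  assumes l: "lattice (rev (block_word bs))" and i: "i < length bs"
  shows "block_width bs i = height (rev (block_word (take i bs))) + fst (bs ! i)"
proof -
  have "count_list (block_word (take i bs)) 1 = height (rev (block_word (take i bs))) + count_list (block_word (take i bs)) 2"
    using lattice_counts[OF block_word_take_lattice[OF l, of i]] by (simp add: count_list_rev)
  moreover have "(\<Sum>j\<le>i. fst (bs ! j)) = (\<Sum>j<i. fst (bs ! j)) + fst (bs ! i)"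
    by (simp flip: lessThan_Suc_atMost)
  ultimately show ?thesis
    using block_word_counts[of i bs] i by (simp add: block_width_def)
qed

lemma snd_le_block_width:
  assumes l: "lattice (rev (block_word bs))" and i: "i < length bs"
  shows "snd (bs ! i) \<le> block_width bs i"
  using block_word_take_lattice[OF l, of "Suc i"]
  unfolding block_word_take_Suc[OF i] lattice_replicate block_width_height[OF assms] by simp

lemma realizes_g_elem:
  assumes l: "lattice (rev (block_word bs))" and i: "i \<le> length bs"
  shows "realizes (g_elem bs i) (rev (block_word (take i bs)))"
  using i
proof (induction i)
  case 0
  have "{} \<in> diagrams 0 0" using id_diagram_diagrams[of 0] by (simp add: id_diagram_def)
  then show ?case
    by (simp add: realizes_def block_word_def Hom_single mat_single mat_diagram_def compatible_def sg_def)
next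
  case (Suc i)
  let ?w = "rev (block_word (take i bs))"
  obtain d m where dm: "bs ! i = (d, m)" by (cases "bs ! i")
  have i: "i < length bs" using Suc.prems by simp
  have a: "block_width bs i = height ?w + d" using block_width_height[OF l i] dm by simp
  have b: "(\<Sum>j<i. fst (bs ! j) + snd (bs ! j)) = length ?w" using block_word_counts(3)[of i bs] i by simp
  have g: "g_elem bs (Suc i) = bend (height ?w + d) (length ?w + d) m (JW (height ?w + d) \<odot> add_lines (height ?w) (length ?w) d (g_elem bs i))"
    using dm a b by (simp add: Let_def)
  have "realizes (g_elem bs i) ?w" using Suc by simp
  from realizes_bend[OF realizes_JW[OF this, of d], of m]
  show ?case
    unfolding g block_word_take_Suc[OF i] using snd_le_block_width[OF l i] dm a by (simp add: add.commute)
qed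

lemma prod_gam:
  assumes l: "lattice (rev (block_word bs))" and i: "i \<le> length bs"
  shows "(\<Prod>j<i. (of_nat (block_width bs j) + 1) / (of_nat (block_width bs j) - of_nat (snd (bs ! j)) + 1)) =
    gam (rev (block_word (take i bs)))"
  using i
proof (induction i)
  case 0
  then show ?case by (simp add: block_word_def)
next
  case (Suc i)
  then have i: "i < length bs" by simp
  have "gam (rev (block_word (take (Suc i) bs))) = gam (rev (block_word (take i bs))) *
      ((of_nat (block_width bs i) + 1) / (of_nat (block_width bs i) - of_nat (snd (bs ! i)) + 1))"
    unfolding block_word_take_Suc[OF i]
    using snd_le_block_width[OF l i] block_width_height[OF l i] by (simp add: gam_replicate)
  then show ?case using Suc by simp
qed

text \<open>Inherited from matrix multiplication through \<open>mat_inj\<close>, instead of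
  comparing the loops of three stacked diagrams.\<close>

lemma comp_assoc:
  assumes x: "x \<in> Hom a b" and y: "y \<in> Hom b c" and z: "z \<in> Hom c d"
  shows "(x \<odot> y) \<odot> z = x \<odot> (y \<odot> z)"
proof (rule mat_inj[OF Hom_comp[OF Hom_comp[OF x y] z] Hom_comp[OF x Hom_comp[OF y z]]])
  fix X Z
  have "mat ((x \<odot> y) \<odot> z) X Z = (\<Sum>Y\<in>Pow {1..c}. \<Sum>W\<in>Pow {1..b}. mat x X W * mat y W Y * mat z Y Z)"
    by (simp only: mat_comp[OF Hom_comp[OF x y] z] mat_comp[OF x y] sum_distrib_right)
  also have "\<dots> = (\<Sum>W\<in>Pow {1..b}. \<Sum>Y\<in>Pow {1..c}. mat x X W * mat y W Y * mat z Y Z)"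
    by (rule sum.swap)
  also have "\<dots> = mat (x \<odot> (y \<odot> z)) X Z"
    by (simp only: mat_comp[OF x Hom_comp[OF y z]] mat_comp[OF y z] sum_distrib_left mult.assoc)
  finally show "mat ((x \<odot> y) \<odot> z) X Z = mat (x \<odot> (y \<odot> z)) X Z" .
qed

lemma comp_one_right: "x \<in> Hom a b \<Longrightarrow> x \<odot> tl_one b = x"
proof (rule mat_inj[OF Hom_comp[OF _ Hom_one]])
  fix X Y assume x: "x \<in> Hom a b" and Y: "Y \<subseteq> {1..b}"
  have "mat (x \<odot> tl_one b) X Y = (\<Sum>W\<in>Pow {1..b}. mat x X W * of_bool (W = Y))"
    unfolding mat_comp[OF x Hom_one] using Y by (intro sum.cong) (auto simp: mat_one)
  then show "mat (x \<odot> tl_one b) X Y = mat x X Y" by (simp only: sum_Pow_delta(1)[OF Y])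
qed

lemma comp_one_left: "x \<in> Hom a b \<Longrightarrow> tl_one a \<odot> x = x"
proof (rule mat_inj[OF Hom_comp[OF Hom_one]])
  fix X Y assume x: "x \<in> Hom a b" and X: "X \<subseteq> {1..a}"
  have "mat (tl_one a \<odot> x) X Y = (\<Sum>W\<in>Pow {1..a}. of_bool (W = X) * mat x W Y)"
    unfolding mat_comp[OF Hom_one x] using X by (intro sum.cong) (auto simp: mat_one)
  then show "mat (tl_one a \<odot> x) X Y = mat x X Y" by (simp only: sum_Pow_delta(2)[OF X])
qed

lemma comp_scale_left: "x \<in> Hom a b \<Longrightarrow> y \<in> Hom b c \<Longrightarrow> scale r x \<odot> y = scale r (x \<odot> y)"
  by (rule mat_inj[of _ a c])
    (auto simp: Hom_comp[of _ a b _ c] Hom_scale mat_scale mat_comp[of _ a b _ c] sum_distrib_left mult.assoc)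

lemma comp_scale_right: "x \<in> Hom a b \<Longrightarrow> y \<in> Hom b c \<Longrightarrow> x \<odot> scale r y = scale r (x \<odot> y)"
  by (rule mat_inj[of _ a c])
    (auto simp: Hom_comp[of _ a b _ c] Hom_scale mat_scale mat_comp[of _ a b _ c] sum_distrib_left mult.left_commute)

lemma comp_add_left: "x \<in> Hom a b \<Longrightarrow> x' \<in> Hom a b \<Longrightarrow> y \<in> Hom b c \<Longrightarrow> (x + x') \<odot> y = x \<odot> y + x' \<odot> y"
  by (rule mat_inj[of _ a c])
    (auto simp: Hom_comp[of _ a b _ c] Hom_add mat_add mat_comp[of _ a b _ c] distrib_right sum.distrib)

lemma comp_add_right: "x \<in> Hom a b \<Longrightarrow> y \<in> Hom b c \<Longrightarrow> y' \<in> Hom b c \<Longrightarrow> x \<odot> (y + y') = x \<odot> y + x \<odot> y'"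
  by (rule mat_inj[of _ a c])
    (auto simp: Hom_comp[of _ a b _ c] Hom_add mat_add mat_comp[of _ a b _ c] distrib_left sum.distrib)

lemma comp_zero_left [simp]: "0 \<odot> y = 0" and comp_zero_right [simp]: "x \<odot> 0 = 0"
  by (simp_all add: tl_comp_def)

lemma comp_sum_left:
  assumes "\<And>i. i \<in> I \<Longrightarrow> x i \<in> Hom a b" "y \<in> Hom b c"
  shows "(\<Sum>i\<in>I. x i) \<odot> y = (\<Sum>i\<in>I. x i \<odot> y)"
  using assms(1)
proof (induction I rule: infinite_finite_induct)
  case (insert i I)
  have "(x i + (\<Sum>i\<in>I. x i)) \<odot> y = x i \<odot> y + (\<Sum>i\<in>I. x i) \<odot> y"
    using insert.prems assms(2) by (intro comp_add_left Hom_sum) auto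
  then show ?case using insert by simp
qed auto

lemma sum_Pow_card: "(\<Sum>X\<in>Pow {1..m}. g (card X)) = (\<Sum>k\<le>m. of_nat (m choose k) * (g k :: rat))"
proof -
  have "(\<Sum>X\<in>Pow {1..m}. g (card X)) = (\<Sum>k\<in>{..m}. sum_card m k (\<lambda>X. g (card X)))"
    unfolding sum_card_def by (rule sum.group[symmetric]) (use card_subset_le in auto)
  also have "\<dots> = (\<Sum>k\<le>m. of_nat (m choose k) * g k)"
    by (intro sum.cong refl sum_card_const) simp
  finally show ?thesis .
qed

section \<open>The idempotent of a lattice word\<close>

locale word_element =
  fixes w :: "nat list" and f :: tl
  assumes lattice: "lattice w" and realizes: "realizes f w"
begin

definition n where "n = length w"
definition a where "a = height w"
definition E where "E = scale (1 / gam w) (tl_star f \<odot> f)"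

lemma f_Hom: "f \<in> Hom a n"
  and mat_f: "X \<subseteq> {1..a} \<Longrightarrow> Y \<subseteq> {1..n} \<Longrightarrow> mat f X Y = phi w (card X) Y"
  using realizes by (auto simp: realizes_def a_def n_def)

lemma star_Hom: "tl_star f \<in> Hom n a"
  by (rule Hom_star[OF f_Hom])

lemma E_Hom: "E \<in> Hom n n"
  unfolding E_def by (intro Hom_scale Hom_comp[OF star_Hom f_Hom])

lemma mat_E: "Y \<subseteq> {1..n} \<Longrightarrow> Z \<subseteq> {1..n} \<Longrightarrow> mat E Y Z = word_idem w Y Z"
proof -
  assume YZ: "Y \<subseteq> {1..n}" "Z \<subseteq> {1..n}"
  have "mat (tl_star f \<odot> f) Y Z = (\<Sum>X\<in>Pow {1..a}. phi w (card X) Y * phi w (card X) Z)"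
    unfolding mat_comp[OF star_Hom f_Hom] using YZ
    by (intro sum.cong refl) (simp add: mat_star[OF f_Hom] mat_f)
  also have "\<dots> = (\<Sum>k\<le>a. of_nat (a choose k) * (phi w k Y * phi w k Z))"
    by (rule sum_Pow_card)
  finally show ?thesis by (simp add: E_def mat_scale word_idem_def a_def)
qed

lemma f_JM:
  assumes i: "1 \<le> i" "i \<le> n"
  shows "f \<odot> \<Phi> n (JM i) = scale (of_int (word_content w i)) f"
proof (rule mat_inj[OF Hom_comp[OF f_Hom Hom_JM[OF i]] Hom_scale[OF f_Hom]])
  fix X Z assume XZ: "X \<subseteq> {1..a}" "Z \<subseteq> {1..n}"
  have "mat f X (Transposition.transpose j i ` Z) = phi w (card X) (Transposition.transpose j i ` Z)" if "j \<in> {1..<i}" for j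
    using that i by (intro mat_f[OF XZ(1)] permutes_image_subset[OF transpose_permutes XZ(2)]) auto
  then have "mat (f \<odot> \<Phi> n (JM i)) X Z = - (\<Sum>j\<in>{1..<i}. phi w (card X) (Transposition.transpose j i ` Z))"
    unfolding mat_comp_JM[OF f_Hom i XZ(2)] by simp
  also have "\<dots> = of_int (word_content w i) * phi w (card X) Z"
    using card_subset_le[OF XZ(1)] XZ(2) i by (intro phi_eigen[OF lattice]) (simp_all add: a_def n_def)
  finally show "mat (f \<odot> \<Phi> n (JM i)) X Z = mat (scale (of_int (word_content w i)) f) X Z"
    by (simp add: mat_scale mat_f[OF XZ])
qed

lemma gam0: "gam w \<noteq> 0"
  using gam_pos[OF lattice] by simp

text \<open>Up to the factor \<open>1 / gam w\<close>, a diagonal entry is a sum of nonnegative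
  multiples of squares, and the term for \<open>k = 0\<close> is positive at a suitable
  labeling.\<close>

lemma E_nonzero: "E \<noteq> 0"
proof
  assume E: "E = 0"
  obtain Y where Y: "Y \<subseteq> {1..n}" "phi w 0 Y \<noteq> 0"
    using phi_nonzero[OF lattice, of 0] by (auto simp: n_def)
  have "0 < (\<Sum>k\<le>a. of_nat (a choose k) * (phi w k Y * phi w k Y))"
  proof (rule sum_pos2[of _ 0])
    show "0 < of_nat (a choose 0) * (phi w 0 Y * phi w 0 Y)" using Y(2) by (auto simp: zero_less_mult_iff linorder_neq_iff)
  qed auto
  then have "word_idem w Y Y \<noteq> 0" using gam0 by (simp add: word_idem_def a_def)
  then show False using mat_E[OF Y(1) Y(1)] E by simp
qed

lemma JW_f: "JW a \<odot> f = f"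
proof (rule mat_inj[OF Hom_comp[OF JW f_Hom] f_Hom])
  fix X Y assume XY: "X \<subseteq> {1..a}" "Y \<subseteq> {1..n}"
  have "mat (JW a \<odot> f) X Y = (\<Sum>W\<in>Pow {1..a}. symm a X W * mat f W Y)"
    unfolding mat_comp[OF JW f_Hom] using XY by (intro sum.cong refl) (simp add: mat_JW)
  also have "\<dots> = mat f X Y" using XY by (intro sum_symm_const) (auto simp: mat_f)
  finally show "mat (JW a \<odot> f) X Y = mat f X Y" .
qed

lemma JW_corner: "y \<in> Hom a a \<Longrightarrow> JW a \<odot> y = scale (Poly_Mapping.lookup y (id_diagram a)) (JW a)"
proof (rule mat_inj[OF Hom_comp[OF JW] Hom_scale[OF JW]])
  fix X Y assume y: "y \<in> Hom a a" and XY: "X \<subseteq> {1..a}" "Y \<subseteq> {1..a}"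
  have "mat (JW a \<odot> y) X Y = (\<Sum>W\<in>Pow {1..a}. symm a X W * mat y W Y)"
    unfolding mat_comp[OF JW y] using XY by (intro sum.cong refl) (simp add: mat_JW)
  then show "mat (JW a \<odot> y) X Y = mat (scale (Poly_Mapping.lookup y (id_diagram a)) (JW a)) X Y"
    using symm_mat[OF y XY] XY by (simp add: mat_scale mat_JW)
qed

text \<open>The corner \<open>f x f\<^sup>*\<close> is a multiple of the Jones-Wenzl idempotent, hence \<open>E x E\<close> is one of \<open>E\<close>.\<close>
lemma E_corner:
  assumes x: "x \<in> Hom n n"
  shows "\<exists>c. E \<odot> x \<odot> E = scale c E"
proof -
  let ?s = "tl_star f"
  define y where "y = f \<odot> x \<odot> ?s"
  have fx: "f \<odot> x \<in> Hom a n" by (rule Hom_comp[OF f_Hom x])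
  have y: "y \<in> Hom a a" unfolding y_def by (rule Hom_comp[OF fx star_Hom])
  have "JW a \<odot> y = (JW a \<odot> f) \<odot> x \<odot> ?s"
    unfolding y_def comp_assoc[OF JW fx star_Hom, symmetric] comp_assoc[OF JW f_Hom x] ..
  then have "JW a \<odot> y = y" unfolding JW_f y_def .
  then obtain c where c: "y = scale c (JW a)" using JW_corner[OF y] by metis
  have sf: "?s \<odot> f \<in> Hom n n" by (rule Hom_comp[OF star_Hom f_Hom])
  have sfx: "?s \<odot> f \<odot> x \<in> Hom n n" by (rule Hom_comp[OF sf x])
  have "?s \<odot> f \<odot> x \<odot> (?s \<odot> f) = ?s \<odot> (f \<odot> x) \<odot> (?s \<odot> f)"
    unfolding comp_assoc[OF star_Hom f_Hom x] ..
  also have "\<dots> = ?s \<odot> (f \<odot> x \<odot> (?s \<odot> f))"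
    by (rule comp_assoc[OF star_Hom fx sf])
  also have "f \<odot> x \<odot> (?s \<odot> f) = y \<odot> f"
    unfolding y_def comp_assoc[OF fx star_Hom f_Hom] ..
  also have "\<dots> = scale c f" unfolding c comp_scale_left[OF JW f_Hom] JW_f ..
  also have "?s \<odot> scale c f = scale c (?s \<odot> f)" by (rule comp_scale_right[OF star_Hom f_Hom])
  finally have "?s \<odot> f \<odot> x \<odot> (?s \<odot> f) = scale c (?s \<odot> f)" .
  moreover have "E \<odot> x \<odot> E = scale (1 / gam w * (1 / gam w)) (?s \<odot> f \<odot> x \<odot> (?s \<odot> f))"
    unfolding E_def comp_scale_left[OF sf x] comp_scale_left[OF sfx Hom_scale[OF sf]] comp_scale_right[OF sfx sf] scale_scale ..
  ultimately have "E \<odot> x \<odot> E = scale (c / gam w) E"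
    by (simp add: E_def scale_scale mult_ac)
  then show ?thesis ..
qed

end

section \<open>Two-column tableaux as lattice words\<close>

definition occ :: "(nat \<Rightarrow> nat) \<Rightarrow> nat \<Rightarrow> nat \<Rightarrow> nat" where
  "occ col c i = card {j \<in> {1..i}. col j = c}"

definition col_word :: "(nat \<Rightarrow> nat) \<Rightarrow> nat \<Rightarrow> nat list" where
  "col_word col n = rev (map col [1..<n + 1])"

lemma occ_0 [simp]: "occ col c 0 = 0"
  by (simp add: occ_def)

lemma occ_Suc: "occ col c (Suc i) = occ col c i + of_bool (col (Suc i) = c)"
proof -
  have "{j \<in> {1..Suc i}. col j = c} = (if col (Suc i) = c then insert (Suc i) {j \<in> {1..i}. col j = c} else {j \<in> {1..i}. col j = c})"
    by (auto simp: le_Suc_eq)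
  then show ?thesis by (simp add: occ_def)
qed

lemma occ_mono: "i \<le> j \<Longrightarrow> occ col c i \<le> occ col c j"
  by (induction rule: inc_induct) (auto simp: occ_Suc)

lemma occ_less: "i < j \<Longrightarrow> col j = c \<Longrightarrow> occ col c i < occ col c j"
  using occ_mono[of i "j - 1" col c] by (cases j) (auto simp: occ_Suc)

lemma occ_pos: "1 \<le> i \<Longrightarrow> col i = c \<Longrightarrow> 1 \<le> occ col c i"
  using occ_less[of 0 i col c] by simp

lemma col_word_0 [simp]: "col_word col 0 = []"
  by (simp add: col_word_def)

lemma col_word_Suc: "col_word col (Suc n) = col (Suc n) # col_word col n"
  by (simp add: col_word_def)

lemma length_col_word [simp]: "length (col_word col n) = n"
  by (induction n) (auto simp: col_word_Suc)

lemma count_col_word: "count_list (col_word col n) c = occ col c n"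
  by (induction n) (auto simp: col_word_Suc occ_Suc)

lemma col_word_cong: "(\<And>i. 1 \<le> i \<Longrightarrow> i \<le> n \<Longrightarrow> col i = col' i) \<Longrightarrow> col_word col n = col_word col' n"
  by (induction n) (auto simp: col_word_Suc)

lemma col_word_eqD: "col_word col n = col_word col' n \<Longrightarrow> 1 \<le> i \<Longrightarrow> i \<le> n \<Longrightarrow> col i = col' i"
  by (induction n) (auto simp: col_word_Suc le_Suc_eq)

lemma lattice_col_word:
  "lattice (col_word col n) \<longleftrightarrow> (\<forall>i\<in>{1..n}. col i \<in> {1, 2}) \<and> (\<forall>i\<le>n. occ col 2 i \<le> occ col 1 i)"
proof (induction n)
  case (Suc n)
  have cnt: "lattice (col_word col n) \<Longrightarrow> occ col 1 n = height (col_word col n) + occ col 2 n"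
    using lattice_counts[of "col_word col n"] by (simp add: count_col_word)
  show ?case
  proof
    assume l: "lattice (col_word col (Suc n))"
    then have l': "lattice (col_word col n)" and c: "col (Suc n) = 1 \<or> col (Suc n) = 2 \<and> 0 < height (col_word col n)"
      by (auto simp: col_word_Suc)
    have "occ col 2 (Suc n) \<le> occ col 1 (Suc n)" using cnt[OF l'] c by (auto simp: occ_Suc)
    then show "(\<forall>i\<in>{1..Suc n}. col i \<in> {1, 2}) \<and> (\<forall>i\<le>Suc n. occ col 2 i \<le> occ col 1 i)"
      using l' c Suc.IH by (auto simp: le_Suc_eq)
  next
    assume R: "(\<forall>i\<in>{1..Suc n}. col i \<in> {1, 2}) \<and> (\<forall>i\<le>Suc n. occ col 2 i \<le> occ col 1 i)"
    then have l': "lattice (col_word col n)" using Suc.IH by auto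
    have "occ col 2 (Suc n) \<le> occ col 1 (Suc n)" "col (Suc n) \<in> {1, 2}" using R by auto
    then have "col (Suc n) = 1 \<or> col (Suc n) = 2 \<and> 0 < height (col_word col n)"
      using cnt[OF l'] by (auto simp: occ_Suc)
    then show "lattice (col_word col (Suc n))" using l' by (simp add: col_word_Suc)
  qed
qed auto

lemma word_content_col_word:
  assumes "\<And>i. 1 \<le> i \<Longrightarrow> i \<le> n \<Longrightarrow> col i \<in> {1, 2}" "1 \<le> i" "i \<le> n"
  shows "word_content (col_word col n) i = int (col i) - int (occ col (col i) i)"
  using assms
proof (induction n)
  case (Suc n)
  show ?case
  proof (cases "i = Suc n")
    case True
    have "col (Suc n) = 1 \<or> col (Suc n) = 2" using Suc.prems(1)[of "Suc n"] by auto
    then show ?thesis using True by (auto simp: col_word_Suc count_col_word occ_Suc)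
  next
    case False
    then show ?thesis using Suc by (simp add: col_word_Suc)
  qed
qed auto

text \<open>After the word \<open>v\<close>, a new entry has content \<open>- count_list v 1\<close>
  in the first column and \<open>1 - count_list v 2\<close> in the second. The latter is larger,
  because the letters 2 never outnumber the letters 1, so the content reveals the letter.\<close>

lemma word_content_inj:
  assumes "lattice v" "lattice w" "length v = length w"
    "\<And>i. 1 \<le> i \<Longrightarrow> i \<le> length v \<Longrightarrow> word_content v i = word_content w i"
  shows "v = w"
  using assms
proof (induction v arbitrary: w)
  case (Cons c v)
  then obtain d u where w: "w = d # u" "length u = length v" by (cases w) auto
  have "word_content v i = word_content u i" if "1 \<le> i" "i \<le> length v" for i
    using Cons.prems(4)[of i] that w by simp
  then have "v = u" using Cons.prems w by (intro Cons.IH) auto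
  moreover have "count_list v 2 \<le> count_list v 1" using lattice_counts[of v] Cons.prems(1) by simp
  moreover have "(if c = 1 then - int (count_list v 1) else 1 - int (count_list v 2)) =
      (if d = 1 then - int (count_list v 1) else 1 - int (count_list v 2))"
    using Cons.prems(4)[of "Suc (length v)"] unfolding w(1) \<open>v = u\<close> by simp
  moreover have "c = 1 \<or> c = 2" "d = 1 \<or> d = 2" using Cons.prems(1,2) w by auto
  ultimately have "c = d" by (cases "c = 1"; cases "d = 1"; simp)
  then show ?case using w \<open>v = u\<close> by simp
qed simp

section \<open>From standard tableaux to lattice words and back\<close>

locale two_column_tableau =
  fixes n :: nat and la :: "nat list" and t :: tableau
  assumes la: "la \<in> Par2 n" and t: "t \<in> Std la"
begin

lemma sum_la: "sum_list la = n"
  using la by (simp add: Par2_def partitions_def)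

lemma young_col: "(r, c) \<in> young la \<Longrightarrow> 1 \<le> r \<and> (c = 1 \<or> c = 2)"
  using la by (fastforce simp: Par2_def young_def)

lemma young_up: "(Suc r, c) \<in> young la \<Longrightarrow> 1 \<le> r \<Longrightarrow> (r, c) \<in> young la"
proof -
  assume r: "(Suc r, c) \<in> young la" "1 \<le> r"
  have "sorted_wrt (\<ge>) la" using la by (simp add: Par2_def partitions_def)
  then have "la ! r \<le> la ! (r - 1)" using r by (intro sorted_wrt_nth_less[of "(\<ge>)"]) (auto simp: young_def)
  then show ?thesis using r by (auto simp: young_def)
qed

lemma young_left: "(r, 2) \<in> young la \<Longrightarrow> (r, 1) \<in> young la"
  by (auto simp: young_def)

lemma t_dom: "dom t = young la"
  and t_bij: "bij_betw (\<lambda>x. the (t x)) (young la) {1..n}"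
  and t_row: "(r, c) \<in> young la \<Longrightarrow> (r, c + 1) \<in> young la \<Longrightarrow> the (t (r, c)) < the (t (r, c + 1))"
  and t_col: "(r, c) \<in> young la \<Longrightarrow> (r + 1, c) \<in> young la \<Longrightarrow> the (t (r, c)) < the (t (r + 1, c))"
  using t sum_la by (auto simp: Std_def)

lemma t_Some: "x \<in> young la \<Longrightarrow> t x = Some (the (t x))"
  using t_dom by (metis domD option.sel)

lemma cell_eq: "t x = Some i \<Longrightarrow> cell t i = x"
  unfolding cell_def
proof (rule the_equality)
  fix y assume x: "t x = Some i" and y: "t y = Some i"
  then have "x \<in> young la" "y \<in> young la" using t_dom by auto
  then show "y = x" using x y bij_betw_imp_inj_on[OF t_bij] by (metis inj_onD option.sel)
qed

lemma t_cell: "1 \<le> i \<Longrightarrow> i \<le> n \<Longrightarrow> t (cell t i) = Some i"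
proof -
  assume i: "1 \<le> i" "i \<le> n"
  then obtain x where "x \<in> young la" "the (t x) = i" using bij_betw_imp_surj_on[OF t_bij] by (metis atLeastAtMost_iff imageE)
  then have "t x = Some i" using t_Some by metis
  then show ?thesis using cell_eq by simp
qed

lemma t_iff: "t x = Some i \<longleftrightarrow> 1 \<le> i \<and> i \<le> n \<and> cell t i = x"
proof
  assume x: "t x = Some i"
  then have "x \<in> young la" using t_dom by auto
  then have "the (t x) \<in> {1..n}" using t_bij by (auto simp: bij_betw_def)
  then show "1 \<le> i \<and> i \<le> n \<and> cell t i = x" using x cell_eq by simp
qed (use t_cell in auto)

definition col where "col i = snd (cell t i)"
definition row where "row i = fst (cell t i)"

lemma cell_young: "1 \<le> i \<Longrightarrow> i \<le> n \<Longrightarrow> (row i, col i) \<in> young la"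
  using t_cell t_dom by (auto simp: row_def col_def)

lemma t_row_col: "1 \<le> i \<Longrightarrow> i \<le> n \<Longrightarrow> t (row i, col i) = Some i"
  using t_cell by (simp add: row_def col_def)

lemma col_12: "1 \<le> i \<Longrightarrow> i \<le> n \<Longrightarrow> col i \<in> {1, 2}"
  using cell_young young_col by auto

lemma column_less: "r < r' \<Longrightarrow> 1 \<le> r \<Longrightarrow> (r', c) \<in> young la \<Longrightarrow> the (t (r, c)) < the (t (r', c)) \<and> (r, c) \<in> young la"
proof (induction r' rule: less_induct)
  case (less r')
  then obtain s where s: "r' = Suc s" by (cases r') auto
  then have y: "(s, c) \<in> young la" using young_up less.prems by auto
  have "the (t (s, c)) < the (t (r', c))" using t_col[OF y] less.prems s by simp
  then show ?case using less.IH[of s] less.prems s y by (cases "r = s") auto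
qed

text \<open>A column increases downwards without gaps, so its entries up to \<open>i\<close> are
  exactly those in the rows from 1 to \<open>row i\<close>.\<close>

lemma row_eq_occ:
  assumes i: "1 \<le> i" "i \<le> n"
  shows "row i = occ col (col i) i"
proof -
  let ?c = "col i" and ?r = "row i"
  have y: "(?r, ?c) \<in> young la" by (rule cell_young[OF i])
  have yr: "(r, ?c) \<in> young la" "the (t (r, ?c)) \<le> i" if "1 \<le> r" "r \<le> ?r" for r
    using column_less[of r ?r ?c] y that t_row_col[OF i] by (cases "r = ?r"; simp)+
  have "(\<lambda>r. the (t (r, ?c))) ` {1..?r} = {j \<in> {1..i}. col j = ?c}"
  proof (intro equalityI subsetI)
    fix j assume "j \<in> (\<lambda>r. the (t (r, ?c))) ` {1..?r}"
    then obtain r where r: "1 \<le> r" "r \<le> ?r" "j = the (t (r, ?c))" by auto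
    have "t (r, ?c) = Some j" using t_Some[OF yr(1)[OF r(1,2)]] r by simp
    then show "j \<in> {j \<in> {1..i}. col j = ?c}" using yr(2)[OF r(1,2)] r(3) unfolding t_iff by (auto simp: col_def)
  next
    fix j assume "j \<in> {j \<in> {1..i}. col j = ?c}"
    then have j: "1 \<le> j" "j \<le> i" "col j = ?c" by auto
    then have jn: "j \<le> n" using i by simp
    have tj: "t (row j, ?c) = Some j" using t_row_col[OF j(1) jn] j(3) by simp
    have "row j \<le> ?r"
    proof (rule ccontr)
      assume "\<not> row j \<le> ?r"
      then have "the (t (?r, ?c)) < the (t (row j, ?c))"
        using column_less[of ?r "row j" ?c] young_col[OF y] cell_young[OF j(1) jn] j(3) by simp
      then show False using tj t_row_col[OF i] j by simp
    qed
    moreover have "1 \<le> row j" using young_col[OF cell_young[OF j(1) jn]] by simp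
    ultimately show "j \<in> (\<lambda>r. the (t (r, ?c))) ` {1..?r}" using tj by (intro image_eqI[of _ _ "row j"]) auto
  qed
  moreover have "inj_on (\<lambda>r. the (t (r, ?c))) {1..?r}"
  proof (rule inj_onI)
    fix r s assume rs: "r \<in> {1..?r}" "s \<in> {1..?r}" "the (t (r, ?c)) = the (t (s, ?c))"
    then have "(r, ?c) = (s, ?c)"
      using inj_onD[OF bij_betw_imp_inj_on[OF t_bij], of "(r, ?c)" "(s, ?c)"] yr(1) by auto
    then show "r = s" by simp
  qed
  ultimately have "card {j \<in> {1..i}. col j = ?c} = card {1..?r}" by (metis card_image)
  then show ?thesis by (simp add: occ_def)
qed

lemma content_eq: "1 \<le> i \<Longrightarrow> i \<le> n \<Longrightarrow> content t i = word_content (col_word col n) i"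
  using word_content_col_word[of n col i] col_12 row_eq_occ by (simp add: content_def row_def col_def)

text \<open>Each entry of the second column has a smaller left neighbor in the first column. Passing
  to this neighbor is injective, which compares the two counts.\<close>

lemma lattice: "lattice (col_word col n)"
  unfolding lattice_col_word
proof (intro conjI ballI allI impI)
  show "col i \<in> {1, 2}" if "i \<in> {1..n}" for i using col_12 that by simp
  fix i assume i: "i \<le> n"
  show "occ col 2 i \<le> occ col 1 i"
    unfolding occ_def
  proof (rule card_inj_on_le[where f="\<lambda>j. the (t (row j, 1))"])
    have y: "(row j, 1) \<in> young la" "the (t (row j, 1)) < j"
      if "1 \<le> j" "j \<le> i" "col j = 2" for j
    proof -
      have jn: "j \<le> n" using that i by simp
      have y2: "(row j, 2) \<in> young la" using cell_young[OF that(1) jn] that(3) by simp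
      then show y1: "(row j, 1) \<in> young la" by (rule young_left)
      have "the (t (row j, 1)) < the (t (row j, 1 + 1))" by (rule t_row) (use y1 y2 in \<open>simp_all add: numeral_2_eq_2\<close>)
      then show "the (t (row j, 1)) < j" using t_row_col[OF that(1) jn] that(3) by (simp add: numeral_2_eq_2)
    qed
    show "inj_on (\<lambda>j. the (t (row j, 1))) {j \<in> {1..i}. col j = 2}"
    proof (rule inj_onI)
      fix j k assume jk: "j \<in> {j \<in> {1..i}. col j = 2}" "k \<in> {j \<in> {1..i}. col j = 2}" "the (t (row j, 1)) = the (t (row k, 1))"
      then have "(row j, 1 :: nat) = (row k, 1)"
        using y[of j] y[of k] by (intro inj_onD[OF bij_betw_imp_inj_on[OF t_bij]]) auto
      moreover have "t (row j, 2) = Some j" "t (row k, 2) = Some k"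
        using t_row_col[of j] t_row_col[of k] jk i by auto
      ultimately show "j = k" by (metis Pair_inject option.inject)
    qed
    show "(\<lambda>j. the (t (row j, 1))) ` {j \<in> {1..i}. col j = 2} \<subseteq> {j \<in> {1..i}. col j = 1}"
    proof
      fix k assume "k \<in> (\<lambda>j. the (t (row j, 1))) ` {j \<in> {1..i}. col j = 2}"
      then obtain j where j: "1 \<le> j" "j \<le> i" "col j = 2" "k = the (t (row j, 1))" by auto
      have "t (row j, 1) = Some k" using t_Some[OF y(1)[OF j(1-3)]] j(4) by simp
      then show "k \<in> {j \<in> {1..i}. col j = 1}" using y(2)[OF j(1-3)] j unfolding t_iff by (auto simp: col_def)
    qed
  qed simp
qed

end

definition tab_word :: "nat \<Rightarrow> tableau \<Rightarrow> nat list" where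
  "tab_word n t = col_word (\<lambda>i. snd (cell t i)) n"

lemma StdPar2E:
  assumes "t \<in> StdPar2 n"
  obtains la where "two_column_tableau n la t"
  using assms by (auto simp: StdPar2_def two_column_tableau_def)

lemma tab_word_lattice: "t \<in> StdPar2 n \<Longrightarrow> tab_word n t \<in> lattice_words n"
proof -
  assume "t \<in> StdPar2 n"
  then obtain la where "two_column_tableau n la t" by (rule StdPar2E)
  then interpret two_column_tableau n la t .
  show ?thesis using lattice by (simp add: tab_word_def lattice_words_def col_def[abs_def])
qed

lemma content_tab_word:
  assumes "t \<in> StdPar2 n" "1 \<le> i" "i \<le> n"
  shows "content t i = word_content (tab_word n t) i"
proof -
  obtain la where "two_column_tableau n la t" using assms(1) by (rule StdPar2E)
  then interpret two_column_tableau n la t .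
  show ?thesis using content_eq[OF assms(2,3)] by (simp add: tab_word_def col_def[abs_def])
qed

text \<open>The word gives the columns of the entries, and \<open>row_eq_occ\<close> recovers the
  rows.\<close>

lemma tab_word_inj: "inj_on (tab_word n) (StdPar2 n)"
proof (rule inj_onI)
  fix s t assume s: "s \<in> StdPar2 n" and t: "t \<in> StdPar2 n" and eq: "tab_word n s = tab_word n t"
  obtain la where "two_column_tableau n la s" using s by (rule StdPar2E)
  then interpret s: two_column_tableau n la s .
  obtain mu where "two_column_tableau n mu t" using t by (rule StdPar2E)
  then interpret t: two_column_tableau n mu t .
  have col: "s.col i = t.col i" if "1 \<le> i" "i \<le> n" for i
    using col_word_eqD[OF eq[unfolded tab_word_def] that] by (simp add: s.col_def t.col_def)
  have "occ s.col c i = occ t.col c i" if "i \<le> n" for c i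
    unfolding occ_def using col that by (intro arg_cong[where f=card]) auto
  then have "s.row i = t.row i" if "1 \<le> i" "i \<le> n" for i
    using s.row_eq_occ t.row_eq_occ col that by simp
  then have cell: "cell s i = cell t i" if "1 \<le> i" "i \<le> n" for i
    using col that by (simp add: prod_eq_iff s.row_def t.row_def s.col_def t.col_def)
  have "s x = Some i \<longleftrightarrow> t x = Some i" for x i
    unfolding s.t_iff t.t_iff using cell by auto
  then show "s = t" by (intro ext) (metis not_None_eq)
qed

text \<open>Each \<open>i\<close> is put into the column given by its letter, in the first free row.
  Then the columns increase by construction and the rows by the lattice condition.\<close>

lemma tab_word_surj:
  assumes w: "w \<in> lattice_words n"
  shows "\<exists>t\<in>StdPar2 n. tab_word n t = w"
proof -
  define col where "col i = rev w ! (i - 1)" for i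
  have len: "length w = n" and lw: "lattice w" using w by (auto simp: lattice_words_def)
  have "map col [1..<n + 1] = rev w" by (rule nth_equalityI) (simp_all add: col_def len del: upt_Suc)
  then have wcol: "col_word col n = w" by (simp add: col_word_def)
  have c12: "\<And>i. 1 \<le> i \<Longrightarrow> i \<le> n \<Longrightarrow> col i = 1 \<or> col i = 2" and dom: "\<And>i. i \<le> n \<Longrightarrow> occ col 2 i \<le> occ col 1 i"
    using lw unfolding wcol[symmetric] lattice_col_word by auto
  have total: "occ col 1 n + occ col 2 n = n"
    using lattice_counts[OF lw] len unfolding wcol[symmetric] count_col_word by simp
  \<comment> \<open>The shape whose two columns have as many cells as there are letters 1 and
    letters 2.\<close>
  define la where "la = replicate (occ col 2 n) 2 @ replicate (occ col 1 n - occ col 2 n) (1::nat)"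
  define S where "S = {(r :: nat, c :: nat). (c = 1 \<or> c = 2) \<and> 1 \<le> r \<and> r \<le> occ col c n}"
  have d: "occ col 2 n \<le> occ col 1 n" using dom by simp
  have len_la: "length la = occ col 1 n" using d by (simp add: la_def)
  have nth_la: "la ! (r - Suc 0) = (if r \<le> occ col 2 n then 2 else 1)" if "1 \<le> r" "r \<le> occ col 1 n" for r
    using that by (auto simp: la_def nth_append)
  have young: "young la = S"
  proof (intro Set.set_eqI)
    fix x :: "nat \<times> nat"
    obtain r c where x: "x = (r, c)" by (cases x)
    consider "c = 0" | "c = 1" | "c = 2" | "2 < c" by linarith
    then show "x \<in> young la \<longleftrightarrow> x \<in> S"
      using d by cases (auto simp: x young_def S_def len_la nth_la split: if_splits)
  qed
  have sum: "sum_list la = n" using total d by (simp add: la_def sum_list_replicate)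
  have "sorted_wrt (\<ge>) (replicate k (x :: nat))" for k x by (induction k) auto
  then have "sorted_wrt (\<ge>) la" by (auto simp: la_def sorted_wrt_append)
  moreover have "\<forall>x\<in>set la. 0 < x" by (auto simp: la_def)
  ultimately have "la \<in> partitions n" using sum by (simp only: partitions_def mem_Collect_eq simp_thms)
  then have la: "la \<in> Par2 n" by (auto simp: Par2_def young S_def)
  define pos where "pos i = (occ col (col i) i, col i)" for i
  have inj: "inj_on pos {1..n}"
  proof (rule inj_onI)
    fix i j assume ij: "i \<in> {1..n}" "j \<in> {1..n}" "pos i = pos j"
    show "i = j"
    proof (rule ccontr)
      assume "i \<noteq> j"
      then consider "i < j" | "j < i" by linarith
      then show False using ij occ_less[of i j col] occ_less[of j i col] by cases (auto simp: pos_def)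
    qed
  qed
  have "pos i \<in> S" if "i \<in> {1..n}" for i
    using that c12[of i] occ_mono[of i n col "col i"] occ_pos[of i col "col i"] by (auto simp: pos_def S_def)
  then have sub: "pos ` {1..n} \<subseteq> S" by blast
  have S: "S = (\<lambda>r. (r, 1)) ` {1..occ col 1 n} \<union> (\<lambda>r. (r, 2)) ` {1..occ col 2 n}"
    by (auto simp: S_def)
  have "card S = n"
    unfolding S using total by (subst card_Un_disjoint) (auto simp: card_image inj_on_def)
  moreover have "finite S" by (simp add: S)
  ultimately have img: "pos ` {1..n} = S"
    using sub card_image[OF inj] by (intro card_subset_eq) auto
  have bij: "bij_betw pos {1..n} S" using inj img by (simp add: bij_betw_def)
  define v where "v = inv_into {1..n} pos"
  have vb: "bij_betw v S {1..n}" unfolding v_def by (rule bij_betw_inv_into[OF bij])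
  have vpos: "v (pos i) = i" if "1 \<le> i" "i \<le> n" for i
    unfolding v_def using that by (intro inv_into_f_f[OF inj]) auto
  have v: "1 \<le> v x \<and> v x \<le> n \<and> pos (v x) = x" if "x \<in> S" for x
    using that vb f_inv_into_f[of x pos "{1..n}"] img by (auto simp: bij_betw_def v_def)
  define t where "t x = (if x \<in> S then Some (v x) else None)" for x
  have tv: "the (t x) = v x" if "x \<in> S" for x using that by (simp add: t_def)
  have "t \<in> Std la"
    unfolding Std_def young sum
  proof (intro CollectI conjI allI impI)
    show "dom t = S" by (auto simp: t_def split: if_splits)
    show "bij_betw (\<lambda>x. the (t x)) S {1..n}" using vb tv by (simp cong: bij_betw_cong)
    fix r c
    show "the (t (r, c)) < the (t (r, c + 1))" if rc: "(r, c) \<in> S \<and> (r, c + 1) \<in> S"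
    proof -
      have c: "c = 1" using rc by (auto simp: S_def)
      define i j where "i = v (r, c)" and "j = v (r, c + 1)"
      have i: "1 \<le> i" "i \<le> n" "pos i = (r, 1)" and j: "1 \<le> j" "j \<le> n" "pos j = (r, 2)"
        using v[of "(r, c)"] v[of "(r, c + 1)"] rc c by (auto simp: i_def j_def numeral_2_eq_2)
      have ci: "col i = 1" "occ col 1 i = r" and cj: "col j = 2" "occ col 2 j = r"
        using i(3) j(3) by (auto simp: pos_def)
      \<comment> \<open>Otherwise the letters up to \<open>j\<close> would include \<open>r\<close>
        letters 2 but fewer than \<open>r\<close> letters 1.\<close>
      have "\<not> j \<le> i"
      proof
        assume "j \<le> i"
        then have "j < i" using ci cj by (cases "i = j") auto
        then have "occ col 1 j < r" using occ_less[of j i col 1] ci by simp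
        then show False using dom[OF j(2)] cj by simp
      qed
      then show ?thesis using tv rc by (simp add: i_def j_def)
    qed
    show "the (t (r, c)) < the (t (r + 1, c))" if rc: "(r, c) \<in> S \<and> (r + 1, c) \<in> S"
    proof -
      have "occ col c (v (r, c)) = r" "occ col c (v (r + 1, c)) = r + 1"
        using v[of "(r, c)"] v[of "(r + 1, c)"] rc by (auto simp: pos_def)
      then have "\<not> v (r + 1, c) \<le> v (r, c)" using occ_mono[of "v (r + 1, c)" "v (r, c)" col c] by auto
      then show ?thesis using tv rc by simp
    qed
  qed
  then have T: "two_column_tableau n la t" using la by (simp add: two_column_tableau_def)
  then interpret two_column_tableau n la t .
  have "snd (cell t i) = col i" if i: "1 \<le> i" "i \<le> n" for i
  proof -
    have "pos i \<in> S" using img i by auto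
    then have "t (pos i) = Some i" using vpos[OF i] by (simp add: t_def)
    then show ?thesis using cell_eq by (simp add: pos_def)
  qed
  then have "tab_word n t = w" unfolding tab_word_def wcol[symmetric] by (rule col_word_cong)
  moreover have "t \<in> StdPar2 n" using la \<open>t \<in> Std la\<close> by (auto simp: StdPar2_def)
  ultimately show ?thesis by blast
qed

lemma tab_word_bij: "bij_betw (tab_word n) (StdPar2 n) (lattice_words n)"
  unfolding bij_betw_def using tab_word_inj tab_word_lattice tab_word_surj by fastforce

lemma finite_StdPar2: "finite (StdPar2 n)"
  using bij_betw_finite[OF tab_word_bij] finite_lattice_words by simp

lemma finite_contents: "finite (contents n)"
proof -
  have "contents n \<subseteq> (\<lambda>(s, i). content s i) ` (StdPar2 n \<times> {1..n})"
    by (auto simp: contents_def)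
  then show ?thesis by (rule finite_subset) (simp add: finite_StdPar2)
qed

section \<open>Existence and uniqueness of the block decomposition\<close>

definition valid_blocks :: "(nat \<times> nat) list \<Rightarrow> bool" where
  "valid_blocks bs \<longleftrightarrow> (\<forall>(d, m)\<in>set bs. 0 < d) \<and> (\<forall>(d, m)\<in>set (butlast bs). 0 < m)"

lemma valid_blocks_Cons: "valid_blocks ((d, m) # bs) \<longleftrightarrow> 0 < d \<and> (bs = [] \<or> 0 < m) \<and> valid_blocks bs"
  by (auto simp: valid_blocks_def)

lemma block_word_simps: "block_word [] = []" "block_word ((d, m) # bs) = replicate d 1 @ replicate m 2 @ block_word bs"
  by (simp_all add: block_word_def)

text \<open>Leading letters 2 are kept apart, so that the induction can prepend any letter. A letter
  1 opens a new block if it precedes such letters or the empty word; otherwise it enlarges the first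
  block.\<close>

lemma valid_blocks_exist:
  assumes "set r \<subseteq> {1, 2}"
  shows "\<exists>e bs. r = replicate e 2 @ block_word bs \<and> valid_blocks bs"
  using assms
proof (induction r)
  case Nil
  show ?case by (intro exI[of _ 0] exI[of _ "[]"]) (simp add: block_word_simps valid_blocks_def)
next
  case (Cons c r)
  then obtain e bs where r: "r = replicate e 2 @ block_word bs" "valid_blocks bs" by auto
  show ?case
  proof (cases "c = 2")
    case True
    then show ?thesis using r by (intro exI[of _ "Suc e"] exI[of _ bs]) simp
  next
    case False
    then have c: "c = 1" using Cons.prems by auto
    show ?thesis
    proof (cases "0 < e \<or> bs = []")
      case True
      then show ?thesis using r c
        by (intro exI[of _ 0] exI[of _ "(1, e) # bs"]) (auto simp: block_word_simps valid_blocks_Cons)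
    next
      case False
      then obtain d m bs' where bs: "bs = (d, m) # bs'" by (cases bs) auto
      then show ?thesis using r c False
        by (intro exI[of _ 0] exI[of _ "(Suc d, m) # bs'"]) (auto simp: block_word_simps valid_blocks_Cons)
    qed
  qed
qed

text \<open>Validity makes the runs maximal: a following block begins with a 1 and is preceded by at
  least one 2.\<close>

lemma block_word_split:
  assumes "valid_blocks ((d, m) # bs)"
  shows "takeWhile (\<lambda>c. c = 1) (block_word ((d, m) # bs)) = replicate d 1"
    and "takeWhile (\<lambda>c. c = 2) (dropWhile (\<lambda>c. c = 1) (block_word ((d, m) # bs))) = replicate m 2"
    and "dropWhile (\<lambda>c. c = 2) (dropWhile (\<lambda>c. c = 1) (block_word ((d, m) # bs))) = block_word bs"
proof -
  define u where "u = block_word bs"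
  have u: "u = [] \<or> (\<exists>u'. u = 1 # u')"
  proof (cases bs)
    case (Cons x bs')
    obtain e k where x: "x = (e, k)" by (cases x)
    then have "0 < e" using assms Cons by (auto simp: valid_blocks_Cons)
    then obtain e' where "e = Suc e'" by (cases e) auto
    then show ?thesis using Cons x by (simp add: u_def block_word_simps)
  qed (simp add: u_def block_word_simps)
  have mu: "u = [] \<or> 0 < m" using assms by (auto simp: valid_blocks_Cons u_def block_word_simps)
  have ones: "takeWhile (\<lambda>c. c = 1) (replicate d 1 @ z) = replicate d 1 @ takeWhile (\<lambda>c. c = 1) z"
    "dropWhile (\<lambda>c. c = 1) (replicate d 1 @ z) = dropWhile (\<lambda>c. c = 1) z" for z :: "nat list"
    by (induction d) auto
  have twos: "takeWhile (\<lambda>c. c = 2) (replicate m 2 @ z) = replicate m 2 @ takeWhile (\<lambda>c. c = 2) z"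
    "dropWhile (\<lambda>c. c = 2) (replicate m 2 @ z) = dropWhile (\<lambda>c. c = 2) z" for z :: "nat list"
    by (induction m) auto
  have z1: "takeWhile (\<lambda>c. c = 1) (replicate m 2 @ u) = []" "dropWhile (\<lambda>c. c = 1) (replicate m 2 @ u) = replicate m 2 @ u"
    using mu by (cases m; auto)+
  have z2: "takeWhile (\<lambda>c. c = 2) u = []" "dropWhile (\<lambda>c. c = 2) u = u"
    using u by auto
  show "takeWhile (\<lambda>c. c = 1) (block_word ((d, m) # bs)) = replicate d 1"
    unfolding block_word_simps ones u_def[symmetric] z1 by simp
  show "takeWhile (\<lambda>c. c = 2) (dropWhile (\<lambda>c. c = 1) (block_word ((d, m) # bs))) = replicate m 2"
    unfolding block_word_simps ones u_def[symmetric] z1 twos z2 by simp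
  show "dropWhile (\<lambda>c. c = 2) (dropWhile (\<lambda>c. c = 1) (block_word ((d, m) # bs))) = block_word bs"
    unfolding block_word_simps ones u_def[symmetric] z1 twos z2 ..
qed

lemma valid_blocks_unique:
  assumes "valid_blocks bs" "valid_blocks bs'" "block_word bs = block_word bs'"
  shows "bs = bs'"
  using assms
proof (induction bs arbitrary: bs')
  case Nil
  show ?case
  proof (cases bs')
    case (Cons x bs'')
    then show ?thesis using Nil by (cases x) (auto simp: block_word_simps valid_blocks_Cons)
  qed simp
next
  case (Cons x bs)
  obtain d m where x: "x = (d, m)" by (cases x)
  note v = Cons.prems(1)[unfolded x]
  show ?case
  proof (cases bs')
    case Nil
    then show ?thesis using Cons.prems x by (auto simp: block_word_simps valid_blocks_Cons)
  next
    case bs': (Cons y bs'')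
    obtain d' m' where y: "y = (d', m')" by (cases y)
    note v' = Cons.prems(2)[unfolded bs' y]
    have eq: "block_word ((d, m) # bs) = block_word ((d', m') # bs'')" using Cons.prems(3) x y bs' by simp
    have "replicate d (1::nat) = replicate d' 1" "replicate m (2::nat) = replicate m' 2" "block_word bs = block_word bs''"
      using block_word_split[OF v] block_word_split[OF v'] unfolding eq by simp_all
    moreover have "bs = bs''"
      using calculation(3) v v' by (intro Cons.IH) (auto simp: valid_blocks_Cons)
    ultimately show ?thesis using x y bs' by (metis length_replicate)
  qed
qed

lemma blocks_tab_word:
  assumes "t \<in> StdPar2 n"
  shows "rev (block_word (blocks n t)) = tab_word n t"
proof -
  let ?r = "map (\<lambda>i. snd (cell t i)) [1..<n + 1]"
  have lw: "lattice (rev ?r)" using tab_word_lattice[OF assms] by (simp only: tab_word_def col_word_def lattice_words_def mem_Collect_eq)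
  have set: "set w \<subseteq> {1, 2}" if "lattice w" for w using that by (induction w) auto
  have "set ?r \<subseteq> {1, 2}" using set[OF lw] by (simp only: set_rev)
  then obtain e bs where r: "?r = replicate e 2 @ block_word bs" and v: "valid_blocks bs" using valid_blocks_exist by blast
  \<comment> \<open>A 2 as the letter of the first entry would be added at height 0, which the
    lattice condition forbids.\<close>
  have "e = 0"
  proof (rule ccontr)
    assume "e \<noteq> 0"
    then obtain e' where "e = Suc e'" by (cases e) auto
    then have "lattice (rev (block_word bs @ []) @ replicate e' 2 @ [2])"
      using lw unfolding r by (simp add: replicate_append_same)
    then have "lattice [2]" using lattice_appendD[of "rev (block_word bs) @ replicate e' 2" "[2]"] by simp
    then show False by simp
  qed
  then have r': "?r = block_word bs" using r by simp
  have "blocks n t = bs"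
    unfolding blocks_def block_word_def[symmetric]
  proof (rule the_equality)
    show "?r = block_word bs \<and> (\<forall>(d, m)\<in>set bs. 0 < d) \<and> (\<forall>(d, m)\<in>set (butlast bs). 0 < m)"
      using r' v by (simp only: valid_blocks_def simp_thms)
    fix bs' assume *: "?r = block_word bs' \<and> (\<forall>(d, m)\<in>set bs'. 0 < d) \<and> (\<forall>(d, m)\<in>set (butlast bs'). 0 < m)"
    then have "valid_blocks bs'" unfolding valid_blocks_def by (elim conjE) (intro conjI)
    moreover have "block_word bs' = block_word bs" using * r' by metis
    ultimately show "bs' = bs" by (intro valid_blocks_unique[OF _ v])
  qed
  then show ?thesis unfolding tab_word_def col_word_def r' by simp
qed

section \<open>Comparison of the idempotents\<close>

lemma word_element_tab:
  assumes t: "t \<in> StdPar2 n"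
  shows "word_element (tab_word n t) (f_elem n t)"
    and "EE' n t = word_element.E (tab_word n t) (f_elem n t)"
proof -
  let ?bs = "blocks n t"
  have w: "rev (block_word ?bs) = tab_word n t" by (rule blocks_tab_word[OF t])
  have l: "lattice (rev (block_word ?bs))" using tab_word_lattice[OF t] w by (simp add: lattice_words_def)
  have "realizes (f_elem n t) (tab_word n t)"
    using realizes_g_elem[OF l order_refl] w by (simp add: f_elem_def)
  then show we: "word_element (tab_word n t) (f_elem n t)"
    using l w by (simp add: word_element_def)
  have "gamma_t n t = gam (tab_word n t)"
    using prod_gam[OF l order_refl] w by (simp add: gamma_t_def Let_def)
  then show "EE' n t = word_element.E (tab_word n t) (f_elem n t)"
    by (simp add: EE'_def word_element.E_def[OF we])
qed

lemma length_tab_word [simp]: "length (tab_word n t) = n"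
  by (simp add: tab_word_def)

lemma f_elem_Hom: "t \<in> StdPar2 n \<Longrightarrow> f_elem n t \<in> Hom (height (tab_word n t)) n"
  using word_element.f_Hom[OF word_element_tab(1)] word_element.n_def[OF word_element_tab(1)]
    word_element.a_def[OF word_element_tab(1)] by fastforce

lemma EE'_Hom: "t \<in> StdPar2 n \<Longrightarrow> EE' n t \<in> Hom n n"
  using word_element.E_Hom[OF word_element_tab(1)] word_element.n_def[OF word_element_tab(1)]
    word_element_tab(2) by fastforce

lemma mat_EE':
  "t \<in> StdPar2 n \<Longrightarrow> Y \<subseteq> {1..n} \<Longrightarrow> Z \<subseteq> {1..n} \<Longrightarrow> mat (EE' n t) Y Z = word_idem (tab_word n t) Y Z"
  using word_element.mat_E[OF word_element_tab(1), of t n Y Z] word_element.n_def[OF word_element_tab(1), of t n]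
    word_element_tab(2)[of t n] by simp

lemma EE'_nonzero: "t \<in> StdPar2 n \<Longrightarrow> EE' n t \<noteq> 0"
  using word_element.E_nonzero[OF word_element_tab(1), of t n] word_element_tab(2)[of t n] by simp

lemma EE'_corner: "t \<in> StdPar2 n \<Longrightarrow> x \<in> Hom n n \<Longrightarrow> \<exists>c. EE' n t \<odot> x \<odot> EE' n t = scale c (EE' n t)"
  using word_element.E_corner[OF word_element_tab(1), of t n x] word_element.n_def[OF word_element_tab(1), of t n]
    word_element_tab(2)[of t n] by simp

lemma f_elem_JM:
  assumes t: "t \<in> StdPar2 n" and i: "1 \<le> i" "i \<le> n"
  shows "f_elem n t \<odot> \<Phi> n (JM i) = scale (of_int (content t i)) (f_elem n t)"
  using word_element.f_JM[OF word_element_tab(1)[OF t], of i] word_element.n_def[OF word_element_tab(1)[OF t]]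
    content_tab_word[OF t i] i by simp

lemma sum_EE': "(\<Sum>t\<in>StdPar2 n. EE' n t) = tl_one n"
proof (rule mat_inj[OF Hom_sum Hom_one])
  fix Y Z assume YZ: "Y \<subseteq> {1..n}" "Z \<subseteq> {1..n}"
  have "mat (\<Sum>t\<in>StdPar2 n. EE' n t) Y Z = (\<Sum>t\<in>StdPar2 n. word_idem (tab_word n t) Y Z)"
    unfolding mat_sum using YZ by (intro sum.cong refl mat_EE')
  also have "\<dots> = (\<Sum>w\<in>lattice_words n. word_idem w Y Z)"
    by (rule sum.reindex_bij_betw[OF tab_word_bij])
  finally show "mat (\<Sum>t\<in>StdPar2 n. EE' n t) Y Z = mat (tl_one n) Y Z"
    by (simp add: sum_word_idem[OF YZ] mat_one[OF YZ])
qed (rule EE'_Hom)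

section \<open>Eigenvectors of the factors of \<open>EE\<close>\<close>

definition JM_factor :: "nat \<Rightarrow> tableau \<Rightarrow> int \<Rightarrow> nat \<Rightarrow> tl" where
  "JM_factor n s c i = scale (1 / of_int (content s i - c)) (\<Phi> n (JM i) - scale (of_int c) (tl_one n))"

lemma JM_factor_Hom: "1 \<le> i \<Longrightarrow> i \<le> n \<Longrightarrow> JM_factor n s c i \<in> Hom n n"
  unfolding JM_factor_def by (intro Hom_scale Hom_diff Hom_JM Hom_one)

lemma f_elem_JM_factor:
  assumes t: "t \<in> StdPar2 n" and i: "1 \<le> i" "i \<le> n"
  shows "f_elem n t \<odot> JM_factor n s c i =
    scale ((of_int (content t i) - of_int c) / of_int (content s i - c)) (f_elem n t)"
proof -
  let ?f = "f_elem n t"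
  note f = f_elem_Hom[OF t] and L = Hom_JM[OF i] and sone = Hom_scale[OF Hom_one[of n], of "- of_int c"]
  have minus: "x - scale r y = x + scale (- r) y" for x y :: tl and r
    by (rule poly_mapping_eqI) (simp add: lookup_scale lookup_add lookup_minus)
  have "?f \<odot> (\<Phi> n (JM i) - scale (of_int c) (tl_one n)) = ?f \<odot> \<Phi> n (JM i) + ?f \<odot> scale (- of_int c) (tl_one n)"
    unfolding minus by (rule comp_add_right[OF f L sone])
  also have "\<dots> = scale (of_int (content t i)) ?f + scale (- of_int c) ?f"
    by (simp add: f_elem_JM[OF t i] comp_scale_right[OF f Hom_one] comp_one_right[OF f])
  also have "\<dots> = scale (of_int (content t i) - of_int c) ?f"
    by (simp flip: scale_add_left)
  finally show ?thesis
    unfolding JM_factor_def comp_scale_right[OF f Hom_diff[OF L Hom_scale[OF Hom_one]]] by (simp add: scale_scale)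
qed

lemma foldr_comp_Hom: "(\<And>x. x \<in> set xs \<Longrightarrow> x \<in> Hom n n) \<Longrightarrow> foldr (\<odot>) xs (tl_one n) \<in> Hom n n"
  by (induction xs) (auto intro: Hom_one Hom_comp)

lemma comp_foldr_fixed:
  assumes f: "f \<in> Hom a n" and "\<And>x. x \<in> set xs \<Longrightarrow> x \<in> Hom n n \<and> f \<odot> x = f"
  shows "f \<odot> foldr (\<odot>) xs (tl_one n) = f"
  using assms(2)
proof (induction xs)
  case Nil
  show ?case by (simp add: comp_one_right[OF f])
next
  case (Cons x xs)
  have "f \<odot> (x \<odot> foldr (\<odot>) xs (tl_one n)) = f \<odot> x \<odot> foldr (\<odot>) xs (tl_one n)"
    using Cons.prems by (intro comp_assoc[symmetric, OF f]) (auto intro: foldr_comp_Hom)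
  then show ?case using Cons by simp
qed

text \<open>The factors act on \<open>f\<close> by scalars, one after the other from the left, until
  \<open>x0\<close> annihilates it.\<close>

lemma comp_foldr_zero:
  assumes f: "f \<in> Hom a n" and "\<And>x. x \<in> set xs \<Longrightarrow> x \<in> Hom n n \<and> (\<exists>r. f \<odot> x = scale r f)"
    and "x0 \<in> set xs" "f \<odot> x0 = 0"
  shows "f \<odot> foldr (\<odot>) xs (tl_one n) = 0"
  using assms(2,3)
proof (induction xs)
  case (Cons x xs)
  have F: "foldr (\<odot>) xs (tl_one n) \<in> Hom n n" using Cons.prems(1) by (intro foldr_comp_Hom) auto
  have eq: "f \<odot> (x \<odot> foldr (\<odot>) xs (tl_one n)) = f \<odot> x \<odot> foldr (\<odot>) xs (tl_one n)"
    using Cons.prems(1)[of x] by (intro comp_assoc[symmetric, OF f _ F]) auto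
  show ?case
  proof (cases "x0 \<in> set xs")
    case True
    obtain r where r: "f \<odot> x = scale r f" using Cons.prems(1)[of x] by auto
    have "f \<odot> foldr (\<odot>) xs (tl_one n) = 0" using Cons.IH[OF _ True] Cons.prems(1) by simp
    then show ?thesis by (simp add: eq r comp_scale_left[OF f F])
  next
    case False
    then show ?thesis using Cons.prems(2) assms(4) eq by simp
  qed
qed simp

lemma EE_factors:
  obtains xs where "EE n s = foldr (\<odot>) xs (tl_one n)"
    "set xs = {JM_factor n s c i | c i. c \<in> contents n \<and> 1 \<le> i \<and> i \<le> n \<and> c \<noteq> content s i}"
proof -
  define xs where "xs = [JM_factor n s c i. c \<leftarrow> sorted_list_of_set (contents n), i \<leftarrow> [1..<n + 1], c \<noteq> content s i]"
  have "EE n s = foldr (\<odot>) xs (tl_one n)"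
    by (simp only: EE_def xs_def JM_factor_def)
  moreover have "set xs = {JM_factor n s c i | c i. c \<in> contents n \<and> 1 \<le> i \<and> i \<le> n \<and> c \<noteq> content s i}"
    unfolding xs_def using finite_contents by (auto simp: less_Suc_eq_le simp del: upt_Suc split: if_splits) (blast | force)+
  ultimately show ?thesis by (rule that)
qed

lemma EE_Hom: "EE n s \<in> Hom n n"
proof -
  obtain xs where xs: "EE n s = foldr (\<odot>) xs (tl_one n)"
    "set xs = {JM_factor n s c i | c i. c \<in> contents n \<and> 1 \<le> i \<and> i \<le> n \<and> c \<noteq> content s i}"
    by (rule EE_factors)
  show ?thesis unfolding xs(1) by (rule foldr_comp_Hom) (use JM_factor_Hom in \<open>auto simp: xs(2)\<close>)
qed

lemma content_separates:
  assumes "s \<in> StdPar2 n" "t \<in> StdPar2 n" "s \<noteq> t"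
  shows "\<exists>i. 1 \<le> i \<and> i \<le> n \<and> content s i \<noteq> content t i"
proof (rule ccontr)
  assume "\<not> ?thesis"
  then have "word_content (tab_word n s) i = word_content (tab_word n t) i" if "1 \<le> i" "i \<le> n" for i
    using that content_tab_word assms by metis
  then have "tab_word n s = tab_word n t"
    using tab_word_lattice assms by (intro word_content_inj) (auto simp: lattice_words_def)
  then show False using inj_onD[OF tab_word_inj] assms by blast
qed

text \<open>For \<open>t = s\<close> every factor is normalized so as to fix
  \<open>f_elem n t\<close>. Otherwise some \<open>i\<close> has different contents in the two
  tableaux; the factor for this \<open>i\<close> and \<open>c = content t i\<close> occurs in
  \<open>EE n s\<close> and annihilates \<open>f_elem n t\<close>.\<close>

lemma f_elem_EE:
  assumes t: "t \<in> StdPar2 n" and s: "s \<in> StdPar2 n"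
  shows "f_elem n t \<odot> EE n s = (if t = s then f_elem n t else 0)"
proof -
  obtain xs where xs: "EE n s = foldr (\<odot>) xs (tl_one n)"
    "set xs = {JM_factor n s c i | c i. c \<in> contents n \<and> 1 \<le> i \<and> i \<le> n \<and> c \<noteq> content s i}"
    by (rule EE_factors)
  show ?thesis
  proof (cases "t = s")
    case True
    have "f_elem n t \<odot> EE n s = f_elem n t"
      unfolding xs(1)
    proof (rule comp_foldr_fixed[OF f_elem_Hom[OF t]])
      fix x assume "x \<in> set xs"
      then obtain c i where x: "x = JM_factor n s c i" "1 \<le> i" "i \<le> n" "c \<noteq> content s i" unfolding xs(2) by blast
      then have "(of_int (content s i) - of_int c) / of_int (content s i - c) = (1 :: rat)" by simp
      then show "x \<in> Hom n n \<and> f_elem n t \<odot> x = f_elem n t"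
        unfolding x(1) f_elem_JM_factor[OF t x(2,3)] using JM_factor_Hom[OF x(2,3)] True by simp
    qed
    then show ?thesis using True by simp
  next
    case False
    obtain i where i: "1 \<le> i" "i \<le> n" "content s i \<noteq> content t i" using content_separates[OF s t] False by blast
    have "f_elem n t \<odot> EE n s = 0"
      unfolding xs(1)
    proof (rule comp_foldr_zero[OF f_elem_Hom[OF t]])
      have "content t i \<in> contents n" using t i by (auto simp: contents_def)
      then show "JM_factor n s (content t i) i \<in> set xs" unfolding xs(2) using i(1,2) i(3)[symmetric] by blast
      show "f_elem n t \<odot> JM_factor n s (content t i) i = 0"
        unfolding f_elem_JM_factor[OF t i(1,2)] by simp
      fix x assume "x \<in> set xs"
      then obtain c j where x: "x = JM_factor n s c j" "1 \<le> j" "j \<le> n" unfolding xs(2) by blast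
      show "x \<in> Hom n n \<and> (\<exists>r. f_elem n t \<odot> x = scale r (f_elem n t))"
        unfolding x(1) using JM_factor_Hom[OF x(2,3)] f_elem_JM_factor[OF t x(2,3)] by blast
    qed
    then show ?thesis using False by simp
  qed
qed

lemma EE'_EE:
  assumes t: "t \<in> StdPar2 n" and s: "s \<in> StdPar2 n"
  shows "EE' n t \<odot> EE n s = (if t = s then EE' n t else 0)"
proof -
  note f = f_elem_Hom[OF t] and S = Hom_star[OF f_elem_Hom[OF t]]
  have "EE' n t \<odot> EE n s = scale (1 / gamma_t n t) (tl_star (f_elem n t) \<odot> (f_elem n t \<odot> EE n s))"
    unfolding EE'_def comp_scale_left[OF Hom_comp[OF S f] EE_Hom] comp_assoc[OF S f EE_Hom] ..
  then show ?thesis unfolding f_elem_EE[OF t s] by (simp add: EE'_def)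
qed

lemma EE'_eq_EE:
  assumes s: "s \<in> StdPar2 n"
  shows "EE' n s = EE n s"
proof -
  have "EE n s = (\<Sum>t\<in>StdPar2 n. EE' n t) \<odot> EE n s"
    by (simp add: sum_EE' comp_one_left[OF EE_Hom])
  also have "\<dots> = (\<Sum>t\<in>StdPar2 n. EE' n t \<odot> EE n s)"
    by (rule comp_sum_left[OF EE'_Hom EE_Hom])
  also have "\<dots> = (\<Sum>t\<in>StdPar2 n. if t = s then EE' n s else 0)"
    using s by (intro sum.cong refl) (simp add: EE'_EE)
  also have "\<dots> = EE' n s" using s finite_StdPar2 by simp
  finally show ?thesis by simp
qed

text \<open>Once \<open>EE'\<close> and \<open>EE\<close> agree, the mixed products are the products
  in question.\<close>

lemma EE'_EE':
  "t \<in> StdPar2 n \<Longrightarrow> s \<in> StdPar2 n \<Longrightarrow> EE' n t \<odot> EE' n s = (if t = s then EE' n t else 0)"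
  using EE'_EE by (simp add: EE'_eq_EE)

lemma scale_eq_0D: "scale c x = 0 \<Longrightarrow> x \<noteq> 0 \<Longrightarrow> c = 0"
  by (metis lookup_scale lookup_zero mult_eq_0_iff poly_mapping_eqI)

text \<open>Write \<open>E\<close> for the idempotent. A summand \<open>x\<close> of an orthogonal
  decomposition satisfies \<open>E x E = x\<close>, so it is a multiple of \<open>E\<close> by
  \<open>EE'_corner\<close>. Idempotence leaves the factors 0 and 1, and then one of the summands is
  zero.\<close>

lemma primitive_EE':
  assumes t: "t \<in> StdPar2 n"
  shows "primitive_idempotent (TL n) (EE' n t)"
  unfolding primitive_idempotent_def
proof (intro conjI notI)
  let ?E = "EE' n t"
  show "idempotent_in (TL n) ?E"
    using EE'_Hom[OF t] EE'_EE'[OF t t] by (simp add: idempotent_in_def TL_simps)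
  show "?E = \<zero>\<^bsub>TL n\<^esub> \<Longrightarrow> False" using EE'_nonzero[OF t] by (simp add: TL_simps)
  assume "\<exists>x y. idempotent_in (TL n) x \<and> idempotent_in (TL n) y \<and> x \<noteq> \<zero>\<^bsub>TL n\<^esub> \<and> y \<noteq> \<zero>\<^bsub>TL n\<^esub> \<and>
    orthogonal_in (TL n) x y \<and> ?E = x \<oplus>\<^bsub>TL n\<^esub> y"
  then obtain x y where x: "x \<in> Hom n n" "x \<odot> x = x" "x \<noteq> 0" and y: "y \<in> Hom n n" "y \<noteq> 0"
    and xy: "x \<odot> y = 0" "y \<odot> x = 0" and E: "?E = x + y"
    by (auto simp: idempotent_in_def orthogonal_in_def TL_simps)
  have "?E \<odot> x = x" unfolding E comp_add_left[OF x(1) y(1) x(1)] x(2) xy by simp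
  moreover have "x \<odot> ?E = x" unfolding E comp_add_right[OF x(1) x(1) y(1)] x(2) xy by simp
  ultimately obtain c where c: "x = scale c ?E" using EE'_corner[OF t x(1)] by metis
  have "scale (c * c) ?E = x \<odot> x"
    unfolding c comp_scale_left[OF EE'_Hom[OF t] Hom_scale[OF EE'_Hom[OF t]]]
      comp_scale_right[OF EE'_Hom[OF t] EE'_Hom[OF t]] scale_scale using EE'_EE'[OF t t] by simp
  then have "scale (c * c) ?E + scale (- c) ?E = scale c ?E + scale (- c) ?E" using x(2) c by simp
  then have "scale (c * c + - c) ?E = 0" unfolding scale_add_left[symmetric] by simp
  then have "c * c + - c = 0" using scale_eq_0D EE'_nonzero[OF t] by blast
  then have "c * (c - 1) = 0" by (simp add: algebra_simps)
  then have "c = 0 \<or> c = 1" by simp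
  then show False
  proof
    assume "c = 0"
    then show False using c x(3) by simp
  next
    assume "c = 1"
    then have "x = ?E" using c by simp
    then show False using E y(2) by simp
  qed
qed

lemma abelian_monoid_TL: "abelian_monoid (TL n)"
  by (rule abelian_monoidI) (auto simp: TL_simps Hom_0 Hom_add add_ac)

lemma finsum_TL:
  assumes "finite I" "\<And>i. i \<in> I \<Longrightarrow> x i \<in> Hom n n"
  shows "(\<Oplus>\<^bsub>TL n\<^esub>i\<in>I. x i) = (\<Sum>i\<in>I. x i)"
  using assms
proof (induction I rule: finite_induct)
  case empty
  show ?case by (simp add: abelian_monoid.finsum_empty[OF abelian_monoid_TL] TL_simps)
next
  case (insert i I)
  then show ?case
    by (simp add: abelian_monoid.finsum_insert[OF abelian_monoid_TL] TL_simps)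
qed

theorem corollary3p9:
  fixes n :: nat
  shows "(\<forall>la\<in>Par2 n. \<forall>t\<in>Std la. EE' n t = EE n t) \<and>
         complete_primitive_idempotents (TL n) (StdPar2 n) (EE' n)"
proof
  show "\<forall>la\<in>Par2 n. \<forall>t\<in>Std la. EE' n t = EE n t"
    using EE'_eq_EE by (auto simp: StdPar2_def)
  show "complete_primitive_idempotents (TL n) (StdPar2 n) (EE' n)"
    unfolding complete_primitive_idempotents_def
  proof (intro conjI ballI impI)
    show "finite (StdPar2 n)" by (rule finite_StdPar2)
    show "primitive_idempotent (TL n) (EE' n t)" if "t \<in> StdPar2 n" for t
      using that by (rule primitive_EE')
    show "orthogonal_in (TL n) (EE' n s) (EE' n t)" if "s \<in> StdPar2 n" "t \<in> StdPar2 n" "s \<noteq> t" for s t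
      using that by (simp add: orthogonal_in_def TL_simps EE'_EE')
    show "(\<Oplus>\<^bsub>TL n\<^esub>t\<in>StdPar2 n. EE' n t) = \<one>\<^bsub>TL n\<^esub>"
      by (simp add: finsum_TL finite_StdPar2 EE'_Hom sum_EE' TL_simps)
  qed
qed

end
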